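(* Let $m\in\mathbb{N}$, $p\in(1,\infty)$, and let $E\subset\mathbb{R}$ be a closed set with $\#E\ge m+1$. For $f\in L^m_p(\mathbb{R})|_E$ let $F=\operatorname{Ext}_E(f:L^m_p(\mathbb{R}))$ be the function produced by the (Whitney-type) three-step construction described in the context. Then $F$ depends linearly on $f$, $F\in L^m_p(\mathbb{R})$, $F|_E=f$, and $$\|F\|_{L^m_p(\mathbb{R})}\le C(m)\,\|f\|_{L^m_p(\mathbb{R})|_E}$$ with a constant $C(m)$ depending only on $m$; that is, $\operatorname{Ext}_E(\cdot:L^m_p(\mathbb{R}))$ is a linear extension operator from $L^m_p(\mathbb{R})|_E$ into $L^m_p(\mathbb{R})$ whose operator norm is bounded by a constant depending only on $m$.
   Context: $L^m_p(\mathbb{R})$ is the space of functions $F:\mathbb{R}\to\mathbb{R}$ such that $F^{(m-1)}$ exists and is (locally) absolutely continuous and $F^{(m)}\in L_p(\mathbb{R})$, seminormed by $\|F\|_{L^m_p(\mathbb{R})}=\|F^{(m)}\|_{L_p(\mathbb{R})}$; $L^m_p(\mathbb{R})|_E$ is the space of restrictions to $E$, with $\|f\|_{L^m_p(\mathbb{R})|_E}=\inf\{\|F\|_{L^m_p(\mathbb{R})}:F\in L^m_p(\mathbb{R}),F|_E=f\}$. $L_S[f]$ is the Lagrange polynomial of degree at most $\#S-1$ interpolating $f$ on the finite set $S$; superscripts $(i)$ denote $i$-th derivatives; $S\to z$ means $\operatorname{diam}(S\cup\{z\})\to0$. Step 1 (sets $S_x$ and points $s_x$). To each nonempty finite set $A\subset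 E$, $A\ne E$, containing at most one limit point of $E$, assign a point $a_E(A)\in E$: if $A$ contains no limit point of $E$, then $a_E(A)$ is a point of $E\setminus A$ nearest to $A$ (one fixed choice for each $A$); if $A$ contains a (unique) limit point $a$ of $E$, then $a_E(A)=a$. For $x\in E$ put $y_0(x)=x$, $Y_0(x)=\{x\}$. Inductively, given $Y_j(x)=\{y_0(x),\dots,y_j(x)\}$: if $j=m-1$ or $y_j(x)$ is a limit point of $E$, stop and put $n(x)=j$; otherwise put $y_{j+1}(x)=a_E(Y_j(x))$, $Y_{j+1}(x)=Y_j(x)\cup\{y_{j+1}(x)\}$. Set $S_x=Y_{n(x)}(x)$, $s_x=y_{n(x)}(x)$. (If $\#S_x<m$, then $s_x$ is a limit point of $E$.) Step 2 (polynomials $P_x$ of degree at most $m-1$, $x\in E$). If $\#S_x=m$, then $P_x=L_{S_x}[f]$. If $\#S_x<m$, then for $f\in L^m_p(\mathbb{R})|_E$ the limits $f_i(s_x)=\lim_{S\to s_x,\,S\subset E,\,\#S=m}L^{(i)}_S[f](s_x)$ exist for $0\le i\le m-1$, and $P_x$ is the unique polynomial of degree at most $m-1$ with $P_x(y)=f(y)$ for all $y\in S_x$ and $P_x^{(i)}(s_x)=f_i(s_x)$ for $1\le i\le m-\#S_x$. Step 3 (gluing). Let $\mathcal{J}_E$ be the family of connected components (pairwise disjoint open intervals) of $\mathbb{R}\setminus E$. For $J=(a,b)\in\mathcal{J}_E$ bounded, let $H_J$ be the unique polynomial of degree at most $2m-1$ with $H_J^{(i)}(a)=P_a^{(i)}(a)$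 and $H_J^{(i)}(b)=P_b^{(i)}(b)$ for $i=0,\dots,m-1$; if $J=(-\infty,b)$ put $H_J=P_b$, and if $J=(a,+\infty)$ put $H_J=P_a$. Define $F(x)=P_x(x)$ for $x\in E$ and $F(x)=H_J(x)$ for $x\in J\in\mathcal{J}_E$. *)

theory Defs
  imports "HOL-Analysis.Analysis" "HOL-Computational_Algebra.Polynomial"
begin

section \<open>The Sobolev space and its trace space\<close>

(* A finite family of non-overlapping intervals is a finite set of pairs of end points. *)
definition abs_continuous_on :: "real \<Rightarrow> real \<Rightarrow> (real \<Rightarrow> real) \<Rightarrow> bool" where
  "abs_continuous_on a b g \<longleftrightarrow>
     (\<forall>\<epsilon>>0. \<exists>\<delta>>0. \<forall>D :: (real \<times> real) set.
        finite D \<and> (\<forall>(u, v)\<in>D. a \<le> u \<and> u \<le> v \<and> v \<le> b) \<and>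
        pairwise (\<lambda>(u, v) (u', v'). {u<..<v} \<inter> {u'<..<v'} = {}) D \<and>
        (\<Sum>(u, v)\<in>D. v - u) < \<delta>
        \<longrightarrow> (\<Sum>(u, v)\<in>D. \<bar>g v - g u\<bar>) < \<epsilon>)"

definition in_Lp :: "real \<Rightarrow> (real \<Rightarrow> real) \<Rightarrow> bool" where
  "in_Lp p g \<longleftrightarrow> g \<in> borel_measurable lebesgue \<and> integrable lebesgue (\<lambda>x. \<bar>g x\<bar> powr p)"

definition Lp_norm :: "real \<Rightarrow> (real \<Rightarrow> real) \<Rightarrow> real" where
  "Lp_norm p g = (LINT x|lebesgue. \<bar>g x\<bar> powr p) powr (1 / p)"

(* The m-th derivative is the derivative almost everywhere of the locally absolutely
   continuous (m-1)-st one; on the exceptional null set deriv has an irrelevant value. *)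
definition sobolev :: "nat \<Rightarrow> real \<Rightarrow> (real \<Rightarrow> real) set" where
  "sobolev m p =
     {F. (\<forall>i < m - 1. \<forall>x. (deriv ^^ i) F field_differentiable at x) \<and>
         (\<forall>a b. abs_continuous_on a b ((deriv ^^ (m - 1)) F)) \<and>
         in_Lp p ((deriv ^^ m) F)}"

definition sobolev_norm :: "nat \<Rightarrow> real \<Rightarrow> (real \<Rightarrow> real) \<Rightarrow> real" where
  "sobolev_norm m p F = Lp_norm p ((deriv ^^ m) F)"

(* A function on E is represented by any total function; its values off E are irrelevant. *)
definition trace_space :: "nat \<Rightarrow> real \<Rightarrow> real set \<Rightarrow> (real \<Rightarrow> real) set" where
  "trace_space m p E = {f. \<exists>F \<in> sobolev m p. \<forall>x\<in>E. F x = f x}"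

definition trace_norm :: "nat \<Rightarrow> real \<Rightarrow> real set \<Rightarrow> (real \<Rightarrow> real) \<Rightarrow> real" where
  "trace_norm m p E f = Inf {sobolev_norm m p F | F. F \<in> sobolev m p \<and> (\<forall>x\<in>E. F x = f x)}"


section \<open>The Whitney-type extension\<close>

subsection \<open>The sets S_x and the points s_x\<close>

definition nearest_point_choice :: "real set \<Rightarrow> (real set \<Rightarrow> real) \<Rightarrow> bool" where
  "nearest_point_choice E a \<longleftrightarrow>
     (\<forall>A. finite A \<and> A \<noteq> {} \<and> A \<subset> E \<longrightarrow>
        ((\<forall>z\<in>A. \<not> z islimpt E) \<longrightarrow>
           a A \<in> E - A \<and> (\<forall>y \<in> E - A. infdist (a A) A \<le> infdist y A)) \<and>
        (\<forall>z\<in>A. z islimpt E \<and> (\<forall>w\<in>A. w islimpt E \<longrightarrow> w = z) \<longrightarrow> a A = z))"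

lemma nearest_point_choice_exists:
  assumes "closed E"
  shows "\<exists>a. nearest_point_choice E a"
proof -
  have nearest: "\<exists>y \<in> E - A. \<forall>y' \<in> E - A. infdist y A \<le> infdist y' A"
    if A: "finite A" "A \<noteq> {}" "A \<subset> E" and nl: "\<forall>z\<in>A. \<not> z islimpt E" for A
  proof -
    have cl: "closed (E - A)"
      unfolding closed_limpt using assms nl
      by (metis Diff_iff Diff_subset closed_limpt islimpt_subset)
    have ne: "E - A \<noteq> {}" using A by blast
    have "\<exists>y \<in> E - A. \<forall>y' \<in> E - A. dist z y \<le> dist z y'" for z
      using distance_attains_inf[OF cl ne] by metis
    then obtain g where g: "\<And>z. g z \<in> E - A" "\<And>z y'. y' \<in> E - A \<Longrightarrow> dist z (g z) \<le> dist z y'"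
      by metis
    obtain z where z: "z \<in> A" "\<And>w. w \<in> A \<Longrightarrow> infdist (g z) A \<le> infdist (g w) A"
      using A ex_is_arg_min_if_finite[of A "\<lambda>z. infdist (g z) A"]
      by (auto simp: is_arg_min_linorder)
    have "infdist (g z) A \<le> infdist y A" if y: "y \<in> E - A" for y
    proof -
      obtain w where w: "w \<in> A" "infdist y A = dist y w"
        using infdist_attains_inf[of A y] A finite_imp_closed by blast
      have "infdist (g z) A \<le> infdist (g w) A" using z w by blast
      also have "\<dots> \<le> dist (g w) w" using w by (simp add: infdist_le)
      also have "\<dots> \<le> infdist y A" using g(2)[OF y, of w] w by (simp add: dist_commute)
      finally show ?thesis .
    qed
    with g(1) show ?thesis by blast
  qed
  have "\<exists>y. finite A \<and> A \<noteq> {} \<and> A \<subset> E \<longrightarrow>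
        ((\<forall>z\<in>A. \<not> z islimpt E) \<longrightarrow> y \<in> E - A \<and> (\<forall>y' \<in> E - A. infdist y A \<le> infdist y' A)) \<and>
        (\<forall>z\<in>A. z islimpt E \<and> (\<forall>w\<in>A. w islimpt E \<longrightarrow> w = z) \<longrightarrow> y = z)" for A
  proof (cases "\<exists>z\<in>A. z islimpt E")
    case True
    then show ?thesis by blast
  next
    case False
    then show ?thesis using nearest[of A] by blast
  qed
  then show ?thesis unfolding nearest_point_choice_def by (rule choice[OF allI])
qed

(* The recursion is not stopped here: stopping only selects the index n_stop below,
   up to which these sets and points are those of the stopped construction. *)
primrec Y_set :: "(real set \<Rightarrow> real) \<Rightarrow> real \<Rightarrow> nat \<Rightarrow> real set" where
  "Y_set a x 0 = {x}"
| "Y_set a x (Suc j) = insert (a (Y_set a x j)) (Y_set a x j)"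

primrec y_pt :: "(real set \<Rightarrow> real) \<Rightarrow> real \<Rightarrow> nat \<Rightarrow> real" where
  "y_pt a x 0 = x"
| "y_pt a x (Suc j) = a (Y_set a x j)"

definition n_stop :: "nat \<Rightarrow> real set \<Rightarrow> (real set \<Rightarrow> real) \<Rightarrow> real \<Rightarrow> nat" where
  "n_stop m E a x = (LEAST j. j = m - 1 \<or> y_pt a x j islimpt E)"

definition S_set :: "nat \<Rightarrow> real set \<Rightarrow> (real set \<Rightarrow> real) \<Rightarrow> real \<Rightarrow> real set" where
  "S_set m E a x = Y_set a x (n_stop m E a x)"

definition s_pt :: "nat \<Rightarrow> real set \<Rightarrow> (real set \<Rightarrow> real) \<Rightarrow> real \<Rightarrow> real" where
  "s_pt m E a x = y_pt a x (n_stop m E a x)"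

subsection \<open>The polynomials P_x\<close>

definition lagrange_poly :: "real set \<Rightarrow> (real \<Rightarrow> real) \<Rightarrow> real poly" where
  "lagrange_poly S f = (THE P. degree P \<le> card S - 1 \<and> (\<forall>y\<in>S. poly P y = f y))"

abbreviation poly_deriv :: "nat \<Rightarrow> real poly \<Rightarrow> real \<Rightarrow> real" where
  "poly_deriv i P x \<equiv> poly ((pderiv ^^ i) P) x"

(* S tends to z, where S ranges over the m-point subsets of E: diam (S \<union> {z}) tends to 0 *)
definition shrinking_sets :: "nat \<Rightarrow> real set \<Rightarrow> real \<Rightarrow> real set filter" where
  "shrinking_sets m E z =
     inf (filtercomap (\<lambda>S. diameter (insert z S)) (nhds 0))
         (principal {S. S \<subseteq> E \<and> finite S \<and> card S = m})"

definition limit_deriv :: "nat \<Rightarrow> real set \<Rightarrow> (real \<Rightarrow> real) \<Rightarrow> nat \<Rightarrow> real \<Rightarrow> real" where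
  "limit_deriv m E f i z = Lim (shrinking_sets m E z) (\<lambda>S. poly_deriv i (lagrange_poly S f) z)"

definition P_poly :: "nat \<Rightarrow> real set \<Rightarrow> (real set \<Rightarrow> real) \<Rightarrow> (real \<Rightarrow> real) \<Rightarrow> real \<Rightarrow> real poly" where
  "P_poly m E a f x =
     (let S = S_set m E a x; s = s_pt m E a x in
      if card S = m then lagrange_poly S f
      else (THE P. degree P \<le> m - 1 \<and> (\<forall>y\<in>S. poly P y = f y) \<and>
                   (\<forall>i\<in>{1..m - card S}. poly_deriv i P s = limit_deriv m E f i s)))"

subsection \<open>Gluing\<close>

(* For a component J of the complement of E, a bounded end point of J is Inf J or Sup J. *)
definition H_poly :: "nat \<Rightarrow> (real \<Rightarrow> real poly) \<Rightarrow> real set \<Rightarrow> real poly" where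
  "H_poly m P J =
     (if bdd_below J \<and> bdd_above J then
        (THE H. degree H \<le> 2 * m - 1 \<and>
           (\<forall>i<m. poly_deriv i H (Inf J) = poly_deriv i (P (Inf J)) (Inf J) \<and>
                  poly_deriv i H (Sup J) = poly_deriv i (P (Sup J)) (Sup J)))
      else if bdd_above J then P (Sup J)
      else P (Inf J))"

definition Ext :: "nat \<Rightarrow> real set \<Rightarrow> (real set \<Rightarrow> real) \<Rightarrow> (real \<Rightarrow> real) \<Rightarrow> real \<Rightarrow> real" where
  "Ext m E a f x =
     (if x \<in> E then poly (P_poly m E a f x) x
      else poly (H_poly m (P_poly m E a f) (connected_component_set (- E) x)) x)"

end

theory Submission
  imports Defs
begin

text \<open>Let \<open>G\<close> be any extension of \<open>f\<close> and \<open>g\<close> its \<open>m\<close>-th derivative.  Each \<open>P x\<close> is a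
  Hermite interpolant of \<open>G\<close>, so by Rolle every derivative of \<open>G - P x\<close> of order below \<open>m\<close> has a
  zero near \<open>S x\<close> and is bounded by the integral of \<open>\<bar>g\<bar>\<close> over any interval containing \<open>S x\<close>.
  If \<open>a < b\<close> are the end points of a component of the complement of \<open>E\<close>, then the greedy choice
  forces either \<open>P a = P b\<close>, or \<open>S a\<close> and \<open>S b\<close> lie within \<open>m (b - a)\<close> of \<open>a\<close> and \<open>b\<close>.  Hence the
  \<open>m\<close>-th derivative of the gluing polynomial is at most a constant times the mean of \<open>\<bar>g\<bar>\<close> over
  the hull of \<open>S a \<union> S b\<close>, and these hulls have overlap bounded in terms of \<open>m\<close> alone.
  On the limit points of \<open>E\<close> the jets of \<open>F\<close> and \<open>G\<close> agree, which gives the regularity of \<open>F\<close> and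
  \<open>F\<^sup>(\<^sup>m\<^sup>) = g\<close> almost everywhere on \<open>E\<close>.\<close>

section \<open>Zeros of derivatives and polynomial interpolation\<close>

text \<open>The gluing polynomial divides jet differences by powers of b - a, whereas Hermite
  interpolation over a hull multiplies by powers of the hull's length; the estimate therefore closes
  only if the hull is at most a multiple of the gap. A longer hull can occur only when both ends
  share the same greedy set, and then nothing has to be glued. The m-th derivative is
  \<open>deriv\<close> of a function that is only absolutely continuous. Bounding increments of
  G^(m-1) by integrals of g, and recognising F^(m) on \<open>E\<close>, hence require
  differentiability almost everywhere and the fundamental theorem for such functions; both are
  derived from Vitali coverings and a gauge argument. Freedom from p is a matter of bookkeeping:
  constants are kept as p-th powers of numbers depending on m, so that the final root removes p, and
  the overlap number, which enters without an exponent, is enlarged to its p-th power.\<close>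

lemma Rolle_zeros:
  fixes f :: "real \<Rightarrow> real"
  assumes der: "\<And>x. (f has_real_derivative f' x) (at x)"
    and "finite Z" "Z \<noteq> {}" "\<And>z. z \<in> Z \<Longrightarrow> f z = 0"
  shows "\<exists>W. finite W \<and> card W = card Z - 1 \<and> W \<subseteq> {Min Z..Max Z} \<and> W \<inter> Z = {} \<and> (\<forall>w\<in>W. f' w = 0)"
  using assms(2-)
proof (induction Z rule: finite_linorder_max_induct)
  case empty
  then show ?case by simp
next
  case (insert b A)
  show ?case
  proof (cases "A = {}")
    case True
    then show ?thesis by (intro exI[of _ "{}"]) auto
  next
    case False
    with insert obtain W where W: "finite W" "card W = card A - 1" "W \<subseteq> {Min A..Max A}"
      "W \<inter> A = {}" "\<forall>w\<in>W. f' w = 0"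
      by auto
    have lt: "Max A < b" using insert False by auto
    have "\<exists>z. Max A < z \<and> z < b \<and> DERIV f z :> 0"
    proof (rule Rolle[OF lt])
      show "f (Max A) = f b" using insert False by auto
      show "continuous_on {Max A..b} f"
        using der by (meson DERIV_continuous_on has_field_derivative_at_within)
      show "f differentiable at x" for x using der real_differentiable_def by blast
    qed
    then obtain z where z: "Max A < z" "z < b" "f' z = 0"
      using der DERIV_unique by blast
    have "Min A \<le> Max A" using insert.hyps False by auto
    moreover have "z \<notin> W" using W z by auto
    moreover have "z \<notin> A" using z(1) insert.hyps(1) Max_ge by fastforce
    moreover have "b \<notin> A" "b \<notin> W" using insert.hyps lt W by auto
    moreover have "card A > 0" using insert.hyps False by (simp add: card_gt_0_iff)
    moreover have "Min (insert b A) = Min A" "Max (insert b A) = b"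
      unfolding Min_insert[OF insert.hyps(1) False] Max_insert[OF insert.hyps(1) False]
      using lt \<open>Min A \<le> Max A\<close> by linarith+
    moreover have "W \<subseteq> {Min A..b}" "Min A \<le> z"
      using W(3) lt z \<open>Min A \<le> Max A\<close> by fastforce+
    ultimately show ?thesis using W z insert.hyps False lt
      by (intro exI[of _ "insert z W"]) (auto simp del: Min_insert Max_insert)
  qed
qed

text \<open>The points of \<open>A j\<close> are prescribed zeros of the \<open>j\<close>-th derivative.  Rolle's points avoid the
  zeros they separate, so prescribed zeros that persist (\<open>A (Suc j) \<subseteq> A j\<close>) are counted anew at
  every order.\<close>
lemma derivative_zeros:
  fixes R :: "nat \<Rightarrow> real \<Rightarrow> real"
  assumes der: "\<And>i x. Suc i < M \<Longrightarrow> (R i has_real_derivative R (Suc i) x) (at x)"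
    and fin: "\<And>j. finite (A j)" and sub: "A 0 \<subseteq> {c..d}" and anti: "\<And>j. A (Suc j) \<subseteq> A j"
    and zero: "\<And>j z. j < M \<Longrightarrow> z \<in> A j \<Longrightarrow> R j z = 0"
    and cnt: "\<And>i. i < M \<Longrightarrow> i < (\<Sum>j\<le>i. card (A j))"
    and "i < M"
  shows "\<exists>z\<in>{c..d}. R i z = 0"
proof -
  have "\<exists>Z. finite Z \<and> Z \<subseteq> {c..d} \<and> A i \<subseteq> Z \<and> (\<forall>z\<in>Z. R i z = 0) \<and> card Z + i = (\<Sum>j\<le>i. card (A j))"
    if "i < M" for i
    using that
  proof (induction i)
    case 0
    then show ?case using fin sub zero by (intro exI[of _ "A 0"]) auto
  next
    case (Suc i)
    then obtain Z where Z: "finite Z" "Z \<subseteq> {c..d}" "A i \<subseteq> Z" "\<forall>z\<in>Z. R i z = 0"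
      "card Z + i = (\<Sum>j\<le>i. card (A j))" by auto
    have pos: "card Z > 0" using Z(5) cnt[of i] Suc.prems by simp
    then have ne: "Z \<noteq> {}" by auto
    obtain W where W: "finite W" "card W = card Z - 1" "W \<subseteq> {Min Z..Max Z}"
      "W \<inter> Z = {}" "\<forall>w\<in>W. R (Suc i) w = 0"
      using Rolle_zeros[of "R i" "R (Suc i)" Z] der Suc.prems Z(1,4) ne by auto
    have "{Min Z..Max Z} \<subseteq> {c..d}" using Z(1,2) ne by auto
    moreover have "card (W \<union> A (Suc i)) = card W + card (A (Suc i))"
      using W Z(3) anti[of i] fin by (intro card_Un_disjoint) auto
    ultimately show ?case
      using W Z pos anti[of i] fin zero[OF Suc.prems]
      by (intro exI[of _ "W \<union> A (Suc i)"]) auto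
  qed
  from this[OF \<open>i < M\<close>] cnt[OF \<open>i < M\<close>] show ?thesis
    by (metis card.empty add_0 less_irrefl subsetD equals0I)
qed

text \<open>The m conditions are spread over the orders: \<open>S\<close> at order 0, then the
  single point \<open>s\<close> at the orders 1 to m - card S. Up to any order i < m at least i + 1
  of them have been imposed, which is what the counting of zeros asks for.\<close>

lemma hermite_derivative_zeros:
  fixes R :: "nat \<Rightarrow> real \<Rightarrow> real"
  assumes der: "\<And>i x. Suc i < m \<Longrightarrow> (R i has_real_derivative R (Suc i) x) (at x)"
    and S: "finite S" "s \<in> S" "card S \<le> m" "S \<subseteq> {c..d}"
    and "\<And>y. y \<in> S \<Longrightarrow> R 0 y = 0" "\<And>i. i \<in> {1..m - card S} \<Longrightarrow> R i s = 0"
    and "i < m"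
  shows "\<exists>z\<in>{c..d}. R i z = 0"
proof -
  define A where "A j = (if j = 0 then S else if j \<le> m - card S then {s} else {})" for j
  have pos: "card S > 0" using S by (metis card_gt_0_iff empty_iff)
  have sum: "(\<Sum>j\<le>i. card (A j)) = card S + min i (m - card S)" for i
    by (induction i) (auto simp: A_def)
  show ?thesis
  proof (rule derivative_zeros[where A = A and M = m])
    show "i < (\<Sum>j\<le>i. card (A j))" if "i < m" for i
      unfolding sum using pos that by linarith
  qed (use assms in \<open>auto simp: A_def split: if_splits\<close>)
qed

text \<open>Uniqueness of Abel-Goncharov interpolation: the zeros of different orders may sit at
  different points. The induction hypothesis kills \<open>pderiv P\<close>, and the zero of order 0
  kills the remaining constant.\<close>

lemma poly_eq_0_if_derivative_zeros:
  fixes P :: "real poly"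
  assumes "degree P < M" and "\<And>i. i < M \<Longrightarrow> \<exists>z. poly_deriv i P z = 0"
  shows "P = 0"
  using assms
proof (induction M arbitrary: P)
  case 0
  then show ?case by simp
next
  case (Suc M)
  have "pderiv P = 0"
  proof (cases "M = 0")
    case True
    then show ?thesis using Suc.prems by (simp add: pderiv_eq_0_iff)
  next
    case False
    show ?thesis
    proof (rule Suc.IH)
      show "degree (pderiv P) < M" using Suc.prems(1) False by (simp add: degree_pderiv)
      show "\<exists>z. poly_deriv i (pderiv P) z = 0" if "i < M" for i
        using Suc.prems(2)[of "Suc i"] that by (simp add: funpow_Suc_right del: funpow.simps)
    qed
  qed
  then obtain c where "P = [:c:]" by (metis pderiv_eq_0_iff degree_eq_zeroE)
  with Suc.prems(2)[of 0] show ?case by simp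
qed

lemma poly_deriv_DERIV: "(poly_deriv i P has_real_derivative poly_deriv (Suc i) P x) (at x)"
  by simp

lemma higher_pderiv_diff: "(pderiv ^^ n) (p - q) = (pderiv ^^ n) p - (pderiv ^^ n) (q :: real poly)"
  by (induction n) (simp_all add: pderiv_diff)

lemma hermite_unique:
  fixes P Q :: "real poly"
  assumes S: "finite S" "s \<in> S" "card S \<le> m"
    and "degree P \<le> m - 1" "degree Q \<le> m - 1"
    and "\<And>y. y \<in> S \<Longrightarrow> poly P y = poly Q y"
    and "\<And>i. i \<in> {1..m - card S} \<Longrightarrow> poly_deriv i P s = poly_deriv i Q s"
  shows "P = Q"
proof -
  have pos: "m > 0" using S by (metis card_gt_0_iff empty_iff less_le_trans)
  have "P - Q = 0"
  proof (rule poly_eq_0_if_derivative_zeros)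
    show "degree (P - Q) < m" using assms(4,5) pos degree_diff_le[of P "m - 1" Q] by linarith
    have "S \<subseteq> {Min S..Max S}" using S(1) by auto
    then show "\<exists>z. poly_deriv i (P - Q) z = 0" if "i < m" for i
      using hermite_derivative_zeros[of m "\<lambda>i. poly_deriv i (P - Q)" S s "Min S" "Max S" i]
        assms that by (auto simp: higher_pderiv_diff pderiv_diff DERIV_diff)
  qed
  then show ?thesis by simp
qed

text \<open>With both end points prescribed at every order below m, the count up to order i is 2 min
  (i + 1) m, which exceeds i as long as i < 2 m.\<close>

lemma two_point_hermite_unique:
  fixes P Q :: "real poly"
  assumes "m \<ge> 1" "degree P \<le> 2 * m - 1" "degree Q \<le> 2 * m - 1" "a < b"
    and "\<And>i. i < m \<Longrightarrow> poly_deriv i P a = poly_deriv i Q a"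
    and "\<And>i. i < m \<Longrightarrow> poly_deriv i P b = poly_deriv i Q b"
  shows "P = Q"
proof -
  define A where "A j = (if j < m then {a, b} else {})" for j :: nat
  have sum: "(\<Sum>j\<le>i. card (A j)) = 2 * min (Suc i) m" for i
    using \<open>m \<ge> 1\<close> \<open>a < b\<close> by (induction i) (auto simp: A_def)
  have "P - Q = 0"
  proof (rule poly_eq_0_if_derivative_zeros)
    show "degree (P - Q) < 2 * m"
      using assms(1-3) degree_diff_le[of P "2 * m - 1" Q] by linarith
    show "\<exists>z. poly_deriv i (P - Q) z = 0" if "i < 2 * m" for i
    proof -
      have "\<exists>z\<in>{a..b}. poly_deriv i (P - Q) z = 0"
      proof (rule derivative_zeros[where A = A and M = "2 * m" and R = "\<lambda>i. poly_deriv i (P - Q)"])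
        show "i < (\<Sum>j\<le>i. card (A j))" if "i < 2 * m" for i
          unfolding sum using that by (simp add: min_def)
      qed (use assms that in \<open>auto simp: A_def higher_pderiv_diff pderiv_diff DERIV_diff split: if_splits\<close>)
      then show ?thesis by blast
    qed
  qed
  then show ?thesis by simp
qed

section \<open>Existence of Hermite interpolants\<close>

text \<open>A summand divisible by (X - s)^k leaves the jet at \<open>s\<close> below order k
  untouched and adjusts order k freely; the existence proofs for Taylor and Hermite data add such
  corrections.\<close>

lemma poly_deriv_mult_power:
  fixes q :: "real poly"
  assumes "i \<le> k"
  shows "poly_deriv i ([:-s, 1:] ^ k * q) s = (if i = k then fact k * poly q s else 0)"
  using assms
proof (induction k arbitrary: i q)
  case 0
  then show ?case by simp
next
  case (Suc k)
  show ?case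
  proof (cases i)
    case 0
    then show ?thesis by simp
  next
    case (Suc j)
    have "pderiv ([:-s, 1:] ^ Suc k * q) = [:-s, 1:] ^ k * (smult (of_nat (Suc k)) q + [:-s, 1:] * pderiv q)"
      by (simp add: pderiv_mult pderiv_power_Suc pderiv_pCons algebra_simps del: power_Suc of_nat_Suc)
         (simp add: algebra_simps)
    then have "poly_deriv i ([:-s, 1:] ^ Suc k * q) s =
        poly_deriv j ([:-s, 1:] ^ k * (smult (of_nat (Suc k)) q + [:-s, 1:] * pderiv q)) s"
      unfolding Suc by (simp add: funpow_Suc_right del: funpow.simps power_Suc)
    also have "\<dots> = (if j = k then fact k * poly (smult (of_nat (Suc k)) q + [:-s, 1:] * pderiv q) s else 0)"
      using Suc.IH[of j] Suc Suc.prems by simp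
    finally show ?thesis using Suc by (simp add: algebra_simps)
  qed
qed

lemma taylor_poly_exists:
  fixes c :: "nat \<Rightarrow> real"
  shows "\<exists>T. degree T \<le> k \<and> (\<forall>i\<le>k. poly_deriv i T s = c i)"
proof (induction k)
  case 0
  show ?case by (intro exI[of _ "[:c 0:]"]) simp
next
  case (Suc k)
  then obtain T where T: "degree T \<le> k" "\<forall>i\<le>k. poly_deriv i T s = c i" by blast
  define U where "U = T + smult ((c (Suc k) - poly_deriv (Suc k) T s) / fact (Suc k)) ([:-s, 1:] ^ Suc k * 1)"
  have "degree U \<le> Suc k"
    unfolding U_def using T(1)
    by (intro degree_add_le order_trans[OF degree_smult_le])
       (simp_all add: degree_linear_power del: power_Suc)
  moreover have "poly_deriv i U s = c i" if "i \<le> Suc k" for i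
    unfolding U_def higher_pderiv_add higher_pderiv_smult poly_add poly_smult
      poly_deriv_mult_power[OF that]
    using T(2) that by (auto simp: le_Suc_eq simp del: fact_Suc funpow.simps)
  ultimately show ?case by blast
qed

lemma lagrange_exists:
  fixes f :: "real \<Rightarrow> real"
  assumes "finite S"
  shows "\<exists>P. degree P \<le> card S - 1 \<and> (\<forall>y\<in>S. poly P y = f y)"
  using assms
proof (induction S rule: finite_induct)
  case empty
  show ?case by (intro exI[of _ 0]) simp
next
  case (insert x S)
  then obtain P where P: "degree P \<le> card S - 1" "\<forall>y\<in>S. poly P y = f y" by blast
  define w where "w = (\<Prod>y\<in>S. [:-y, 1:])"
  have w: "poly w x \<noteq> 0" "\<And>y. y \<in> S \<Longrightarrow> poly w y = 0" "degree w \<le> card S"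
    using insert.hyps
    by (auto simp: w_def poly_prod degree_prod_eq_sum_degree)
  define Q where "Q = P + smult ((f x - poly P x) / poly w x) w"
  have "degree Q \<le> card S"
    unfolding Q_def using P(1) w(3)
    by (intro degree_add_le order_trans[OF degree_smult_le]) auto
  moreover have "\<forall>y\<in>insert x S. poly Q y = f y"
    using P w by (auto simp: Q_def)
  ultimately show ?case using insert.hyps by auto
qed

text \<open>\<open>T\<close> carries the jet at \<open>s\<close>, and a multiple of (X - s)^(k+1)
  repairs the values at the other points without touching that jet, where k = m - card S. The degree
  is k + 1 + (card S - 2) = m - 1.\<close>

lemma hermite_exists:
  fixes f :: "real \<Rightarrow> real"
  assumes S: "finite S" "s \<in> S" "card S \<le> m"
  shows "\<exists>P. degree P \<le> m - 1 \<and> (\<forall>y\<in>S. poly P y = f y) \<and>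
    (\<forall>i\<in>{1..m - card S}. poly_deriv i P s = c i)"
proof -
  define k where "k = m - card S"
  obtain T where T: "degree T \<le> k" "\<And>i. i \<le> k \<Longrightarrow> poly_deriv i T s = (if i = 0 then f s else c i)"
    using taylor_poly_exists[of k s "\<lambda>i. if i = 0 then f s else c i"] by blast
  obtain Q where Q: "degree Q \<le> card (S - {s}) - 1"
    "\<And>y. y \<in> S - {s} \<Longrightarrow> poly Q y = (f y - poly T y) / (y - s) ^ Suc k"
    using lagrange_exists[of "S - {s}" "\<lambda>y. (f y - poly T y) / (y - s) ^ Suc k"] S by auto
  have pos: "card S > 0" using S by (metis card_gt_0_iff empty_iff)
  show ?thesis
  proof (cases "S = {s}")
    case True
    then show ?thesis using T T(2)[of 0] S by (intro exI[of _ T]) (auto simp: k_def)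
  next
    case False
    then have "S - {s} \<noteq> {}" using S by blast
    then have "card (S - {s}) > 0" using S(1) by (simp add: card_gt_0_iff)
    then have c2: "card S \<ge> 2" using S by simp
    define P where "P = T + [:-s, 1:] ^ Suc k * Q"
    have "degree ([:-s, 1:] ^ Suc k * Q) \<le> Suc k + (card S - 2)"
      using Q(1) S degree_mult_le[of "[:-s, 1:] ^ Suc k" Q]
      by (simp add: degree_linear_power numeral_2_eq_2 del: power_Suc)
    moreover have "Suc k + (card S - 2) = m - 1" using c2 S(3) by (simp add: k_def)
    ultimately have "degree P \<le> m - 1"
      unfolding P_def using T(1) c2 S(3) by (intro degree_add_le) (auto simp: k_def)
    moreover have jet: "poly_deriv i P s = (if i = 0 then f s else c i)" if "i \<le> k" for i
      using poly_deriv_mult_power[of i "Suc k" s Q] T(2)[OF that] that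
      by (simp add: P_def higher_pderiv_add del: power_Suc)
    moreover have "poly P y = f y" if "y \<in> S" for y
    proof (cases "y = s")
      case True
      then show ?thesis using jet[of 0] by simp
    next
      case False
      then show ?thesis using Q(2)[of y] that by (simp add: P_def del: power_Suc)
    qed
    ultimately show ?thesis by (intro exI[of _ P]) (auto simp: k_def)
  qed
qed

text \<open>Only the half of the Hermite basis dual to the jet at 1 is needed, since the jet at the
  first end point will be supplied by \<open>P\<close> itself. Descending in k: X^m (X - 1)^k / k!
  has the right jet at 1 up to order k, and its higher orders are removed with the members already
  built.\<close>

lemma two_point_hermite_basis:
  assumes "m \<ge> 1"
  shows "\<exists>h :: nat \<Rightarrow> real poly. \<forall>k<m. degree (h k) \<le> 2 * m - 1 \<and>
    (\<forall>i<m. poly_deriv i (h k) 0 = 0 \<and> poly_deriv i (h k) 1 = (if i = k then 1 else 0))"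
proof -
  have "\<exists>h :: real poly. degree h \<le> 2 * m - 1 \<and>
      (\<forall>i<m. poly_deriv i h 0 = 0 \<and> poly_deriv i h 1 = (if i = k then 1 else 0))" if "k < m" for k
    using that
  proof (induction "m - k" arbitrary: k rule: less_induct)
    case less
    have "\<forall>j\<in>{k<..<m}. \<exists>h :: real poly. degree h \<le> 2 * m - 1 \<and>
        (\<forall>i<m. poly_deriv i h 0 = 0 \<and> poly_deriv i h 1 = (if i = j then 1 else 0))"
      using less.hyps less.prems by (metis diff_less_mono2 greaterThanLessThan_iff)
    then obtain h :: "nat \<Rightarrow> real poly" where h: "\<And>j. j \<in> {k<..<m} \<Longrightarrow> degree (h j) \<le> 2 * m - 1"
      "\<And>i j. j \<in> {k<..<m} \<Longrightarrow> i < m \<Longrightarrow> poly_deriv i (h j) 0 = 0"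
      "\<And>i j. j \<in> {k<..<m} \<Longrightarrow> i < m \<Longrightarrow> poly_deriv i (h j) 1 = (if i = j then 1 else 0)"
      by metis
    define b where "b = [:-1, 1:] ^ k * smult (1 / fact k) ([:-0, 1::real:] ^ m)"
    have b': "b = [:-0, 1:] ^ m * smult (1 / fact k) ([:-1, 1::real:] ^ k)"
      by (simp add: b_def mult.commute)
    define g where "g = b - (\<Sum>j\<in>{k<..<m}. smult (poly_deriv j b 1) (h j))"
    have "degree b \<le> k + m"
      unfolding b_def
      by (rule order_trans[OF degree_mult_le]) (simp add: degree_linear_power del: minus_zero)
    then have "degree b \<le> 2 * m - 1" using less.prems by linarith
    then have "degree g \<le> 2 * m - 1"
      unfolding g_def using h(1)
      by (intro degree_diff_le degree_sum_le order_trans[OF degree_smult_le]) auto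
    moreover have "poly_deriv i g 0 = 0" if "i < m" for i
    proof -
      have "poly_deriv i b 0 = 0"
        unfolding b' using poly_deriv_mult_power[of i m 0] that by (simp del: mult_smult_right)
      then show ?thesis
        using h(2) that by (simp add: g_def higher_pderiv_diff higher_pderiv_sum higher_pderiv_smult poly_sum)
    qed
    moreover have "poly_deriv i g 1 = (if i = k then 1 else 0)" if i: "i < m" for i
    proof -
      have b1: "poly_deriv i b 1 = (if i = k then 1 else 0)" if "i \<le> k"
        unfolding b_def using poly_deriv_mult_power[OF that, of 1 "smult (1 / fact k) ([:-0, 1::real:] ^ m)"] by simp
      have "poly_deriv i g 1 = poly_deriv i b 1 - (\<Sum>j\<in>{k<..<m}. poly_deriv j b 1 * (if i = j then 1 else 0))"
        using h(3) i by (simp add: g_def higher_pderiv_diff higher_pderiv_sum higher_pderiv_smult poly_sum)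
      also have "\<dots> = poly_deriv i b 1 - (if k < i then poly_deriv i b 1 else 0)"
        using i by (simp add: if_distrib sum.delta cong: if_cong)
      finally show ?thesis using b1 by (cases "k < i") auto
    qed
    ultimately show ?case by blast
  qed
  then show ?thesis by metis
qed

lemma poly_deriv_pcompose_affine:
  fixes h :: "real poly"
  shows "poly_deriv i (pcompose h [:c, d:]) x = d ^ i * poly_deriv i h (c + x * d)"
proof -
  have "(pderiv ^^ i) (pcompose h [:c, d:]) = smult (d ^ i) (pcompose ((pderiv ^^ i) h) [:c, d:])"
    by (induction i) (simp_all add: pderiv_smult pderiv_pcompose pderiv_pCons mult.commute)
  then show ?thesis by (simp add: poly_pcompose)
qed

text \<open>The estimate includes the order i = m, which is not an interpolation condition: it will
  bound the m-th derivative of the glued function. Weighting the k-th jet difference by (b - a)^k is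
  what allows \<open>B\<close> to be independent of the interval.\<close>

abbreviation glues ::
  "nat \<Rightarrow> real \<Rightarrow> real poly \<Rightarrow> real poly \<Rightarrow> real \<Rightarrow> real \<Rightarrow> real poly \<Rightarrow> bool" where
  "glues m B P Q a b H \<equiv> degree H \<le> 2 * m - 1 \<and>
      (\<forall>i<m. poly_deriv i H a = poly_deriv i P a \<and> poly_deriv i H b = poly_deriv i Q b) \<and>
      (\<forall>i\<le>m. \<forall>x\<in>{a..b}. \<bar>poly_deriv i H x - poly_deriv i P x\<bar>
         \<le> B * (\<Sum>k<m. \<bar>poly_deriv k Q b - poly_deriv k P b\<bar> * (b - a) ^ k) / (b - a) ^ i)"

text \<open>The gluing polynomial of step 3 is \<open>P\<close> plus a rescaled combination of the basis above, so its
  deviation from \<open>P\<close> is controlled by the jet of \<open>Q - P\<close> at the second end point.\<close>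
lemma two_point_hermite:
  assumes "m \<ge> 1"
  shows "\<exists>B\<ge>0. \<forall>(P::real poly) Q a b. degree P \<le> m - 1 \<and> degree Q \<le> m - 1 \<and> a < b \<longrightarrow>
    (\<exists>H. glues m B P Q a b H)"
proof -
  obtain h :: "nat \<Rightarrow> real poly" where h: "\<And>k. k < m \<Longrightarrow> degree (h k) \<le> 2 * m - 1"
      "\<And>i k. k < m \<Longrightarrow> i < m \<Longrightarrow> poly_deriv i (h k) 0 = 0"
      "\<And>i k. k < m \<Longrightarrow> i < m \<Longrightarrow> poly_deriv i (h k) 1 = (if i = k then 1 else 0)"
    using two_point_hermite_basis[OF assms] by blast
  have bd: "\<exists>B. \<forall>x\<in>{0..1}. \<bar>poly p x\<bar> \<le> B" for p :: "real poly"
  proof -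
    have "compact (poly p ` {0..1})"
      by (intro compact_continuous_image continuous_intros compact_Icc)
    then show ?thesis
      using compact_imp_bounded bounded_real by (metis imageI)
  qed
  then have "\<forall>i k. \<exists>B. \<forall>x\<in>{0..1}. \<bar>poly_deriv i (h k) x\<bar> \<le> B" by blast
  then obtain b0 where b0: "\<And>i k x. x \<in> {0..1} \<Longrightarrow> \<bar>poly_deriv i (h k) x\<bar> \<le> b0 i k" by metis
  have b0nn: "0 \<le> b0 i k" for i k using b0[of 0 i k] by force
  define B where "B = (\<Sum>i\<le>m. \<Sum>k<m. b0 i k)"
  have Bnn: "B \<ge> 0" unfolding B_def by (intro sum_nonneg b0nn)
  have B: "\<bar>poly_deriv i (h k) x\<bar> \<le> B" if "i \<le> m" "k < m" "x \<in> {0..1}" for i k x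
  proof -
    have "\<bar>poly_deriv i (h k) x\<bar> \<le> b0 i k" using b0 that by blast
    also have "\<dots> \<le> (\<Sum>k<m. b0 i k)" using that b0nn by (intro member_le_sum) auto
    also have "\<dots> \<le> B" unfolding B_def using that b0nn
      by (intro member_le_sum[of i _ "\<lambda>i. \<Sum>k<m. b0 i k"] sum_nonneg) auto
    finally show ?thesis .
  qed
  show ?thesis
  proof (intro exI[of _ B] conjI Bnn allI impI)
    fix P Q :: "real poly" and a b :: real
    assume *: "degree P \<le> m - 1 \<and> degree Q \<le> m - 1 \<and> a < b"
    define \<delta> where "\<delta> = b - a"
    have \<delta>: "\<delta> > 0" using * by (simp add: \<delta>_def)
    define c where "c k = poly_deriv k Q b - poly_deriv k P b" for k
    define u where "u k = pcompose (h k) [:- a / \<delta>, 1 / \<delta>:]" for k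
    define H where "H = P + (\<Sum>k<m. smult (c k * \<delta> ^ k) (u k))"
    have u: "poly_deriv i (u k) x = poly_deriv i (h k) ((x - a) / \<delta>) / \<delta> ^ i" for i k x
      unfolding u_def poly_deriv_pcompose_affine
      by (simp add: power_one_over divide_inverse algebra_simps power_inverse)
    have H: "poly_deriv i H x - poly_deriv i P x = (\<Sum>k<m. c k * \<delta> ^ k * poly_deriv i (u k) x)" for i x
      by (simp add: H_def higher_pderiv_add higher_pderiv_sum higher_pderiv_smult poly_sum)
    have deg: "degree H \<le> 2 * m - 1"
      unfolding H_def
    proof (intro degree_add_le degree_sum_le order_trans[OF degree_smult_le])
      show "degree P \<le> 2 * m - 1" using * by linarith
      show "degree (u k) \<le> 2 * m - 1" if "k \<in> {..<m}" for k
        using h(1)[of k] that \<delta> unfolding u_def degree_pcompose by simp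
    qed simp
    have a: "poly_deriv i H a = poly_deriv i P a" if "i < m" for i
      using H[of i a] h(2) that by (simp add: u)
    have b: "poly_deriv i H b = poly_deriv i Q b" if "i < m" for i
    proof -
      have "poly_deriv i H b - poly_deriv i P b = (\<Sum>k<m. if i = k then c k else 0)"
        unfolding H u using h(3) that \<delta> by (intro sum.cong) (auto simp: \<delta>_def)
      then show ?thesis using that by (simp add: c_def)
    qed
    have "\<bar>poly_deriv i H x - poly_deriv i P x\<bar>
        \<le> B * (\<Sum>k<m. \<bar>poly_deriv k Q b - poly_deriv k P b\<bar> * (b - a) ^ k) / (b - a) ^ i"
      if "i \<le> m" "x \<in> {a..b}" for i x
    proof -
      have t: "(x - a) / \<delta> \<in> {0..1}" using that \<delta> by (auto simp: \<delta>_def)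
      have "\<bar>poly_deriv i H x - poly_deriv i P x\<bar> \<le> (\<Sum>k<m. \<bar>c k * \<delta> ^ k * poly_deriv i (u k) x\<bar>)"
        unfolding H by (rule sum_abs)
      also have "\<dots> \<le> (\<Sum>k<m. \<bar>c k\<bar> * \<delta> ^ k * (B / \<delta> ^ i))"
        using B[OF that(1) _ t] \<delta> unfolding u
        by (intro sum_mono) (auto simp: abs_mult intro!: mult_left_mono divide_right_mono)
      also have "\<dots> = B * (\<Sum>k<m. \<bar>c k\<bar> * \<delta> ^ k) / \<delta> ^ i"
        by (simp add: sum_distrib_left sum_divide_distrib algebra_simps)
      finally show ?thesis by (simp add: c_def \<delta>_def)
    qed
    with deg a b show "\<exists>H. glues m B P Q a b H"
      by blast
  qed
qed

text \<open>Descent in the order: the top function has a zero and is bounded by its oscillation,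
  each lower one by the mean value theorem from its own zero, gaining a factor d - c. The top
  hypothesis is about increments because \<open>R (m - 1)\<close> will be only absolutely
  continuous.\<close>

lemma derivative_family_bound:
  fixes R :: "nat \<Rightarrow> real \<Rightarrow> real"
  assumes der: "\<And>i x. Suc i < m \<Longrightarrow> (R i has_real_derivative R (Suc i) x) (at x)"
    and zero: "\<And>i. i < m \<Longrightarrow> \<exists>z\<in>{c..d}. R i z = 0"
    and osc: "\<And>x y. c \<le> x \<Longrightarrow> x \<le> y \<Longrightarrow> y \<le> d \<Longrightarrow> \<bar>R (m - 1) y - R (m - 1) x\<bar> \<le> M"
    and "i < m" "x \<in> {c..d}"
  shows "\<bar>R i x\<bar> \<le> M * (d - c) ^ (m - 1 - i)"
  using assms(4,5)
proof (induction "m - 1 - i" arbitrary: i x)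
  case 0
  then have i: "i = m - 1" by linarith
  obtain z where "z \<in> {c..d}" "R i z = 0" using zero 0 by blast
  then show ?case using osc[of x z] osc[of z x] 0 unfolding i by (cases "x \<le> z") auto
next
  case (Suc k)
  then have i: "Suc i < m" "k = m - 1 - Suc i" by linarith+
  obtain z where z: "z \<in> {c..d}" "R i z = 0" using zero Suc by blast
  have IH: "\<bar>R (Suc i) t\<bar> \<le> M * (d - c) ^ k" if "t \<in> {c..d}" for t
    using Suc.hyps(1)[OF i(2)] i that by simp
  have nn: "0 \<le> M * (d - c) ^ k" using IH[OF z(1)] by linarith
  have "\<bar>R i x - R i z\<bar> \<le> (M * (d - c) ^ k) * \<bar>x - z\<bar>"
    using field_differentiable_bound[of "{c..d}" "R i" "R (Suc i)" "M * (d - c) ^ k" x z]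
      has_field_derivative_at_within[OF der[OF i(1)]] IH Suc.prems z by (auto simp: real_norm_def)
  also have "\<dots> \<le> (M * (d - c) ^ k) * (d - c)"
    using Suc.prems z nn by (intro mult_left_mono) auto
  finally show ?case using z(2) Suc.hyps(2) by (metis diff_zero power_Suc2 mult.assoc)
qed

section \<open>Absolutely continuous functions\<close>

abbreviation nonoverlapping :: "(real \<times> real) set \<Rightarrow> bool" where
  "nonoverlapping \<equiv> pairwise (\<lambda>(v, w) (v', w'). {v<..<w} \<inter> {v'<..<w'} = {})"

abbreviation separated :: "(real \<times> real) set \<Rightarrow> bool" where
  "separated \<equiv> pairwise (\<lambda>(v, w) (v', w'). disjnt {v..w} {v'..w'})"

abbreviation covered :: "(real \<times> real) set \<Rightarrow> real set" where
  "covered D \<equiv> (\<Union>(v, w)\<in>D. {v..w})"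

abbreviation total_length :: "(real \<times> real) set \<Rightarrow> real" where
  "total_length D \<equiv> (\<Sum>(v, w)\<in>D. w - v)"

abbreviation increments :: "(real \<Rightarrow> real) \<Rightarrow> (real \<times> real) set \<Rightarrow> real" where
  "increments u D \<equiv> (\<Sum>(v, w)\<in>D. u w - u v)"

abbreviation variation :: "(real \<Rightarrow> real) \<Rightarrow> (real \<times> real) set \<Rightarrow> real" where
  "variation u D \<equiv> (\<Sum>(v, w)\<in>D. \<bar>u w - u v\<bar>)"

section \<open>Vitali coverings and finite families of intervals\<close>

text \<open>Intervals are balls on the line, so the Vitali theorem for balls yields a countable
  disjoint family that exhausts \<open>S\<close> up to a null set, and a finite part of it has
  nearly the full measure. The predicate \<open>I\<close> is the property that arbitrarily short
  intervals around each point enjoy; \<open>U\<close> confines them to a set of finite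
  measure.\<close>

lemma Vitali_intervals:
  fixes S :: "real set"
  assumes S: "S \<in> lmeasurable" and U: "open U" "S \<subseteq> U" "U \<in> lmeasurable" and "e > 0"
    and fine: "\<And>x \<eta>. x \<in> S \<Longrightarrow> \<eta> > 0 \<Longrightarrow> \<exists>v w. I v w \<and> v < w \<and> x \<in> {v..w} \<and> w - v < \<eta>"
  obtains D where "finite D" "\<forall>v w. (v, w) \<in> D \<longrightarrow> I v w \<and> v < w \<and> {v..w} \<subseteq> U"
    "separated D"
    "measure lebesgue (S - covered D) < e"
proof -
  define K where "K = {(v, w). I v w \<and> v < w \<and> {v..w} \<subseteq> U}"
  define ctr where "ctr i = (fst i + snd i) / 2" for i :: "real \<times> real"
  define rad where "rad i = (snd i - fst i) / 2" for i :: "real \<times> real"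
  have cb: "cball (ctr i) (rad i) = {fst i..snd i}" for i
    by (auto simp: ctr_def rad_def cball_eq_atLeastAtMost field_simps)
  have 1: "0 < rad i" if "i \<in> K" for i using that by (auto simp: K_def rad_def)
  have 2: "\<exists>i. i \<in> K \<and> x \<in> cball (ctr i) (rad i) \<and> rad i < d" if xS: "x \<in> S" and "0 < d" for x d
  proof -
    have "x \<in> U" using U(2) xS by (rule subsetD)
    then obtain r where r: "r > 0" "ball x r \<subseteq> U" using U(1) unfolding open_contains_ball by metis
    have "min r d > 0" using \<open>d > 0\<close> \<open>r > 0\<close> by simp
    from fine[OF xS this] obtain v w where *: "I v w" "v < w" "x \<in> {v..w}" "w - v < min r d" by blast
    have "{v..w} \<subseteq> ball x r"
    proof
      fix t assume "t \<in> {v..w}"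
      then show "t \<in> ball x r" using *(3,4) by (auto simp: dist_real_def abs_less_iff)
    qed
    then have "(v, w) \<in> K" using * r(2) by (simp add: K_def subset_trans[of _ "ball x r"])
    moreover have "x \<in> cball (ctr (v, w)) (rad (v, w))" using * by (simp add: cb)
    moreover have "rad (v, w) < d" using * by (simp add: rad_def)
    ultimately show ?thesis by blast
  qed
  obtain C where C: "countable C" "C \<subseteq> K"
    "pairwise (\<lambda>i j. disjnt (cball (ctr i) (rad i)) (cball (ctr j) (rad j))) C"
    "negligible (S - (\<Union>i\<in>C. cball (ctr i) (rad i)))"
    by (rule Vitali_covering_theorem_cballs[OF 1 2])
  define T where "T i = {fst i..snd i}" for i :: "real \<times> real"
  have TU: "T i \<subseteq> U" if "i \<in> K" for i using that by (auto simp: K_def T_def)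
  obtain \<D> where \<D>: "\<D> \<subseteq> T ` C" "finite \<D>" "measure lebesgue (\<Union>(T ` C)) - e < measure lebesgue (\<Union>\<D>)"
  proof (rule measure_countable_Union_approachable[of "T ` C" e "measure lebesgue U"])
    show "measure lebesgue (\<Union>D') \<le> measure lebesgue U" if "D' \<subseteq> T ` C" "finite D'" for D'
    proof (rule measure_mono_fmeasurable)
      show "\<Union>D' \<subseteq> U" using that TU C(2) by blast
      show "\<Union>D' \<in> sets lebesgue" using that by (intro sets.finite_Union) (auto simp: T_def)
    qed (use U in auto)
  qed (use C \<open>e > 0\<close> in \<open>auto simp: T_def\<close>)
  obtain D where D: "D \<subseteq> C" "finite D" "\<D> = T ` D"
    using \<D>(1,2) by (metis finite_subset_image)
  have CM: "\<Union>(T ` C) \<in> lmeasurable"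
  proof (rule fmeasurableI2[OF U(3)])
    show "\<Union>(T ` C) \<subseteq> U" using TU C(2) by blast
    show "\<Union>(T ` C) \<in> sets lebesgue"
      using C(1) by (intro sets.countable_UN') (auto simp: T_def)
  qed
  have DM: "\<Union>(T ` D) \<in> lmeasurable"
    using D(2) by (intro fmeasurable.finite_UN) (auto simp: T_def)
  have "measure lebesgue (S - \<Union>(T ` D)) \<le> measure lebesgue (\<Union>(T ` C) - \<Union>(T ` D) \<union> (S - \<Union>(T ` C)))"
    using C(4) S CM DM
    by (intro measure_mono_fmeasurable fmeasurable.Un fmeasurable.Diff)
       (auto simp: cb T_def fmeasurableD negligible_imp_measurable intro: fmeasurable.Diff)
  also have "\<dots> \<le> measure lebesgue (\<Union>(T ` C) - \<Union>(T ` D)) + measure lebesgue (S - \<Union>(T ` C))"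
    using S CM DM by (intro measure_Un_le) auto
  also have "measure lebesgue (S - \<Union>(T ` C)) = 0"
    using C(4) by (simp add: cb T_def negligible_imp_measure0)
  also have "measure lebesgue (\<Union>(T ` C) - \<Union>(T ` D)) = measure lebesgue (\<Union>(T ` C)) - measure lebesgue (\<Union>(T ` D))"
    using D(1) CM DM by (intro measurable_measure_Diff) auto
  finally have "measure lebesgue (S - \<Union>(T ` D)) < e" using \<D>(3) D(3) by simp
  moreover have "covered D = \<Union>(T ` D)" by (auto simp: T_def)
  moreover have "separated D"
    using pairwise_subset[OF C(3) D(1)] by (simp add: cb case_prod_unfold)
  moreover have "I v w \<and> v < w \<and> {v..w} \<subseteq> U" if "(v, w) \<in> D" for v w
    using that D C by (auto simp: K_def)
  ultimately show thesis using that[of D] D by simp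
qed

lemma measure_disjoint_intervals:
  assumes "finite D" "\<And>v w. (v, w) \<in> D \<Longrightarrow> v \<le> (w::real)"
    "separated D"
  shows "measure lebesgue (covered D) = total_length D"
proof -
  have "measure lebesgue (\<Union>i\<in>D. {fst i..snd i}) = (\<Sum>i\<in>D. measure lebesgue {fst i..snd i})"
  proof (rule measure_UNION')
    show "pairwise (\<lambda>x y. disjnt {fst x..snd x} {fst y..snd y}) D"
      using assms(3) by (simp add: case_prod_unfold)
  qed (use assms in auto)
  also have "\<dots> = (\<Sum>i\<in>D. snd i - fst i)"
    using assms(2) by (intro sum.cong) auto
  finally show ?thesis by (simp add: case_prod_unfold)
qed

text \<open>The leftover pieces are found by splitting off the rightmost interval. One family
  \<open>R\<close> serves all functions u at once: with the identity the last clause compares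
  lengths, with the function under study it compares increments.\<close>

lemma interval_complement:
  assumes "finite D" "\<And>v w. (v, w) \<in> D \<Longrightarrow> v < w \<and> a \<le> v \<and> w \<le> b"
    "separated D" "a \<le> b"
  obtains R where "finite R" "\<And>v w. (v, w) \<in> R \<Longrightarrow> v \<le> w \<and> a \<le> v \<and> w \<le> b"
    "nonoverlapping R"
    "\<And>u :: real \<Rightarrow> real. u b - u a = increments u D + increments u R"
proof -
  have "\<exists>R. finite R \<and> (\<forall>(v, w)\<in>R. v \<le> w \<and> a \<le> v \<and> w \<le> b) \<and>
      nonoverlapping R \<and>
      (\<forall>u :: real \<Rightarrow> real. u b - u a = increments u D + increments u R)"
    using assms
  proof (induction "card D" arbitrary: D b rule: less_induct)
    case less
    show ?case
    proof (cases "D = {}")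
      case True
      then show ?thesis using less.prems by (intro exI[of _ "{(a, b)}"]) auto
    next
      case False
      then have "Max (fst ` D) \<in> fst ` D" using less.prems(1) by simp
      then obtain i where i: "i \<in> D" "fst i = Max (fst ` D)" by auto
      have imax: "fst j \<le> fst i" if "j \<in> D" for j
        unfolding i(2) using that less.prems(1) by simp
      obtain v w where vw: "i = (v, w)" by fastforce
      have vw': "v < w" "a \<le> v" "w \<le> b" using less.prems(2) i vw by auto
      define D' where "D' = D - {i}"
      have below: "w' < v" if "(v', w') \<in> D'" for v' w'
      proof -
        have "disjnt {v..w} {v'..w'}"
          using pairwiseD[OF less.prems(3), of i "(v', w')"] that i(1) vw by (auto simp: D'_def)
        then have "v \<notin> {v'..w'}" using vw'(1) by (auto simp: disjnt_iff)
        moreover have "v' \<le> v" using imax[of "(v', w')"] that vw by (simp add: D'_def)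
        ultimately show ?thesis by simp
      qed
      have "\<exists>R. finite R \<and> (\<forall>(v', w')\<in>R. v' \<le> w' \<and> a \<le> v' \<and> w' \<le> v) \<and>
        nonoverlapping R \<and>
        (\<forall>u :: real \<Rightarrow> real. u v - u a = increments u D' + increments u R)"
      proof (rule less.hyps)
        show "card D' < card D" unfolding D'_def by (rule card_Diff1_less[OF less.prems(1) i(1)])
        show "separated D'"
          using less.prems(3) by (rule pairwise_subset) (auto simp: D'_def)
        show "v' < w' \<and> a \<le> v' \<and> w' \<le> v" if "(v', w') \<in> D'" for v' w'
          using below[OF that] less.prems(2)[of v' w'] that by (auto simp: D'_def)
      qed (use less.prems vw' in \<open>auto simp: D'_def\<close>)
      then obtain R where R0: "finite R \<and> (\<forall>(v', w')\<in>R. v' \<le> w' \<and> a \<le> v' \<and> w' \<le> v) \<and>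
        nonoverlapping R \<and>
        (\<forall>u :: real \<Rightarrow> real. u v - u a = increments u D' + increments u R)"
        by (elim exE)
      have R: "finite R" "(v', w') \<in> R \<Longrightarrow> v' \<le> w' \<and> a \<le> v' \<and> w' \<le> v"
        "nonoverlapping R"
        "u v - u a = increments u D' + increments u R" for v' w' and u :: "real \<Rightarrow> real"
        using R0 by (simp_all, blast)
      have nin: "(w, b) \<notin> R" using R(2)[of w b] vw' by auto
      have "u b - u a = increments u D + increments u (insert (w, b) R)" for u :: "real \<Rightarrow> real"
        using R(4)[of u] nin R(1) sum.remove[OF less.prems(1) i(1), of "\<lambda>(v, w). u w - u v"]
        by (simp add: vw D'_def)
      moreover have "{w<..<b} \<inter> {v'<..<w'} = {}" if "(v', w') \<in> R" for v' w'
        using R(2)[OF that] vw' by auto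
      then have "nonoverlapping (insert (w, b) R)"
        using R(3) by (auto simp: pairwise_insert Int_commute simp del: Int_greaterThanLessThan)
      moreover have "\<forall>(v', w')\<in>insert (w, b) R. v' \<le> w' \<and> a \<le> v' \<and> w' \<le> b"
      proof -
        have "v' \<le> w' \<and> a \<le> v' \<and> w' \<le> b" if "(v', w') \<in> insert (w, b) R" for v' w'
          using that R(2)[of v' w'] vw' by auto
        then show ?thesis by auto
      qed
      ultimately show ?thesis using R(1) by (intro exI[of _ "insert (w, b) R"] conjI allI) simp_all
    qed
  qed
  then obtain R where R0: "finite R \<and> (\<forall>(v, w)\<in>R. v \<le> w \<and> a \<le> v \<and> w \<le> b) \<and>
      nonoverlapping R \<and>
      (\<forall>u :: real \<Rightarrow> real. u b - u a = increments u D + increments u R)"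
    by (elim exE)
  show thesis
    by (rule that[of R]) (use R0 in auto)
qed

text \<open>Here \<open>D1\<close> approximates a set from outside and \<open>D2\<close> from inside the intervals of \<open>D1\<close>; the
  increments over the two families differ by those over a set of small measure.\<close>
lemma abs_continuous_nested_families:
  fixes u :: "real \<Rightarrow> real"
  assumes \<delta>: "\<And>D :: (real \<times> real) set. finite D \<Longrightarrow> \<forall>(v, w)\<in>D. a \<le> v \<and> v \<le> w \<and> w \<le> b \<Longrightarrow>
        nonoverlapping D \<Longrightarrow>
        total_length D < \<delta> \<Longrightarrow> variation u D < \<epsilon>"
    and D1: "finite D1" "\<And>v w. (v, w) \<in> D1 \<Longrightarrow> v < w \<and> a \<le> v \<and> w \<le> b"
      "separated D1"
    and D2: "finite D2" "\<And>v w. (v, w) \<in> D2 \<Longrightarrow> v < w \<and> {v..w} \<subseteq> (\<Union>(v, w)\<in>D1. {v<..<w})"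
      "separated D2"
    and small: "total_length D1 - total_length D2 < \<delta>"
  shows "\<bar>increments u D1 - increments u D2\<bar> < \<epsilon>"
proof -
  define E where "E i = {j \<in> D2. {fst j..snd j} \<subseteq> {fst i<..<snd i}}" for i :: "real \<times> real"
  have disj1: "i = i'" if "i \<in> D1" "i' \<in> D1" "x \<in> {fst i..snd i}" "x \<in> {fst i'..snd i'}" for i i' x
    using pairwiseD[OF D1(3) that(1,2)] that(3,4) by (auto simp: case_prod_unfold disjnt_iff)
  have "\<exists>R. finite R \<and> (\<forall>(v, w)\<in>R. v \<le> w \<and> fst i \<le> v \<and> w \<le> snd i) \<and>
      nonoverlapping R \<and>
      (\<forall>u :: real \<Rightarrow> real. u (snd i) - u (fst i) = increments u (E i) + increments u R)"
    if "i \<in> D1" for i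
  proof -
    have ord: "v < w \<and> fst i \<le> v \<and> w \<le> snd i" if "(v, w) \<in> E i" for v w
    proof -
      have "v < w" "{v..w} \<subseteq> {fst i<..<snd i}" using that D2(2)[of v w] by (auto simp: E_def)
      then have "v \<in> {fst i<..<snd i}" "w \<in> {fst i<..<snd i}" by (meson atLeastAtMost_iff less_imp_le order_refl subsetD)+
      with \<open>v < w\<close> show ?thesis by simp
    qed
    show ?thesis
    proof (rule interval_complement[of "E i" "fst i" "snd i"])
      show "finite (E i)" using D2(1) by (simp add: E_def)
      show "separated (E i)"
        using D2(3) by (rule pairwise_subset) (auto simp: E_def)
      show "fst i \<le> snd i" using D1(2)[of "fst i" "snd i"] that by simp
    qed (use ord in \<open>blast+\<close>)
  qed
  then have "\<forall>i\<in>D1. \<exists>R. finite R \<and> (\<forall>(v, w)\<in>R. v \<le> w \<and> fst i \<le> v \<and> w \<le> snd i) \<and>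
      nonoverlapping R \<and>
      (\<forall>u :: real \<Rightarrow> real. u (snd i) - u (fst i) = increments u (E i) + increments u R)"
    by blast
  then obtain R where R0: "\<forall>i\<in>D1. finite (R i) \<and> (\<forall>(v, w)\<in>R i. v \<le> w \<and> fst i \<le> v \<and> w \<le> snd i) \<and>
      nonoverlapping (R i) \<and>
      (\<forall>u :: real \<Rightarrow> real. u (snd i) - u (fst i) = increments u (E i) + increments u (R i))"
    by (elim bchoice[THEN exE])
  have R: "finite (R i)" "(v, w) \<in> R i \<Longrightarrow> v \<le> w \<and> fst i \<le> v \<and> w \<le> snd i"
    "nonoverlapping (R i)"
    "u (snd i) - u (fst i) = increments u (E i) + increments u (R i)"
    if "i \<in> D1" for i v w and u :: "real \<Rightarrow> real"
    using R0[rule_format, OF that] by (simp_all, blast)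
  define RR where "RR = (\<Union>i\<in>D1. R i)"
  have Rdisj: "R i \<inter> R j = {}" if "i \<in> D1" "j \<in> D1" "i \<noteq> j" for i j
  proof (rule ccontr)
    assume "R i \<inter> R j \<noteq> {}"
    then obtain v w where "(v, w) \<in> R i" "(v, w) \<in> R j" by fastforce
    then show False using R(2)[of i v w] R(2)[of j v w] disj1[of i j v] that by auto
  qed
  have D2E: "D2 = (\<Union>i\<in>D1. E i)"
  proof -
    \<comment> \<open>An interval of \<open>D2\<close> cannot leave the member of \<open>D1\<close>
      it starts in: the right end \<open>snd i\<close> would have to lie in another open interval,
      but the closed intervals of \<open>D1\<close> are disjoint.\<close>
    have "\<exists>i\<in>D1. {v..w} \<subseteq> {fst i<..<snd i}" if "(v, w) \<in> D2" for v w
    proof -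
      have vw: "v < w" "{v..w} \<subseteq> (\<Union>(v, w)\<in>D1. {v<..<w})" using D2(2)[OF that] by auto
      then have "v \<in> (\<Union>(v, w)\<in>D1. {v<..<w})" by (meson atLeastAtMost_iff less_imp_le order_refl subsetD)
      then obtain i where i: "i \<in> D1" "v \<in> {fst i<..<snd i}" by (auto simp: case_prod_unfold)
      have "w < snd i"
      proof (rule ccontr)
        assume "\<not> w < snd i"
        then have "snd i \<in> {v..w}" using i by auto
        with vw(2) have "snd i \<in> (\<Union>(v, w)\<in>D1. {v<..<w})" by blast
        then obtain j where j: "j \<in> D1" "snd i \<in> {fst j<..<snd j}" by (auto simp: case_prod_unfold)
        then have "i = j" using disj1[of i j "snd i"] i by auto
        with j show False by simp
      qed
      with i show ?thesis by (intro bexI[of _ i]) auto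
    qed
    then have "\<exists>i\<in>D1. {fst k..snd k} \<subseteq> {fst i<..<snd i}" if "k \<in> D2" for k
      using that by (metis prod.collapse)
    then show ?thesis unfolding E_def by blast
  qed
  have Edisj: "E i \<inter> E j = {}" if "i \<in> D1" "j \<in> D1" "i \<noteq> j" for i j
  proof (rule ccontr)
    assume "E i \<inter> E j \<noteq> {}"
    then obtain k where k: "k \<in> D2" "{fst k..snd k} \<subseteq> {fst i<..<snd i}" "{fst k..snd k} \<subseteq> {fst j<..<snd j}"
      by (auto simp: E_def)
    moreover have "fst k \<in> {fst k..snd k}" using D2(2)[of "fst k" "snd k"] k by simp
    ultimately have "fst k \<in> {fst i<..<snd i}" "fst k \<in> {fst j<..<snd j}" by blast+
    then show False using disj1[of i j "fst k"] that by simp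
  qed
  have split: "increments u D1 = increments u D2 + increments u RR" for u :: "real \<Rightarrow> real"
  proof -
    have "increments u D1 = (\<Sum>i\<in>D1. increments u (E i) + increments u (R i))"
      using R(4)[of _ u] by (intro sum.cong) (auto simp: case_prod_unfold)
    also have "\<dots> = (\<Sum>i\<in>D1. \<Sum>(v, w)\<in>E i. u w - u v) + (\<Sum>i\<in>D1. \<Sum>(v, w)\<in>R i. u w - u v)"
      by (rule sum.distrib)
    also have "(\<Sum>i\<in>D1. \<Sum>(v, w)\<in>E i. u w - u v) = increments u D2"
      unfolding D2E using D1(1) D2(1) Edisj by (intro sum.UNION_disjoint[symmetric]) (auto simp: E_def)
    also have "(\<Sum>i\<in>D1. \<Sum>(v, w)\<in>R i. u w - u v) = increments u RR"
      unfolding RR_def using D1(1) R(1) Rdisj by (intro sum.UNION_disjoint[symmetric]) auto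
    finally show ?thesis .
  qed
  have "variation u RR < \<epsilon>"
  proof (rule \<delta>)
    show "finite RR" using D1(1) R(1) by (auto simp: RR_def)
    show "\<forall>(v, w)\<in>RR. a \<le> v \<and> v \<le> w \<and> w \<le> b"
    proof -
      have "a \<le> v \<and> v \<le> w \<and> w \<le> b" if vw: "(v, w) \<in> RR" for v w
      proof -
        obtain i where "i \<in> D1" "(v, w) \<in> R i" using vw by (auto simp: RR_def)
        then show ?thesis using R(2)[of i v w] D1(2)[of "fst i" "snd i"] by simp
      qed
      then show ?thesis by auto
    qed
    show "nonoverlapping RR"
    proof -
      have "{v<..<w} \<inter> {v'<..<w'} = {}"
        if vw: "(v, w) \<in> RR" "(v', w') \<in> RR" "(v, w) \<noteq> (v', w')" for v w v' w'
      proof -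
        obtain i j where ij: "i \<in> D1" "j \<in> D1" "(v, w) \<in> R i" "(v', w') \<in> R j"
          using vw by (auto simp: RR_def)
        show ?thesis
        proof (cases "i = j")
          case True
          then show ?thesis using pairwiseD[OF R(3)[OF ij(1)], of "(v, w)" "(v', w')"] ij vw by simp
        next
          case False
          have "x \<notin> {v<..<w} \<inter> {v'<..<w'}" for x
            using R(2)[OF ij(1,3)] R(2)[OF ij(2,4)] disj1[OF ij(1,2), of x] False by auto
          then show ?thesis by blast
        qed
      qed
      then show ?thesis by (auto simp: pairwise_def)
    qed
    show "total_length RR < \<delta>" using small split[of "\<lambda>x. x"] by simp
  qed
  moreover have "\<bar>\<Sum>(v, w)\<in>RR. u w - u v\<bar> \<le> variation u RR"
    unfolding case_prod_unfold by (rule sum_abs)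
  ultimately show ?thesis using split[of u] by linarith
qed

lemma lmeasurable_Int_borel:
  fixes A :: "real set"
  assumes "A \<in> sets borel" "B \<in> lmeasurable"
  shows "A \<inter> B \<in> lmeasurable"
proof -
  have "A \<in> sets lebesgue" using assms(1) sets_completionI_sets[of A lborel] by simp
  then show ?thesis using assms(2) by (intro fmeasurableI2[OF assms(2)]) auto
qed

section \<open>Derivates and differentiability almost everywhere\<close>

text \<open>A superlevel set of the two-sided upper derivate, up to the boundary case. Applied to -u
  and -p it says that difference quotients below p occur arbitrarily close to x, so lower derivates
  need no definition of their own.\<close>

definition steep_points :: "(real \<Rightarrow> real) \<Rightarrow> real \<Rightarrow> real set" where
  "steep_points u q = {x. \<forall>\<eta>>0. \<exists>y. y \<noteq> x \<and> \<bar>y - x\<bar> < \<eta> \<and> q < (u y - u x) / (y - x)}"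

lemma steep_points_interval:
  assumes "x \<in> steep_points u q" "\<eta> > 0"
  shows "\<exists>v w. q * (w - v) < u w - u v \<and> v < w \<and> x \<in> {v..w} \<and> w - v < \<eta>"
proof -
  obtain y where y: "y \<noteq> x" "\<bar>y - x\<bar> < \<eta>" "q < (u y - u x) / (y - x)"
    using assms unfolding steep_points_def by blast
  show ?thesis
  proof (cases "x < y")
    case True
    then show ?thesis using y by (intro exI[of _ x] exI[of _ y]) (auto simp: pos_less_divide_eq)
  next
    case False
    then have "y < x" using y by simp
    then show ?thesis using y by (intro exI[of _ y] exI[of _ x]) (auto simp: neg_less_divide_eq algebra_simps)
  qed
qed

text \<open>For a fixed step h the condition on x is open by continuity; a union over steps stays
  open, and the quantifier over \<eta> can be taken along 1/n.\<close>

lemma steep_points_borel: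
  assumes "continuous_on UNIV u"
  shows "steep_points u q \<in> sets borel"
proof -
  define A where "A \<eta> = (\<Union>h\<in>{h. h \<noteq> 0 \<and> \<bar>h\<bar> < \<eta>}. {x. q < (u (x + h) - u x) / h})" for \<eta> :: real
  have "open (A \<eta>)" for \<eta>
    unfolding A_def
  proof (intro open_UN ballI open_Collect_less)
    fix h :: real assume "h \<in> {h. h \<noteq> 0 \<and> \<bar>h\<bar> < \<eta>}"
    then have "h \<noteq> 0" by simp
    then show "continuous_on UNIV (\<lambda>x. (u (x + h) - u x) / h)"
      by (intro continuous_intros continuous_on_compose2[OF assms]) auto
  qed auto
  moreover have "steep_points u q = (\<Inter>n. A (1 / real (Suc n)))"
  proof (intro equalityI subsetI)
    fix x assume x: "x \<in> steep_points u q"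
    have "x \<in> A (1 / real (Suc n))" for n
    proof -
      obtain y where y: "y \<noteq> x" "\<bar>y - x\<bar> < 1 / real (Suc n)" "q < (u y - u x) / (y - x)"
        using x unfolding steep_points_def mem_Collect_eq
        by (metis of_nat_0_less_iff zero_less_Suc zero_less_divide_1_iff)
      then show ?thesis unfolding A_def
        by (intro UN_I[of "y - x"]) (auto simp del: of_nat_Suc)
    qed
    then show "x \<in> (\<Inter>n. A (1 / real (Suc n)))" by blast
  next
    fix x assume x: "x \<in> (\<Inter>n. A (1 / real (Suc n)))"
    have "\<exists>y. y \<noteq> x \<and> \<bar>y - x\<bar> < \<eta> \<and> q < (u y - u x) / (y - x)" if "\<eta> > 0" for \<eta>
    proof -
      obtain n where n: "1 / real (Suc n) < \<eta>" by (rule nat_approx_posE[OF \<open>\<eta> > 0\<close>])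
      have "x \<in> A (1 / real (Suc n))" using x by blast
      then obtain h where "h \<noteq> 0" "\<bar>h\<bar> < 1 / real (Suc n)" "q < (u (x + h) - u x) / h"
        unfolding A_def by blast
      with n show ?thesis by (intro exI[of _ "x + h"]) (auto simp del: of_nat_Suc)
    qed
    then show "x \<in> steep_points u q" unfolding steep_points_def by blast
  qed
  ultimately show ?thesis by (auto intro!: sets.countable_INT borel_open)
qed

lemma not_steep_eventually:
  assumes "x \<notin> steep_points u q"
  shows "eventually (\<lambda>y. (u y - u x) / (y - x) \<le> q) (at x)"
  using assms unfolding steep_points_def eventually_at by (force simp: dist_real_def not_less)

text \<open>\<open>A\<close> consists of the eventual upper bounds of the difference quotient, and
  its infimum is the upper derivate; \<open>up\<close> and \<open>lo\<close> make it finite. If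
  quotients below some rational p under that infimum occurred arbitrarily close to x, then x would
  lie in the crossing set of p and any rational q in between. Rational levels keep the number of
  crossing sets countable.\<close>

lemma differentiable_if_not_steep:
  fixes u :: "real \<Rightarrow> real"
  assumes up: "x \<notin> steep_points u k" and lo: "x \<notin> steep_points (\<lambda>x. - u x) k'"
    and cross: "\<And>p q. p \<in> \<rat> \<Longrightarrow> q \<in> \<rat> \<Longrightarrow> p < q \<Longrightarrow> x \<notin> steep_points u q \<inter> steep_points (\<lambda>x. - u x) (- p)"
  shows "\<exists>D. (u has_real_derivative D) (at x)"
proof -
  define Q where "Q y = (u y - u x) / (y - x)" for y
  define A where "A = {q. eventually (\<lambda>y. Q y \<le> q) (at x)}"
  have neg: "(- u y - - u x) / (y - x) = - Q y" for y
    unfolding Q_def minus_divide_left by simp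
  have lower: "eventually (\<lambda>y. p \<le> Q y) (at x)" if "x \<notin> steep_points (\<lambda>x. - u x) (- p)" for p
    using not_steep_eventually[OF that] unfolding neg by simp
  have upper: "q \<in> A" if "x \<notin> steep_points u q" for q
    using not_steep_eventually[OF that] by (simp add: A_def Q_def)
  have ne: "A \<noteq> {}" using upper[OF up] by blast
  have bdd: "bdd_below A"
  proof (rule bdd_belowI)
    fix q assume "q \<in> A"
    then have "eventually (\<lambda>y. Q y \<le> q) (at x)" by (simp add: A_def)
    moreover have "eventually (\<lambda>y. - k' \<le> Q y) (at x)" using lower[of "- k'"] lo by simp
    ultimately have "eventually (\<lambda>y. - k' \<le> q) (at x)" by eventually_elim linarith
    then show "- k' \<le> q" by simp
  qed
  have "(Q \<longlongrightarrow> Inf A) (at x)"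
  proof (rule order_tendstoI)
    fix a assume "a < Inf A"
    then obtain p where p: "p \<in> \<rat>" "a < p" "p < Inf A" using Rats_dense_in_real by blast
    then obtain q where q: "q \<in> \<rat>" "p < q" "q < Inf A" using Rats_dense_in_real by blast
    have "q \<notin> A" using q(3) cInf_lower[OF _ bdd] by fastforce
    then have "x \<in> steep_points u q" using upper by blast
    then have "x \<notin> steep_points (\<lambda>x. - u x) (- p)" using cross[OF p(1) q(1,2)] by blast
    from lower[OF this] show "eventually (\<lambda>y. a < Q y) (at x)"
      by (rule eventually_mono) (use p in simp)
  next
    fix a assume "Inf A < a"
    then obtain q where "q \<in> A" "q < a" using cInf_lessD[OF ne] by blast
    then show "eventually (\<lambda>y. Q y < a) (at x)"
      unfolding A_def by (auto elim: eventually_mono)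
  qed
  then show ?thesis unfolding has_field_derivative_iff Q_def by blast
qed

lemma abs_continuous_on_minus:
  assumes "abs_continuous_on a b u"
  shows "abs_continuous_on a b (\<lambda>x. - u x)"
proof -
  have "(\<Sum>(v, w)\<in>D. \<bar>- u w - - u v\<bar>) = variation u D" for D
    by (intro sum.cong) auto
  then show ?thesis using assms unfolding abs_continuous_on_def by simp
qed

definition small_increments :: "(real \<Rightarrow> real) \<Rightarrow> real \<Rightarrow> real \<Rightarrow> real \<Rightarrow> real \<Rightarrow> bool" where
  "small_increments u a b \<delta> \<epsilon> \<longleftrightarrow>
     (\<forall>D :: (real \<times> real) set. finite D \<and> (\<forall>(v, w)\<in>D. a \<le> v \<and> v \<le> w \<and> w \<le> b) \<and>
        nonoverlapping D \<and>
        total_length D < \<delta> \<longrightarrow> variation u D < \<epsilon>)"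

lemma small_incrementsD:
  assumes "small_increments u a b \<delta> \<epsilon>" "finite D" "\<forall>(v, w)\<in>D. a \<le> v \<and> v \<le> w \<and> w \<le> b"
    "nonoverlapping D" "total_length D < \<delta>"
  shows "variation u D < \<epsilon>"
  using assms unfolding small_increments_def by simp

lemma abs_continuous_onE:
  assumes "abs_continuous_on a b u" "\<epsilon> > 0"
  obtains \<delta> where "\<delta> > 0" "small_increments u a b \<delta> \<epsilon>"
  using assms unfolding abs_continuous_on_def small_increments_def by meson

lemma abs_continuous_imp_continuous:
  assumes "\<And>a b. abs_continuous_on a b u"
  shows "continuous_on UNIV u"
  unfolding continuous_on_iff
proof (intro ballI allI impI)
  fix x e :: real assume "e > 0"
  obtain \<delta> where \<delta>: "\<delta> > 0" "small_increments u (x - 1) (x + 1) \<delta> e"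
    by (rule abs_continuous_onE[OF assms \<open>e > 0\<close>, of "x - 1" "x + 1"])
  have "dist (u y) (u x) < e" if y: "dist y x < min \<delta> 1" for y
  proof (cases "x \<le> y")
    case True
    then show ?thesis using small_incrementsD[OF \<delta>(2), of "{(x, y)}"] y by (simp add: dist_real_def)
  next
    case False
    then show ?thesis using small_incrementsD[OF \<delta>(2), of "{(y, x)}"] y by (simp add: dist_real_def abs_minus_commute)
  qed
  then show "\<exists>d>0. \<forall>y\<in>UNIV. dist y x < d \<longrightarrow> dist (u y) (u x) < e"
    using \<open>\<delta> > 0\<close> by (intro exI[of _ "min \<delta> 1"]) auto
qed

text \<open>Absolute continuity speaks only about families of small total length, while a Vitali
  family may be long. As each member is below r, some subfamily is short enough and still not below
  the threshold t.\<close>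

lemma subset_sum_between:
  fixes f :: "'a \<Rightarrow> real"
  assumes "finite D" "\<And>i. i \<in> D \<Longrightarrow> f i < r" "t \<le> sum f D" "t \<le> r" "r > 0"
  shows "\<exists>D'\<subseteq>D. t \<le> sum f D' \<and> sum f D' < 2 * r"
  using assms
proof (induction D rule: finite_induct)
  case empty
  then show ?case
    by auto
next
  case (insert x D)
  show ?case
  proof (cases "t \<le> sum f D")
    case True
    then show ?thesis using insert by (meson insertCI subset_insertI2)
  next
    case False
    moreover have "f x < r" using insert.prems by blast
    ultimately have "sum f (insert x D) < 2 * r" using insert.hyps insert.prems(3) by simp
    then show ?thesis using insert.prems(2) by blast
  qed
qed


lemma disjnt_closed_open:
  fixes D :: "(real \<times> real) set"
  assumes "separated D"
  shows "nonoverlapping D"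
  using assms
proof (rule pairwise_mono)
  show "(case i of (v, w) \<Rightarrow> \<lambda>(v', w'). {v<..<w} \<inter> {v'<..<w'} = {}) j"
    if "(case i of (v, w) \<Rightarrow> \<lambda>(v', w'). disjnt {v..w} {v'..w'}) j" for i j :: "real \<times> real"
  proof -
    have "{fst i..snd i} \<inter> {fst j..snd j} = {}" using that by (simp add: case_prod_unfold disjnt_def)
    moreover have "{fst i<..<snd i} \<subseteq> {fst i..snd i}" "{fst j<..<snd j} \<subseteq> {fst j..snd j}" by auto
    ultimately have "{fst i<..<snd i} \<inter> {fst j<..<snd j} = {}" by blast
    then show ?thesis by (simp only: case_prod_unfold)
  qed
qed auto

text \<open>If the upper derivate were infinite on a set of positive measure, Vitali intervals over
  that set would have increments above k times their length. A subfamily of total length between t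
  and \<delta> then has variation at least k t > 1, against absolute continuity with \<epsilon> =
  1.\<close>

lemma abs_continuous_steep_null:
  assumes cont: "continuous_on UNIV u" and ac: "abs_continuous_on c d u"
  shows "negligible ((\<Inter>k::nat. steep_points u (real k)) \<inter> {c<..<d})" (is "negligible ?S")
proof -
  have "(\<Inter>k::nat. steep_points u (real k)) \<in> sets borel"
    using steep_points_borel[OF cont] by (intro sets.countable_INT) auto
  then have S: "?S \<in> lmeasurable"
    using lmeasurable_box[of c d] by (intro lmeasurable_Int_borel) auto
  have "\<not> measure lebesgue ?S > 0"
  proof
    assume pos: "measure lebesgue ?S > 0" (is "?\<mu> > 0")
    obtain \<delta> where \<delta>: "\<delta> > 0" "small_increments u c d \<delta> 1"
      by (rule abs_continuous_onE[OF ac zero_less_one])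
    \<comment> \<open>\<open>?\<mu> / 2\<close> is what the Vitali family is certain to cover;
      \<open>\<delta> / 2\<close> is the size below which its intervals are kept, so that a
      subfamily can be cut to a total length below \<delta>.\<close>
    define t where "t = min (?\<mu> / 2) (\<delta> / 2)"
    have t: "t > 0" "t \<le> \<delta> / 2" "t \<le> ?\<mu> / 2" using pos \<delta>(1) by (auto simp: t_def)
    obtain k :: nat where k: "1 / t < real k" using reals_Archimedean2 by blast
    have fine: "\<exists>v w. (real k * (w - v) < u w - u v \<and> w - v < \<delta> / 2) \<and> v < w \<and> x \<in> {v..w} \<and> w - v < \<eta>"
      if "x \<in> ?S" "\<eta> > 0" for x \<eta>
      using steep_points_interval[of x u "real k" "min \<eta> (\<delta> / 2)"] that \<delta>(1) by auto
    have sub: "?S \<subseteq> {c<..<d}" by blast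
    have "?\<mu> / 2 > 0" using pos by simp
    have IM: "{c<..<d} \<in> lmeasurable" using lmeasurable_box[of c d] by simp
    obtain D where D0: "finite D" "\<forall>v w. (v, w) \<in> D \<longrightarrow>
        (real k * (w - v) < u w - u v \<and> w - v < \<delta> / 2) \<and> v < w \<and> {v..w} \<subseteq> {c<..<d}"
      "separated D"
      "measure lebesgue (?S - covered D) < ?\<mu> / 2"
      by (rule Vitali_intervals[OF S open_greaterThanLessThan sub IM \<open>?\<mu> / 2 > 0\<close>, of "\<lambda>v w. real k * (w - v) < u w - u v \<and> w - v < \<delta> / 2", OF fine])
    note D = D0(1) D0(2)[rule_format] D0(3,4)
    have UM: "covered D \<in> lmeasurable"
      using D(1) by (intro fmeasurable.finite_UN) auto
    have "?\<mu> \<le> measure lebesgue ((?S - covered D) \<union> covered D)"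
      by (rule measure_mono_fmeasurable) (use S UM in \<open>auto intro: fmeasurable.Diff fmeasurable.Un\<close>)
    also have "\<dots> \<le> measure lebesgue (?S - covered D) + measure lebesgue (covered D)"
      using S UM by (intro measure_Un_le) auto
    also have "measure lebesgue (covered D) = total_length D"
      by (rule measure_disjoint_intervals) (use D in \<open>auto simp: less_imp_le\<close>)
    finally have "t \<le> total_length D" using D(4) t(3) by linarith
    then obtain D' where D': "D' \<subseteq> D" "t \<le> total_length D'" "total_length D' < 2 * (\<delta> / 2)"
      using subset_sum_between[of D "\<lambda>(v, w). w - v" "\<delta> / 2" t] D(1,2) t(2) \<delta>(1) by auto
    have "variation u D' < 1"
    proof (rule small_incrementsD[OF \<delta>(2)])
      show "finite D'" using D'(1) D(1) finite_subset by blast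
      have "c \<le> v \<and> v \<le> w \<and> w \<le> d" if "(v, w) \<in> D'" for v w
      proof -
        have "v < w" "{v..w} \<subseteq> {c<..<d}" using D(2)[of v w] D'(1) that by auto
        then show ?thesis using subsetD[of "{v..w}" "{c<..<d}" v] subsetD[of "{v..w}" "{c<..<d}" w] by simp
      qed
      then show "\<forall>(v, w)\<in>D'. c \<le> v \<and> v \<le> w \<and> w \<le> d" by auto
      show "nonoverlapping D'"
        by (rule disjnt_closed_open[OF pairwise_subset[OF D(3) D'(1)]])
      show "total_length D' < \<delta>" using D'(3) by simp
    qed
    moreover have "real k * total_length D' \<le> variation u D'"
      unfolding sum_distrib_left
    proof (rule sum_mono)
      fix i assume "i \<in> D'"
      then show "real k * (case i of (v, w) \<Rightarrow> w - v) \<le> (case i of (v, w) \<Rightarrow> \<bar>u w - u v\<bar>)"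
        using D(2)[of "fst i" "snd i"] subsetD[OF D'(1), of i]
        by (auto simp: case_prod_unfold intro: order_trans[OF less_imp_le abs_ge_self])
    qed
    moreover have "real k * t \<le> real k * total_length D'"
      using D'(2) by (intro mult_left_mono) auto
    moreover have "1 < real k * t" using k t(1) by (simp add: pos_divide_less_eq)
    ultimately show False by linarith
  qed
  then show ?thesis using S by (simp add: negligible_iff_measure zero_less_measure_iff less_le)
qed

text \<open>The classical double covering for derivates, with absolute continuity in place of
  monotonicity. \<open>D1\<close> covers the set with slopes below p inside an open set hardly
  larger; \<open>D2\<close> covers it again, inside \<open>D1\<close>, with slopes above q. Both
  total lengths are close to ?\<mu> and the increments over the two families nearly agree, which
  forces q ?\<mu> to be at most about p ?\<mu>.\<close>

lemma abs_continuous_cross_null: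
  assumes cont: "continuous_on UNIV u" and ac: "abs_continuous_on c d u" and "p < q"
  shows "negligible (steep_points u q \<inter> steep_points (\<lambda>x. - u x) (- p) \<inter> {c<..<d})" (is "negligible ?S")
proof -
  have "steep_points u q \<inter> steep_points (\<lambda>x. - u x) (- p) \<in> sets borel"
    using cont by (intro sets.Int steep_points_borel continuous_intros)
  then have S: "?S \<in> lmeasurable"
    using lmeasurable_box[of c d] by (intro lmeasurable_Int_borel) auto
  have "\<not> measure lebesgue ?S > 0"
  proof
    assume pos: "measure lebesgue ?S > 0" (is "?\<mu> > 0")
    \<comment> \<open>The final inequality reads (q - p) ?\<mu> \<le> K \<epsilon>, and \<epsilon>
      is chosen to make the right-hand side half of the left.\<close>
    define K where "K = \<bar>p\<bar> + 1 + (q - p)"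
    have K: "K > 0" using \<open>p < q\<close> by (simp add: K_def)
    define \<epsilon> where "\<epsilon> = (q - p) * ?\<mu> / (2 * K)"
    have \<epsilon>: "\<epsilon> > 0" using K pos \<open>p < q\<close> by (simp add: \<epsilon>_def)
    obtain \<delta>0 where \<delta>0: "\<delta>0 > 0" "small_increments u c d \<delta>0 \<epsilon>"
      by (rule abs_continuous_onE[OF ac \<epsilon>])
    define \<delta> where "\<delta> = min \<delta>0 \<epsilon>"
    have \<delta>: "\<delta> > 0" "\<delta> \<le> \<delta>0" "\<delta> \<le> \<epsilon>" using \<delta>0(1) \<epsilon> by (auto simp: \<delta>_def)
    have \<delta>4: "\<delta> / 4 > 0" using \<delta> by simp
    obtain T where T: "open T" "?S \<subseteq> T" "T - ?S \<in> lmeasurable" "emeasure lebesgue (T - ?S) < ennreal (\<delta> / 4)"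
      using sets_lebesgue_outer_open[OF fmeasurableD[OF S] \<delta>4] by metis
    define U where "U = T \<inter> {c<..<d}"
    have U: "open U" "?S \<subseteq> U" "U \<subseteq> {c<..<d}" using T by (auto simp: U_def)
    have UM: "U \<in> lmeasurable"
      using U by (intro lmeasurable_open bounded_subset[OF _ U(3)]) auto
    have "measure lebesgue (T - ?S) < \<delta> / 4"
      using T(3,4) \<delta>4 by (simp add: emeasure_eq_measure2 ennreal_less_iff fmeasurableD2)
    moreover have "measure lebesgue U \<le> measure lebesgue ((T - ?S) \<union> ?S)"
      using UM T(3) S by (intro measure_mono_fmeasurable fmeasurable.Un) (auto simp: U_def fmeasurableD)
    moreover have "\<dots> \<le> measure lebesgue (T - ?S) + ?\<mu>"
      using T(3) S by (intro measure_Un_le) auto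
    ultimately have mU: "measure lebesgue U < ?\<mu> + \<delta> / 4" by linarith
    have fine1: "\<exists>v w. u w - u v < p * (w - v) \<and> v < w \<and> x \<in> {v..w} \<and> w - v < \<eta>"
      if "x \<in> ?S" "\<eta> > 0" for x \<eta>
    proof -
      have "x \<in> steep_points (\<lambda>x. - u x) (- p)" using that by blast
      from steep_points_interval[OF this that(2)] obtain v w
        where "- p * (w - v) < - u w - - u v \<and> v < w \<and> x \<in> {v..w} \<and> w - v < \<eta>" by blast
      then show ?thesis by (intro exI[of _ v] exI[of _ w]) auto
    qed
    obtain D1 where D10: "finite D1" "\<forall>v w. (v, w) \<in> D1 \<longrightarrow>
        u w - u v < p * (w - v) \<and> v < w \<and> {v..w} \<subseteq> U"
      "separated D1"
      "measure lebesgue (?S - covered D1) < \<delta> / 4"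
      by (rule Vitali_intervals[OF S U(1,2) UM \<delta>4, of "\<lambda>v w. u w - u v < p * (w - v)", OF fine1])
    note D1 = D10(1) D10(2)[rule_format] D10(3,4)
    define V where "V = (\<Union>(v, w)\<in>D1. {v<..<w})"
    have V1: "V \<subseteq> covered D1" unfolding V_def by fastforce
    have D1U: "covered D1 \<subseteq> U" using D1(2) by blast
    have V: "open V" "V \<subseteq> U" using V1 D1U by (auto simp: V_def)
    have VM: "V \<in> lmeasurable"
      using V UM by (intro fmeasurableI2[OF UM]) auto
    have M1: "covered D1 \<in> lmeasurable"
      using D1(1) by (intro fmeasurable.finite_UN) auto
    have l1: "total_length D1 \<le> measure lebesgue U"
    proof -
      have "total_length D1 = measure lebesgue (covered D1)"
        by (rule measure_disjoint_intervals[symmetric]) (use D1 in \<open>auto simp: less_imp_le\<close>)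
      also have "\<dots> \<le> measure lebesgue U"
        using D1U UM M1 by (intro measure_mono_fmeasurable) (auto simp: fmeasurableD)
      finally show ?thesis .
    qed
    have S2: "?S \<inter> V \<in> lmeasurable" using S VM by (rule fmeasurable.Int)
    have fine2: "\<exists>v w. q * (w - v) < u w - u v \<and> v < w \<and> x \<in> {v..w} \<and> w - v < \<eta>"
      if "x \<in> ?S \<inter> V" "\<eta> > 0" for x \<eta>
      using steep_points_interval[of x u q \<eta>] that by blast
    obtain D2 where D20: "finite D2" "\<forall>v w. (v, w) \<in> D2 \<longrightarrow>
        q * (w - v) < u w - u v \<and> v < w \<and> {v..w} \<subseteq> V"
      "separated D2"
      "measure lebesgue (?S \<inter> V - covered D2) < \<delta> / 4"
      by (rule Vitali_intervals[OF S2 V(1) Int_lower2 VM \<delta>4, of "\<lambda>v w. q * (w - v) < u w - u v", OF fine2])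
    note D2 = D20(1) D20(2)[rule_format] D20(3,4)
    have M2: "covered D2 \<in> lmeasurable"
      using D2(1) by (intro fmeasurable.finite_UN) auto
    define L1 where "L1 = total_length D1"
    define L2 where "L2 = total_length D2"
    \<comment> \<open>These finitely many end points contain all that the closed intervals of
      \<open>D1\<close> have beyond the open set \<open>V\<close>.\<close>
    define F where "F = fst ` D1 \<union> snd ` D1"
    have F: "finite F" using D1(1) by (simp add: F_def)
    have FM: "F \<in> lmeasurable" "measure lebesgue F = 0"
      using negligible_finite[OF F] negligible_imp_measurable negligible_imp_measure0 by blast+
    have D1F: "covered D1 \<subseteq> V \<union> F"
      unfolding V_def F_def by (force simp: less_le)
    let ?A = "?S - covered D1" and ?B = "?S \<inter> V - covered D2"
    have AM: "?A \<in> lmeasurable" "?B \<in> lmeasurable"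
      using S M1 S2 M2 by (auto intro: fmeasurable.Diff)
    have "?\<mu> \<le> measure lebesgue (?A \<union> (F \<union> (?B \<union> covered D2)))"
      using D1F S AM FM M2
      by (intro measure_mono_fmeasurable fmeasurable.Un) (blast intro: fmeasurableD)+
    also have "\<dots> \<le> measure lebesgue ?A + (measure lebesgue F + (measure lebesgue ?B + measure lebesgue (covered D2)))"
      using AM FM M2
      by (intro order_trans[OF measure_Un_le] add_left_mono sets.Un fmeasurableD order_refl) auto
    also have "measure lebesgue (covered D2) = L2"
      unfolding L2_def by (rule measure_disjoint_intervals) (use D2 in \<open>auto simp: less_imp_le\<close>)
    finally have l2: "?\<mu> - \<delta> / 2 \<le> L2" using D1(4) D2(4) FM(2) by linarith
    have l12: "L1 - L2 < \<delta>" using l1 l2 mU \<open>\<delta> > 0\<close> unfolding L1_def by linarith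
    have l21: "L2 \<le> L1"
    proof -
      have "L2 = measure lebesgue (covered D2)"
        unfolding L2_def by (rule measure_disjoint_intervals[symmetric]) (use D2 in \<open>auto simp: less_imp_le\<close>)
      also have "\<dots> \<le> measure lebesgue (covered D1)"
      proof (rule measure_mono_fmeasurable)
        show "covered D2 \<subseteq> covered D1" using D2(2) V1 by blast
      qed (use M1 M2 in auto)
      also have "\<dots> = L1"
        unfolding L1_def by (rule measure_disjoint_intervals) (use D1 in \<open>auto simp: less_imp_le\<close>)
      finally show ?thesis .
    qed
    have "\<bar>increments u D1 - increments u D2\<bar> < \<epsilon>"
    proof (rule abs_continuous_nested_families[OF small_incrementsD[OF \<delta>0(2)] D1(1) _ D1(3) D2(1) _ D2(3)])
      show "v < w \<and> c \<le> v \<and> w \<le> d" if "(v, w) \<in> D1" for v w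
      proof -
        have "v < w" "{v..w} \<subseteq> {c<..<d}" using D1(2)[OF that] U(3) by auto
        then show ?thesis using subsetD[of "{v..w}" "{c<..<d}" v] subsetD[of "{v..w}" "{c<..<d}" w] by simp
      qed
      show "v < w \<and> {v..w} \<subseteq> (\<Union>(v, w)\<in>D1. {v<..<w})" if "(v, w) \<in> D2" for v w
        using D2(2)[OF that] by (simp add: V_def)
      show "total_length D1 - total_length D2 < \<delta>0"
        using l12 \<delta>(2) unfolding L1_def L2_def by linarith
    qed
    moreover have "increments u D1 \<le> p * L1"
      unfolding L1_def sum_distrib_left using D1(2) by (intro sum_mono) (auto intro: less_imp_le)
    moreover have "q * L2 \<le> increments u D2"
      unfolding L2_def sum_distrib_left using D2(2) by (intro sum_mono) (auto intro: less_imp_le)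
    ultimately have 1: "q * L2 \<le> p * L1 + \<epsilon>" by linarith
    have "p * (L1 - L2) \<le> \<bar>p\<bar> * \<epsilon>"
      using l12 l21 \<delta>(3) by (intro mult_mono) auto
    with 1 have "(q - p) * L2 \<le> (\<bar>p\<bar> + 1) * \<epsilon>" by (simp add: algebra_simps)
    moreover have "(q - p) * (?\<mu> - \<epsilon> / 2) \<le> (q - p) * L2"
      using l2 \<delta>(3) \<open>p < q\<close> by (intro mult_left_mono) auto
    ultimately have "(q - p) * ?\<mu> \<le> (\<bar>p\<bar> + 1) * \<epsilon> + (q - p) * \<epsilon> / 2" by (simp add: algebra_simps)
    also have "\<dots> \<le> (\<bar>p\<bar> + 1) * \<epsilon> + (q - p) * \<epsilon>" using \<epsilon> \<open>p < q\<close> by simp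
    also have "\<dots> = K * \<epsilon>" by (simp add: K_def algebra_simps)
    also have "\<dots> = (q - p) * ?\<mu> / 2" using K by (simp add: \<epsilon>_def)
    finally show False using pos \<open>p < q\<close> by (simp add: field_simps)
  qed
  then show ?thesis using S by (simp add: negligible_iff_measure zero_less_measure_iff less_le)
qed

text \<open>At an exceptional point the upper derivate of u or of -u is infinite, or two rationals
  witness a crossing. The null sets known on bounded intervals are pasted by countability.\<close>

theorem abs_continuous_differentiable_ae:
  fixes u :: "real \<Rightarrow> real"
  assumes ac: "\<And>a b. abs_continuous_on a b u"
  shows "negligible {x. \<not> u differentiable at x}"
proof -
  have cont: "continuous_on UNIV u" using ac by (rule abs_continuous_imp_continuous)
  have cont': "continuous_on UNIV (\<lambda>x. - u x)" using cont by (intro continuous_intros)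
  let ?up = "\<Inter>k::nat. steep_points u (real k)" and ?lo = "\<Inter>k::nat. steep_points (\<lambda>x. - u x) (real k)"
  let ?cr = "\<lambda>p q. steep_points u q \<inter> steep_points (\<lambda>x. - u x) (- p)"
  let ?I = "{(p, q). p \<in> \<rat> \<and> q \<in> \<rat> \<and> p < q} :: (real \<times> real) set"
  have un: "A = (\<Union>n::nat. A \<inter> {- real n<..<real n})" for A :: "real set"
  proof -
    have "\<exists>n::nat. x \<in> {- real n<..<real n}" for x
    proof -
      obtain n :: nat where "\<bar>x\<bar> < real n" using reals_Archimedean2 by blast
      then show ?thesis by (intro exI[of _ n]) auto
    qed
    then show ?thesis by blast
  qed
  have neg: "negligible A" if "\<And>n::nat. negligible (A \<inter> {- real n<..<real n})" for A :: "real set"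
    by (subst un) (rule negligible_countable_Union, use that in auto)
  have "countable ?I"
    by (rule countable_subset[of _ "\<rat> \<times> \<rat>"]) (auto simp: countable_rat)
  moreover have "negligible (?cr p q)" if "p < q" for p q
    by (rule neg, rule abs_continuous_cross_null[OF cont ac that])
  ultimately have "negligible (\<Union>(p, q)\<in>?I. ?cr p q)"
    by (intro negligible_countable_Union countable_image) auto
  moreover have "negligible ?up" by (rule neg, rule abs_continuous_steep_null[OF cont ac])
  moreover have "negligible ?lo"
    by (rule neg, rule abs_continuous_steep_null[OF cont' abs_continuous_on_minus[OF ac]])
  ultimately have "negligible ((\<Union>(p, q)\<in>?I. ?cr p q) \<union> (?up \<union> ?lo))" by (intro negligible_Un)
  moreover have "{x. \<not> u differentiable at x} \<subseteq> (\<Union>(p, q)\<in>?I. ?cr p q) \<union> (?up \<union> ?lo)"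
  proof
    fix x assume x: "x \<in> {x. \<not> u differentiable at x}"
    show "x \<in> (\<Union>(p, q)\<in>?I. ?cr p q) \<union> (?up \<union> ?lo)"
    proof (rule ccontr)
      assume n: "x \<notin> (\<Union>(p, q)\<in>?I. ?cr p q) \<union> (?up \<union> ?lo)"
      then obtain k k' :: nat where "x \<notin> steep_points u (real k)" "x \<notin> steep_points (\<lambda>x. - u x) (real k')" by blast
      moreover have "x \<notin> ?cr p q" if "p \<in> \<rat>" "q \<in> \<rat>" "p < q" for p q
        using n that by blast
      ultimately have "\<exists>D. (u has_real_derivative D) (at x)" by (rule differentiable_if_not_steep)
      then show False using x real_differentiable_def by blast
    qed
  qed
  ultimately show ?thesis by (rule negligible_subset)
qed

section \<open>The fundamental theorem of calculus for absolutely continuous functions\<close>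

text \<open>The integral is taken in the gauge sense, so integrability of \<open>deriv u\<close> is
  a conclusion. Off the null set \<open>N\<close> the gauge comes from differentiability; intervals
  with tags in \<open>N\<close> are forced into an open set \<open>T\<close> of measure below
  \<delta>, where absolute continuity makes the sum of their increments small.\<close>

theorem abs_continuous_has_integral_deriv:
  fixes u :: "real \<Rightarrow> real"
  assumes ac: "\<And>a b. abs_continuous_on a b u" and "a \<le> b"
  shows "(deriv u has_integral (u b - u a)) {a..b}"
proof -
  define N where "N = {x. \<not> u differentiable at x}"
  have N: "negligible N" unfolding N_def by (rule abs_continuous_differentiable_ae[OF ac])
  define d where "d x = (if x \<in> N then 0 else deriv u x)" for x
  have der: "(u has_real_derivative d x) (at x)" if "x \<notin> N" for x
    using that unfolding N_def d_def
    by (auto simp: DERIV_deriv_iff_real_differentiable)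
  have "(d has_integral (u b - u a)) {a..b}"
    unfolding has_integral_real
  proof (intro allI impI)
    fix e :: real assume e: "e > 0"
    \<comment> \<open>Adding 1 keeps L positive when a = b.\<close>
    define L where "L = b - a + 1"
    have L: "L > 0" using \<open>a \<le> b\<close> by (simp add: L_def)
    define c where "c = e / (2 * L)"
    have c: "c > 0" "c * (b - a) < e / 2"
    proof -
      show "c > 0" using e L by (simp add: c_def)
      have "c * L = e / 2" using L by (simp add: c_def)
      then show "c * (b - a) < e / 2" using \<open>c > 0\<close> by (simp add: L_def algebra_simps)
    qed
    have "e / 2 > 0" using e by simp
    from abs_continuous_onE[OF ac this, of a b]
    obtain \<delta> where \<delta>: "\<delta> > 0" "small_increments u a b \<delta> (e / 2)" by blast
    obtain T where T: "N \<subseteq> T" "open T" "T - N \<in> lmeasurable" "emeasure lebesgue (T - N) < ennreal \<delta>"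
      using sets_lebesgue_outer_open[of N \<delta>] \<delta>(1) N negligible_imp_sets by metis
    have TM: "T \<in> lmeasurable"
      using fmeasurable.Un[OF T(3) negligible_imp_measurable[OF N]] T(1) by (simp add: Un_absorb2)
    have "measure lebesgue T \<le> measure lebesgue (T - N) + measure lebesgue N"
      using measure_Un_le[of "T - N" lebesgue N] T(1,3) negligible_imp_sets[OF N]
      by (simp add: fmeasurableD Un_absorb2)
    also have "\<dots> = measure lebesgue (T - N)" using N by (simp add: negligible_imp_measure0)
    also have "\<dots> < \<delta>"
      using T(3,4) \<delta>(1) by (simp add: emeasure_eq_measure2 ennreal_less_iff fmeasurableD2)
    finally have mT: "measure lebesgue T < \<delta>" .
    have "\<exists>r>0. (x \<in> N \<longrightarrow> ball x r \<subseteq> T) \<and>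
        (x \<notin> N \<longrightarrow> (\<forall>y\<in>ball x r. \<bar>u y - u x - d x * (y - x)\<bar> \<le> c * \<bar>y - x\<bar>))" for x
    proof (cases "x \<in> N")
      case True
      then have "x \<in> T" using T(1) by blast
      then show ?thesis using T(2) True unfolding open_contains_ball by blast
    next
      case False
      have "(u has_derivative (\<lambda>h. d x * h)) (at x)"
        using der[OF False] unfolding has_field_derivative_def .
      then obtain r where r: "r > 0" "\<And>y. norm (y - x) < r \<Longrightarrow> norm (u y - u x - d x * (y - x)) \<le> c * norm (y - x)"
        unfolding has_derivative_at_alt using c(1) by blast
      then show ?thesis using False by (intro exI[of _ r]) (auto simp: dist_real_def abs_minus_commute)
    qed
    then obtain r where r: "\<And>x. r x > 0" "\<And>x. x \<in> N \<Longrightarrow> ball x (r x) \<subseteq> T"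
      "\<And>x y. x \<notin> N \<Longrightarrow> y \<in> ball x (r x) \<Longrightarrow> \<bar>u y - u x - d x * (y - x)\<bar> \<le> c * \<bar>y - x\<bar>"
      by metis
    show "\<exists>\<gamma>. gauge \<gamma> \<and> (\<forall>\<D>. \<D> tagged_division_of {a..b} \<and> \<gamma> fine \<D> \<longrightarrow>
        norm ((\<Sum>(x, k)\<in>\<D>. measure lborel k *\<^sub>R d x) - (u b - u a)) < e)"
    proof (intro exI conjI allI impI)
      show "gauge (\<lambda>x. ball x (r x))" using r(1) by (simp add: gauge_ball_dependent)
      fix P assume P: "P tagged_division_of {a..b} \<and> (\<lambda>x. ball x (r x)) fine P"
      have fin: "finite P" using P by blast
      have K: "\<exists>v w. k = {v..w} \<and> v \<le> w \<and> a \<le> v \<and> w \<le> b \<and> x \<in> {v..w} \<and> {v..w} \<subseteq> ball x (r x)"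
        if xk: "(x, k) \<in> P" for x k
      proof -
        have td: "P tagged_division_of {a..b}" and "(\<lambda>x. ball x (r x)) fine P" using P by auto
        then have 1: "x \<in> k" "k \<subseteq> {a..b}" "k \<subseteq> ball x (r x)"
          using tagged_division_ofD(2,3)[OF td xk] fineD[OF _ xk] by blast+
        obtain v w where "k = cbox v w" using tagged_division_ofD(4)[OF td xk] by blast
        then have k: "k = {v..w}" by simp
        then have "v \<le> w" using 1(1) by auto
        then show ?thesis using 1 k by (intro exI[of _ v] exI[of _ w]) auto
      qed
      define A where "A = {(x, k) \<in> P. x \<notin> N}"
      \<comment> \<open>Degenerate intervals are left out: their terms vanish, and nonempty
        interiors are needed below to recover the tag from the interval.\<close>
      define B where "B = {(x, k) \<in> P. x \<in> N \<and> measure lborel k \<noteq> 0}"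
      define g where "g = (\<lambda>(x :: real, k). measure lborel k * d x - (u (Sup k) - u (Inf k)))"
      have tot: "u b - u a = (\<Sum>(x, k)\<in>P. u (Sup k) - u (Inf k))"
        using additive_tagged_division_1[OF \<open>a \<le> b\<close>, of P u] P by simp
      have len: "b - a = (\<Sum>(x, k)\<in>P. Sup k - Inf k)"
        using additive_tagged_division_1[OF \<open>a \<le> b\<close>, of P "\<lambda>x. x"] P by simp
      have "(\<Sum>(x, k)\<in>P. measure lborel k *\<^sub>R d x) - (u b - u a) = sum g P"
        unfolding tot g_def by (simp add: case_prod_unfold sum_subtractf)
      also have "\<dots> = sum g (A \<union> B)"
      proof (rule sum.mono_neutral_right)
        show "\<forall>i\<in>P - (A \<union> B). g i = 0"
        proof
          fix i assume "i \<in> P - (A \<union> B)"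
          then obtain x k where i: "i = (x, k)" "(x, k) \<in> P" "measure lborel k = 0"
            by (cases i) (auto simp: A_def B_def)
          obtain v w where "k = {v..w}" "v \<le> w" using K[OF i(2)] by blast
          with i show "g i = 0" by (simp add: g_def)
        qed
      qed (use fin in \<open>auto simp: A_def B_def\<close>)
      also have "\<dots> = sum g A + sum g B"
        using fin by (intro sum.union_disjoint) (auto simp: A_def B_def intro: finite_subset[of _ P])
      finally have eq: "(\<Sum>(x, k)\<in>P. measure lborel k *\<^sub>R d x) - (u b - u a) = sum g A + sum g B" .
      have finA: "finite A" "finite B" using fin by (auto simp: A_def B_def intro: finite_subset[of _ P])
      have "\<bar>sum g A\<bar> \<le> (\<Sum>(x, k)\<in>A. c * (Sup k - Inf k))"
      proof (rule order_trans[OF sum_abs sum_mono])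
        fix i assume "i \<in> A"
        then obtain x k where i: "i = (x, k)" "(x, k) \<in> P" "x \<notin> N" by (auto simp: A_def)
        obtain v w where k: "k = {v..w}" "v \<le> w" "x \<in> {v..w}" "{v..w} \<subseteq> ball x (r x)" using K[OF i(2)] by blast
        have "v \<in> ball x (r x)" "w \<in> ball x (r x)"
          using subsetD[OF k(4), of v] subsetD[OF k(4), of w] k(2) by simp_all
        then have "\<bar>u v - u x - d x * (v - x)\<bar> \<le> c * (x - v)" "\<bar>u w - u x - d x * (w - x)\<bar> \<le> c * (w - x)"
          using r(3)[OF i(3), of v] r(3)[OF i(3), of w] k(3) by simp_all
        \<comment> \<open>Straddle estimate: the tag lies in [v, w], so the errors c (x - v) and c
          (w - x) add up to c (w - v).\<close>
        then have "\<bar>(w - v) * d x - (u w - u v)\<bar> \<le> c * (w - v)" by (simp add: algebra_simps abs_le_iff)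
        then show "\<bar>g i\<bar> \<le> (case i of (x, k) \<Rightarrow> c * (Sup k - Inf k))"
          using k by (simp add: i g_def)
      qed
      also have "\<dots> \<le> (\<Sum>(x, k)\<in>P. c * (Sup k - Inf k))"
      proof (rule sum_mono2[OF fin])
        fix i assume i: "i \<in> P - A"
        obtain x k where "i = (x, k)" by fastforce
        then show "0 \<le> (case i of (x, k) \<Rightarrow> c * (Sup k - Inf k))" using K[of x k] i c(1) by auto
      qed (auto simp: A_def)
      also have "\<dots> = c * (b - a)" unfolding len by (simp add: case_prod_unfold sum_distrib_left)
      finally have A: "\<bar>sum g A\<bar> < e / 2" using c(2) by linarith
      define h where "h = (\<lambda>(x :: real, k :: real set). (Inf k, Sup k))"
      have intK: "interior k \<noteq> {}" if "(x, k) \<in> B" for x k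
      proof -
        have "(x, k) \<in> P" "measure lborel k \<noteq> 0" using that by (auto simp: B_def)
        then obtain v w where "k = {v..w}" "v \<le> w" using K[of x k] by blast
        then show ?thesis using \<open>measure lborel k \<noteq> 0\<close> by auto
      qed
      have dis: "interior k \<inter> interior k' = {}" if "(x, k) \<in> B" "(x', k') \<in> B" "(x, k) \<noteq> (x', k')" for x k x' k'
        using tagged_division_ofD(5)[of P "{a..b}" x k x' k'] P that unfolding B_def by auto
      have hk: "{fst (h i)..snd (h i)} = snd i \<and> fst (h i) \<le> snd (h i)" if "i \<in> B" for i
      proof -
        have "(fst i, snd i) \<in> P" using that by (auto simp: B_def)
        from K[OF this] show ?thesis by (auto simp: h_def case_prod_unfold)
      qed
      have inj: "inj_on h B"
      proof (rule inj_onI)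
        fix i j assume ij: "i \<in> B" "j \<in> B" "h i = h j"
        then have "snd i = snd j" using hk by metis
        then show "i = j"
          using dis[of "fst i" "snd i" "fst j" "snd j"] intK[of "fst i" "snd i"] ij by (metis inf.idem prod.collapse)
      qed
      have "variation u (h ` B) < e / 2"
      proof (rule small_incrementsD[OF \<delta>(2)])
        show "finite (h ` B)" using finA by simp
        have "a \<le> v \<and> v \<le> w \<and> w \<le> b" if vw: "(v, w) \<in> h ` B" for v w
        proof -
          obtain i where i: "i \<in> B" "(v, w) = h i" using vw by blast
          then have "(fst i, snd i) \<in> P" by (auto simp: B_def)
          from K[OF this] show ?thesis using i by (auto simp: h_def case_prod_unfold)
        qed
        then show "\<forall>(v, w)\<in>h ` B. a \<le> v \<and> v \<le> w \<and> w \<le> b"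
          by (intro ballI case_prodI2) metis
        have disj: "{fst (h i)<..<snd (h i)} \<inter> {fst (h j)<..<snd (h j)} = {}"
          if "i \<in> B" "j \<in> B" "h i \<noteq> h j" for i j
        proof -
          have "interior (snd i) \<inter> interior (snd j) = {}"
            using dis[of "fst i" "snd i" "fst j" "snd j"] that by auto
          moreover have "interior (snd i) = {fst (h i)<..<snd (h i)}" if "i \<in> B" for i
            using hk[OF that] interior_atLeastAtMost_real by metis
          ultimately show ?thesis using that by simp
        qed
        then show dj: "nonoverlapping (h ` B)"
          unfolding pairwise_def by (auto simp: case_prod_unfold simp del: Int_greaterThanLessThan)
        have "total_length (h ` B) = (\<Sum>i\<in>h ` B. measure lebesgue {fst i<..<snd i})"
          using hk by (intro sum.cong) (auto simp: case_prod_unfold)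
        also have "\<dots> = measure lebesgue (\<Union>i\<in>h ` B. {fst i<..<snd i})"
        proof (rule measure_UNION'[symmetric])
          show "pairwise (\<lambda>i j. disjnt {fst i<..<snd i} {fst j<..<snd j}) (h ` B)"
            using dj by (simp add: case_prod_unfold disjnt_def)
          show "{fst i<..<snd i} \<in> lmeasurable" for i :: "real \<times> real"
            using lmeasurable_box[of "fst i" "snd i"] by simp
        qed (use finA in auto)
        also have "\<dots> \<le> measure lebesgue T"
        proof (rule measure_mono_fmeasurable[OF _ _ TM])
          have "{fst (h i)<..<snd (h i)} \<subseteq> T" if "i \<in> B" for i
          proof -
            have i: "(fst i, snd i) \<in> P" "fst i \<in> N" using that by (auto simp: B_def)
            have "{fst (h i)<..<snd (h i)} \<subseteq> {fst (h i)..snd (h i)}" by auto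
            also have "\<dots> = snd i" using hk[OF that] by simp
            also have "\<dots> \<subseteq> ball (fst i) (r (fst i))" using K[OF i(1)] by blast
            also have "\<dots> \<subseteq> T" using r(2) i(2) by blast
            finally show ?thesis .
          qed
          then show "(\<Union>i\<in>h ` B. {fst i<..<snd i}) \<subseteq> T" by blast
          show "(\<Union>i\<in>h ` B. {fst i<..<snd i}) \<in> sets lebesgue"
            using finA by (intro sets.finite_UN) auto
        qed
        finally show "total_length (h ` B) < \<delta>" using mT by linarith
      qed
      moreover have "\<bar>sum g B\<bar> \<le> variation u (h ` B)"
      proof -
        have "\<bar>sum g B\<bar> \<le> (\<Sum>i\<in>B. \<bar>g i\<bar>)" by (rule sum_abs)
        also have "\<dots> = (\<Sum>i\<in>B. case h i of (v, w) \<Rightarrow> \<bar>u w - u v\<bar>)"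
          by (intro sum.cong) (auto simp: B_def g_def h_def d_def)
        also have "\<dots> = variation u (h ` B)"
          by (rule sum.reindex[OF inj, unfolded comp_def, symmetric])
        finally show ?thesis .
      qed
      ultimately show "norm ((\<Sum>(x, k)\<in>P. measure lborel k *\<^sub>R d x) - (u b - u a)) < e"
        unfolding eq real_norm_def using A by linarith
    qed
  qed
  then show ?thesis
    by (rule has_integral_spike[OF N, rotated]) (auto simp: d_def)
qed

section \<open>Integrals of L_p functions over intervals\<close>

text \<open>An elementary substitute for Hoelder's inequality, to be integrated and followed by a
  choice of t: t = 1 gives local integrability, a large t uniform integrability, and the balancing t
  Hoelder's inequality up to a factor 2.\<close>

lemma young_split:
  fixes x t p :: real
  assumes "t > 0" "p > 1" "x \<ge> 0"
  shows "x \<le> t + t powr (1 - p) * x powr p"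
proof (cases "x \<le> t")
  case True
  then show ?thesis using assms by (simp add: add_increasing2)
next
  case False
  then have x: "x > t" "x > 0" using assms by auto
  have "x = x powr (1 - p) * x powr p" using x by (simp flip: powr_add)
  also have "\<dots> \<le> t powr (1 - p) * x powr p"
    using assms x by (intro mult_right_mono powr_mono2') auto
  finally show ?thesis using assms by simp
qed

lemma in_Lp_set_integrable:
  assumes "in_Lp p g" "p > 1"
  shows "set_integrable lebesgue {a..b} g"
  unfolding set_integrable_def
proof (rule Bochner_Integration.integrable_bound)
  have "integrable lebesgue (indicat_real {a..b})"
    using lmeasurable_iff_integrable lmeasurable_interval by blast
  moreover have "integrable lebesgue (\<lambda>x. \<bar>g x\<bar> powr p)" using assms by (simp add: in_Lp_def)
  ultimately show "integrable lebesgue (\<lambda>x. indicat_real {a..b} x + \<bar>g x\<bar> powr p)"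
    by (rule Bochner_Integration.integrable_add)
  show "(\<lambda>x. indicat_real {a..b} x *\<^sub>R g x) \<in> borel_measurable lebesgue"
    using assms unfolding real_scaleR_def in_Lp_def
    by (intro borel_measurable_times borel_measurable_indicator) auto
  show "AE x in lebesgue. norm (indicat_real {a..b} x *\<^sub>R g x) \<le> norm (indicat_real {a..b} x + \<bar>g x\<bar> powr p)"
    using young_split[of 1 p] assms(2) by (intro AE_I2) (auto simp: indicator_def)
qed

abbreviation abs_integral :: "(real \<Rightarrow> real) \<Rightarrow> real \<Rightarrow> real \<Rightarrow> real" where
  "abs_integral g a b \<equiv> (LINT t:{a..b}|lebesgue. \<bar>g t\<bar>)"

lemma abs_continuous_increment_le:
  assumes ac: "\<And>a b. abs_continuous_on a b u" and "a \<le> b" and L: "in_Lp p (deriv u)" "p > 1"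
  shows "\<bar>u b - u a\<bar> \<le> abs_integral (deriv u) a b"
proof -
  have i: "set_integrable lebesgue {a..b} (deriv u)" by (rule in_Lp_set_integrable[OF L])
  have "u b - u a = (LINT t:{a..b}|lebesgue. deriv u t)"
    using has_integral_set_lebesgue[OF i] abs_continuous_has_integral_deriv[OF ac \<open>a \<le> b\<close>]
    by (rule has_integral_unique[rotated])
  then show ?thesis using set_integral_norm_bound[OF i] by simp
qed

lemma set_integral_closed_open:
  fixes g :: "real \<Rightarrow> real"
  assumes "g \<in> borel_measurable lebesgue"
  shows "(LINT t:{a..b}|lebesgue. g t) = (LINT t:{a<..<b}|lebesgue. g t)"
  unfolding set_lebesgue_integral_def
proof (rule integral_cong_AE)
  have "AE x in lebesgue. x \<notin> {a, b}"
    using negligible_finite[of "{a, b}"] by (intro AE_not_in) (auto simp: negligible_iff_null_sets)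
  then show "AE x in lebesgue. indicat_real {a..b} x *\<^sub>R g x = indicat_real {a<..<b} x *\<^sub>R g x"
    by (rule AE_mp) (auto simp: indicator_def)
qed (use assms in \<open>auto simp del: real_scaleR_def intro!: borel_measurable_scaleR borel_measurable_indicator\<close>)

text \<open>Uniform integrability: over a family of total length l the integral of |k| is at most t
  l + t^(1-p) M. The second term is made small by t, and then the first one by the length.\<close>

theorem abs_continuous_if_increments_le:
  assumes L: "in_Lp p k" and p: "p > 1"
    and inc: "\<And>x y. x \<le> y \<Longrightarrow> \<bar>u y - u x\<bar> \<le> abs_integral k x y"
  shows "abs_continuous_on a b u"
  unfolding abs_continuous_on_def
proof (intro allI impI)
  fix \<epsilon> :: real assume \<epsilon>: "\<epsilon> > 0"
  have km: "k \<in> borel_measurable lebesgue" and kp: "integrable lebesgue (\<lambda>x. \<bar>k x\<bar> powr p)"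
    using L by (auto simp: in_Lp_def)
  define M where "M = (LINT x|lebesgue. \<bar>k x\<bar> powr p)"
  have M: "M \<ge> 0" unfolding M_def by (intro integral_nonneg_AE AE_I2) simp
  \<comment> \<open>Chosen so that t^(1-p) = 1/X, hence t^(1-p) M < \<epsilon>/2; the summand 2
    keeps X positive and the inequality strict when M = 0.\<close>
  define X where "X = (2 * M + 2) / \<epsilon>"
  have X: "X > 0" using M \<epsilon> by (simp add: X_def)
  define t where "t = X powr (1 / (p - 1))"
  have t: "t > 0" using X by (simp add: t_def)
  have "t powr (1 - p) = X powr (- 1)"
  proof -
    have "1 / (p - 1) * (1 - p) = - 1" using p by (simp add: divide_eq_eq)
    then show ?thesis unfolding t_def powr_powr by simp
  qed
  then have "t powr (1 - p) * (2 * M + 2) = \<epsilon>"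
    using X M \<epsilon> by (simp add: powr_minus X_def)
  then have "2 * (t powr (1 - p) * M) + 2 * t powr (1 - p) = \<epsilon>" by (simp add: algebra_simps)
  moreover have "t powr (1 - p) > 0" using t by simp
  ultimately have tp: "t powr (1 - p) * M < \<epsilon> / 2" by linarith
  have bound: "variation u D < \<epsilon>"
    if D: "finite D" "\<forall>(v, w)\<in>D. a \<le> v \<and> v \<le> w \<and> w \<le> b"
      "nonoverlapping D"
      "total_length D < \<epsilon> / (2 * t)" for D
  proof -
    define I where "I i = {fst i<..<snd i}" for i :: "real \<times> real"
    have ord: "fst i \<le> snd i" if "i \<in> D" for i using D(2) that by auto
    have intp: "integrable lebesgue (\<lambda>x. indicat_real (I i) x * \<bar>k x\<bar> powr p)" for i
      using integrable_mult_indicator[OF _ kp, of "I i"] by (simp add: I_def)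
    have intI: "integrable lebesgue (indicat_real (I i))" for i
      using lmeasurable_iff_integrable[of "I i"] lmeasurable_box[of "fst i" "snd i"] by (simp add: I_def)
    have one: "\<bar>u (snd i) - u (fst i)\<bar> \<le> t * (snd i - fst i) + t powr (1 - p) * (LINT x|lebesgue. indicat_real (I i) x * \<bar>k x\<bar> powr p)"
      if "i \<in> D" for i
    proof -
      have "\<bar>u (snd i) - u (fst i)\<bar> \<le> abs_integral k (fst i) (snd i)" using inc ord[OF that] by blast
      also have "\<dots> = (LINT x|lebesgue. indicat_real (I i) x * \<bar>k x\<bar>)"
        using set_integral_closed_open[of "\<lambda>x. \<bar>k x\<bar>" "fst i" "snd i"] km by (simp add: set_lebesgue_integral_def I_def)
      also have "\<dots> \<le> (LINT x|lebesgue. t * indicat_real (I i) x + t powr (1 - p) * (indicat_real (I i) x * \<bar>k x\<bar> powr p))"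
      proof (rule integral_mono)
        show le: "indicat_real (I i) x * \<bar>k x\<bar> \<le> t * indicat_real (I i) x + t powr (1 - p) * (indicat_real (I i) x * \<bar>k x\<bar> powr p)" for x
          using young_split[OF t p, of "\<bar>k x\<bar>"] by (simp add: indicator_def)
        show i2: "integrable lebesgue (\<lambda>x. t * indicat_real (I i) x + t powr (1 - p) * (indicat_real (I i) x * \<bar>k x\<bar> powr p))"
          using intp intI by (intro Bochner_Integration.integrable_add integrable_mult_right)
        show "integrable lebesgue (\<lambda>x. indicat_real (I i) x * \<bar>k x\<bar>)"
        proof (rule Bochner_Integration.integrable_bound[OF i2])
          show "(\<lambda>x. indicat_real (I i) x * \<bar>k x\<bar>) \<in> borel_measurable lebesgue"
            using km unfolding I_def by (intro borel_measurable_times borel_measurable_indicator borel_measurable_abs) auto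
          show "AE x in lebesgue. norm (indicat_real (I i) x * \<bar>k x\<bar>)
              \<le> norm (t * indicat_real (I i) x + t powr (1 - p) * (indicat_real (I i) x * \<bar>k x\<bar> powr p))"
            using le by (intro AE_I2) (smt (verit) indicator_pos_le mult_nonneg_nonneg abs_ge_zero real_norm_def)
        qed
      qed
      also have "\<dots> = t * (snd i - fst i) + t powr (1 - p) * (LINT x|lebesgue. indicat_real (I i) x * \<bar>k x\<bar> powr p)"
        using intp[of i] intI[of i] ord[OF that] by (simp add: I_def)
      finally show ?thesis .
    qed
    have "(\<Sum>i\<in>D. (LINT x|lebesgue. indicat_real (I i) x * \<bar>k x\<bar> powr p)) = (LINT x|lebesgue. (\<Sum>i\<in>D. indicat_real (I i) x * \<bar>k x\<bar> powr p))"
      using intp by (subst Bochner_Integration.integral_sum) auto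
    also have "\<dots> \<le> M"
      unfolding M_def
    proof (rule integral_mono[OF _ kp])
      show "integrable lebesgue (\<lambda>x. \<Sum>i\<in>D. indicat_real (I i) x * \<bar>k x\<bar> powr p)"
        using intp by (intro Bochner_Integration.integrable_sum) auto
      fix x
      have "(\<Sum>i\<in>D. indicat_real (I i) x) \<le> 1"
      proof (cases "\<exists>i\<in>D. x \<in> I i")
        case True
        then obtain i where i: "i \<in> D" "x \<in> I i" by blast
        have "x \<notin> I j" if "j \<in> D" "j \<noteq> i" for j
          using pairwiseD[OF D(3) i(1) that(1)] that i unfolding I_def case_prod_unfold by blast
        then have "(\<Sum>i\<in>D. indicat_real (I i) x) = (\<Sum>j\<in>D. if j = i then 1 else 0)"
          using i by (intro sum.cong) (auto simp: indicator_def)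
        then show ?thesis using D(1) by simp
      next
        case False
        then have "(\<Sum>i\<in>D. indicat_real (I i) x) = 0" by (intro sum.neutral) (auto simp: indicator_def)
        then show ?thesis by simp
      qed
      then show "(\<Sum>i\<in>D. indicat_real (I i) x * \<bar>k x\<bar> powr p) \<le> \<bar>k x\<bar> powr p"
        unfolding sum_distrib_right[symmetric] by (intro mult_left_le_one_le) (auto intro: sum_nonneg)
    qed
    finally have sumM: "(\<Sum>i\<in>D. (LINT x|lebesgue. indicat_real (I i) x * \<bar>k x\<bar> powr p)) \<le> M" .
    have "variation u D = (\<Sum>i\<in>D. \<bar>u (snd i) - u (fst i)\<bar>)" by (simp add: case_prod_unfold)
    also have "\<dots> \<le> (\<Sum>i\<in>D. t * (snd i - fst i) + t powr (1 - p) * (LINT x|lebesgue. indicat_real (I i) x * \<bar>k x\<bar> powr p))"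
      by (intro sum_mono one)
    also have "\<dots> = t * total_length D + t powr (1 - p) * (\<Sum>i\<in>D. (LINT x|lebesgue. indicat_real (I i) x * \<bar>k x\<bar> powr p))"
      by (simp add: sum.distrib sum_distrib_left case_prod_unfold)
    also have "\<dots> \<le> t * total_length D + t powr (1 - p) * M"
      using sumM by (intro add_left_mono mult_left_mono) auto
    also have "t * total_length D < t * (\<epsilon> / (2 * t))" using D(4) t by (intro mult_strict_left_mono)
    also have "t * (\<epsilon> / (2 * t)) = \<epsilon> / 2" using t by simp
    finally show ?thesis using tp by linarith
  qed
  show "\<exists>\<delta>>0. \<forall>D :: (real \<times> real) set.
        finite D \<and> (\<forall>(u, v)\<in>D. a \<le> u \<and> u \<le> v \<and> v \<le> b) \<and>
        pairwise (\<lambda>(u, v) (u', v'). {u<..<v} \<inter> {u'<..<v'} = {}) D \<and>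
        (\<Sum>(u, v)\<in>D. v - u) < \<delta>
        \<longrightarrow> variation u D < \<epsilon>"
    using bound \<epsilon> t by (intro exI[of _ "\<epsilon> / (2 * t)"]) auto
qed

section \<open>The greedy sets\<close>

definition E_convex :: "real set \<Rightarrow> real set \<Rightarrow> bool" where
  "E_convex E A \<longleftrightarrow> (\<forall>u\<in>A. \<forall>v\<in>A. \<forall>e\<in>E. u \<le> e \<and> e \<le> v \<longrightarrow> e \<in> A)"

text \<open>Connectedness of the graph on \<open>Y\<close> whose edges join points at distance at
  most \<delta>, stated through cuts. This is the form that a greedy construction started elsewhere
  in \<open>Y\<close> consumes: as long as it has not filled \<open>Y\<close>, an edge leads out of
  it.\<close>

definition chained :: "real \<Rightarrow> real set \<Rightarrow> bool" where
  "chained \<delta> Y \<longleftrightarrow> (\<forall>B. B \<noteq> {} \<and> B \<subset> Y \<longrightarrow> (\<exists>y\<in>Y - B. \<exists>w\<in>B. dist y w \<le> \<delta>))"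

lemma chained_insert:
  assumes Y: "chained \<delta> Y" and w: "w \<in> Y" "dist y w \<le> \<delta>"
  shows "chained \<delta> (insert y Y)"
  unfolding chained_def
proof (intro allI impI)
  fix B assume B: "B \<noteq> {} \<and> B \<subset> insert y Y"
  show "\<exists>y'\<in>insert y Y - B. \<exists>w\<in>B. dist y' w \<le> \<delta>"
  proof (cases "y \<in> B")
    case False
    then have "B \<subseteq> Y" using B by blast
    then show ?thesis
    proof (cases "B = Y")
      case True
      then show ?thesis using w False by blast
    next
      case False
      then obtain y' v where "y' \<in> Y - B" "v \<in> B" "dist y' v \<le> \<delta>"
        using Y B \<open>B \<subseteq> Y\<close> unfolding chained_def by (metis psubsetI)
      then show ?thesis by blast
    qed
  next
    case True
    show ?thesis
    proof (cases "w \<in> B")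
      case False
      then show ?thesis using True w by (metis DiffI dist_commute insertI2)
    next
      case wB: True
      show ?thesis
      proof (cases "B - {y} = {}")
        case True
        then have "w = y" using wB by blast
        then have "insert y Y = Y" using w by blast
        then show ?thesis using Y B unfolding chained_def by metis
      next
        case False
        show ?thesis
        proof (cases "y \<in> Y")
          case True
          then have "insert y Y = Y" by blast
          then show ?thesis using Y B unfolding chained_def by metis
        next
          case yY: False
          then have "B - {y} \<subset> Y" using B True by blast
          then obtain y' v where "y' \<in> Y - (B - {y})" "v \<in> B - {y}" "dist y' v \<le> \<delta>"
            using Y False unfolding chained_def by metis
          then show ?thesis using yY by blast
        qed
      qed
    qed
  qed
qed

locale whitney =
  fixes m :: nat and E :: "real set" and nc :: "real set \<Rightarrow> real"
  assumes m: "m \<ge> 1" and closed_E: "closed E" and big: "infinite E \<or> card E \<ge> m + 1"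
    and nc: "nearest_point_choice E nc"
begin

abbreviation "Y \<equiv> Y_set nc"
abbreviation "yp \<equiv> y_pt nc"
abbreviation "ns \<equiv> n_stop m E nc"
abbreviation "S \<equiv> S_set m E nc"
abbreviation "sp \<equiv> s_pt m E nc"

lemma Y_image: "Y x j = yp x ` {..j}"
  by (induction j) (auto simp: atMost_Suc)

lemma ns_le: "ns x \<le> m - 1"
  unfolding n_stop_def by (rule Least_le) simp

lemma ns_stop: "ns x = m - 1 \<or> yp x (ns x) islimpt E"
  unfolding n_stop_def by (rule LeastI[of _ "m - 1"]) simp

lemma before_ns:
  assumes "j < ns x"
  shows "\<not> yp x j islimpt E" "j < m - 1"
  using not_less_Least[OF assms[unfolded n_stop_def]] assms ns_le[of x] by auto

lemma Y_no_limit: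
  assumes "j < ns x" "z \<in> Y x j"
  shows "\<not> z islimpt E"
  using assms before_ns unfolding Y_image by force

text \<open>\<open>E\<close> has more than m points, so a set of at most m points is a proper subset
  and the choice function is constrained on it.\<close>

lemma nc_props:
  assumes "finite A" "A \<noteq> {}" "A \<subseteq> E" "card A \<le> m" "\<And>z. z \<in> A \<Longrightarrow> \<not> z islimpt E"
  shows "nc A \<in> E - A" "\<And>y. y \<in> E - A \<Longrightarrow> infdist (nc A) A \<le> infdist y A"
proof -
  have "A \<noteq> E" using assms(1,4) big by auto
  then have "finite A \<and> A \<noteq> {} \<and> A \<subset> E" using assms by blast
  with nc assms(5) show "nc A \<in> E - A" "\<And>y. y \<in> E - A \<Longrightarrow> infdist (nc A) A \<le> infdist y A"
    unfolding nearest_point_choice_def by blast+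
qed

text \<open>Before the stopping index the sets contain no limit point, so every step takes the
  nearest-point branch and adds a new element; the exact cardinality rests on this.\<close>

lemma Y_basic:
  assumes "x \<in> E" "j \<le> ns x"
  shows "finite (Y x j) \<and> Y x j \<subseteq> E \<and> card (Y x j) = Suc j \<and> x \<in> Y x j"
  using assms(2)
proof (induction j)
  case 0
  then show ?case using assms by simp
next
  case (Suc j)
  then have IH: "finite (Y x j)" "Y x j \<subseteq> E" "card (Y x j) = Suc j" "x \<in> Y x j" by auto
  have "nc (Y x j) \<in> E - Y x j"
  proof (rule nc_props)
    show "card (Y x j) \<le> m" using IH(3) before_ns(2)[of j x] Suc.prems by simp
    show "\<not> z islimpt E" if "z \<in> Y x j" for z using Y_no_limit[of j x z] Suc.prems that by simp
  qed (use IH in auto)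
  then show ?case using IH by simp
qed

lemma next_point:
  assumes "x \<in> E" "j < ns x"
  shows "yp x (Suc j) \<in> E - Y x j"
    and "\<And>y. y \<in> E - Y x j \<Longrightarrow> infdist (yp x (Suc j)) (Y x j) \<le> infdist y (Y x j)"
proof -
  have Y: "finite (Y x j)" "Y x j \<subseteq> E" "card (Y x j) = Suc j" "x \<in> Y x j"
    using Y_basic[of x j] assms by auto
  have c: "card (Y x j) \<le> m" using Y(3) before_ns(2)[OF assms(2)] by simp
  have ne: "Y x j \<noteq> {}" using Y(4) by blast
  show "yp x (Suc j) \<in> E - Y x j"
    using nc_props(1)[OF Y(1) ne Y(2) c Y_no_limit[OF assms(2)]] by simp
  show "infdist (yp x (Suc j)) (Y x j) \<le> infdist y (Y x j)" if "y \<in> E - Y x j" for y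
    using nc_props(2)[OF Y(1) ne Y(2) c Y_no_limit[OF assms(2)] that] by simp
qed

lemma infdist_Y_attained:
  assumes "x \<in> E" "j \<le> ns x"
  obtains w where "w \<in> Y x j" "infdist y (Y x j) = dist y w"
proof -
  have Y: "finite (Y x j)" "x \<in> Y x j" using Y_basic[OF assms] by auto
  have "closed (Y x j)" "Y x j \<noteq> {}" using Y finite_imp_closed by blast+
  from infdist_attains_inf[OF this, of y] that show thesis by blast
qed

text \<open>Suppose e in \<open>E\<close> is missing from the set but lies between the new point p
  and an old point v. The old point w nearest to p is on the same side of e as v, by convexity so
  far, so e lies between p and w and is nearer to the set than p, against the choice of p.\<close>

lemma Y_convex:
  assumes "x \<in> E" "j \<le> ns x"
  shows "E_convex E (Y x j)"
  using assms(2)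
proof (induction j)
  case 0
  then show ?case by (auto simp: E_convex_def)
next
  case (Suc j)
  then have IH: "E_convex E (Y x j)" and j: "j < ns x" by auto
  let ?A = "Y x j" and ?p = "yp x (Suc j)"
  have near: "infdist ?p ?A \<le> dist e w" if "e \<in> E - ?A" "w \<in> ?A" for e w
    using next_point(2)[OF assms(1) j that(1)] infdist_le[OF that(2), of e] by linarith
  have key: "e \<in> ?A" if e: "e \<in> E" "e \<noteq> ?p" and v: "v \<in> ?A" and btw: "e \<in> closed_segment ?p v" for e v
  proof (rule ccontr)
    assume eA: "e \<notin> ?A"
    obtain w where w: "w \<in> ?A" "infdist ?p ?A = dist ?p w"
      by (rule infdist_Y_attained[OF assms(1) less_imp_le[OF j]])
    have le: "dist ?p w \<le> dist e w" using near[of e w] e eA w by simp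
    have cnv: "\<not> (w \<le> e \<and> e \<le> v)" "\<not> (v \<le> e \<and> e \<le> w)"
      using IH w(1) v e(1) eA unfolding E_convex_def by metis+
    have "(?p \<le> e \<and> e \<le> v) \<or> (v \<le> e \<and> e \<le> ?p)"
      using btw unfolding closed_segment_eq_real_ivl by (cases "?p \<le> v") (simp_all del: y_pt.simps)
    with e(2) consider "?p < e" "e \<le> v" | "v \<le> e" "e < ?p" by linarith
    then show False
    proof cases
      case 1
      then have "e < w" using cnv(1) by linarith
      then show False using 1 le by (simp add: dist_real_def del: y_pt.simps)
    next
      case 2
      then have "w < e" using cnv(2) by linarith
      then show False using 2 le by (simp add: dist_real_def del: y_pt.simps)
    qed
  qed
  have ins: "Y x (Suc j) = insert ?p ?A" by simp
  show ?case
    unfolding ins E_convex_def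
  proof (intro ballI impI)
    fix u v e assume *: "u \<in> insert ?p ?A" "v \<in> insert ?p ?A" "e \<in> E" "u \<le> e \<and> e \<le> v"
    show "e \<in> insert ?p ?A"
    proof (cases "e = ?p")
      case False
      consider "u = ?p" "v = ?p" | "u = ?p" "v \<in> ?A" | "u \<in> ?A" "v = ?p" | "u \<in> ?A" "v \<in> ?A" using * by blast
      then show ?thesis
      proof cases
        case 1
        then show ?thesis using * by simp
      next
        case 2
        then have "e \<in> closed_segment ?p v" using * by (simp add: closed_segment_eq_real_ivl)
        then show ?thesis using key[OF *(3) False 2(2)] by simp
      next
        case 3
        then have "e \<in> closed_segment ?p u" using * by (simp add: closed_segment_eq_real_ivl)
        then show ?thesis using key[OF *(3) False 3(1)] by simp
      next
        case 4
        then show ?thesis using IH * unfolding E_convex_def by blast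
      qed
    qed simp
  qed
qed

lemma Y_close:
  assumes x: "x \<in> E" and \<delta>: "\<delta> \<ge> 0" and "k \<le> ns x"
    and near: "\<And>j. j < k \<Longrightarrow> \<exists>e\<in>E - Y x j. infdist e (Y x j) \<le> \<delta>"
  shows "Y x k \<subseteq> cball x (real k * \<delta>) \<and> chained \<delta> (Y x k)"
  using assms(3,4)
proof (induction k)
  case 0
  then show ?case by (auto simp: chained_def psubset_eq)
next
  case (Suc k)
  then have IH: "Y x k \<subseteq> cball x (real k * \<delta>)" "chained \<delta> (Y x k)" and k: "k < ns x" by auto
  obtain e where "e \<in> E - Y x k" "infdist e (Y x k) \<le> \<delta>" using Suc.prems(2) by blast
  then have "infdist (yp x (Suc k)) (Y x k) \<le> \<delta>" using next_point(2)[OF x k, of e] by simp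
  then obtain w where w: "w \<in> Y x k" "dist (yp x (Suc k)) w \<le> \<delta>"
    using infdist_Y_attained[of x k "yp x (Suc k)"] x k by (metis less_imp_le)
  have "dist x w \<le> real k * \<delta>" using IH(1) w(1) by auto
  then have "dist x (yp x (Suc k)) \<le> real (Suc k) * \<delta>"
    using w(2) dist_triangle[of x "yp x (Suc k)" w] by (simp add: dist_commute algebra_simps)
  moreover have "cball x (real k * \<delta>) \<subseteq> cball x (real (Suc k) * \<delta>)"
    using \<delta> by (intro subset_cball) (simp add: algebra_simps)
  ultimately show ?case using IH(1) chained_insert[OF IH(2) w] by auto
qed

lemma S_basic:
  assumes "x \<in> E"
  shows "finite (S x)" "S x \<subseteq> E" "x \<in> S x" "sp x \<in> S x" "card (S x) \<le> m" "E_convex E (S x)"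
proof -
  show "finite (S x)" "S x \<subseteq> E" "x \<in> S x" "E_convex E (S x)"
    using Y_basic[OF assms order_refl] Y_convex[OF assms order_refl] unfolding S_set_def by auto
  show "sp x \<in> S x" unfolding S_set_def s_pt_def Y_image by blast
  show "card (S x) \<le> m" using Y_basic[OF assms order_refl] ns_le[of x] m unfolding S_set_def by linarith
qed

lemma small_S_limit:
  assumes "x \<in> E" "card (S x) \<noteq> m"
  shows "sp x islimpt E"
  using Y_basic[OF assms(1) order_refl] ns_stop[of x] assms(2) m unfolding S_set_def s_pt_def by auto

lemma S_limit_point:
  assumes "z islimpt E"
  shows "z \<in> E" "S z = {z}" "sp z = z"
proof -
  show "z \<in> E" using assms closed_E closed_limpt by blast
  have "ns z = 0" unfolding n_stop_def using assms by (intro Least_equality) auto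
  then show "S z = {z}" "sp z = z" unfolding S_set_def s_pt_def by auto
qed

lemma S_near_limit_point:
  assumes "x \<in> E" "z islimpt E"
  shows "S x \<subseteq> cball x (real m * \<bar>x - z\<bar>)"
proof -
  have zE: "z \<in> E" using S_limit_point(1)[OF assms(2)] .
  have "Y x (ns x) \<subseteq> cball x (real (ns x) * \<bar>x - z\<bar>)"
  proof (rule Y_close[THEN conjunct1])
    fix j assume j: "j < ns x"
    have "z \<notin> Y x j" using Y_no_limit[OF j] assms(2) by blast
    moreover have "infdist z (Y x j) \<le> \<bar>x - z\<bar>"
      using infdist_le[of x "Y x j" z] Y_basic[OF assms(1), of j] j by (simp add: dist_real_def abs_minus_commute)
    ultimately show "\<exists>e\<in>E - Y x j. infdist e (Y x j) \<le> \<bar>x - z\<bar>" using zE by blast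
  qed (use assms in auto)
  also have "\<dots> \<subseteq> cball x (real m * \<bar>x - z\<bar>)"
    using ns_le[of x] by (intro subset_cball mult_right_mono) auto
  finally show ?thesis unfolding S_set_def .
qed

text \<open>The first greedy set of \<open>a\<close> that leaves every other point of \<open>E\<close> at distance more than
  \<open>\<delta>\<close> is the whole \<open>\<delta>\<close>-chain component of \<open>a\<close>, hence also a greedy set of \<open>b\<close>; from there on
  the two constructions coincide.\<close>
lemma S_dichotomy:
  assumes a: "a \<in> E" and b: "b \<in> E" and \<delta>: "\<delta> = \<bar>b - a\<bar>"
  shows "S a \<subseteq> cball a (real m * \<delta>) \<or> (S a = S b \<and> sp a = sp b)"
proof (cases "\<forall>j<ns a. \<exists>e\<in>E - Y a j. infdist e (Y a j) \<le> \<delta>")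
  case True
  then have "Y a (ns a) \<subseteq> cball a (real (ns a) * \<delta>)"
    using Y_close[OF a, of \<delta> "ns a"] \<delta> by auto
  also have "\<dots> \<subseteq> cball a (real m * \<delta>)"
    using ns_le[of a] \<delta> by (intro subset_cball mult_right_mono) auto
  finally show ?thesis unfolding S_set_def by blast
next
  case False
  define bad where "bad j \<longleftrightarrow> j < ns a \<and> \<not> (\<exists>e\<in>E - Y a j. infdist e (Y a j) \<le> \<delta>)" for j
  have "\<exists>j. bad j" using False unfolding bad_def by blast
  define j where "j = (LEAST j. bad j)"
  have "bad j" unfolding j_def using \<open>\<exists>j. bad j\<close> by (rule LeastI_ex)
  then have j: "j < ns a" and far: "\<And>e. e \<in> E \<Longrightarrow> infdist e (Y a j) \<le> \<delta> \<Longrightarrow> e \<in> Y a j"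
    unfolding bad_def by blast+
  have before: "\<exists>e\<in>E - Y a i. infdist e (Y a i) \<le> \<delta>" if "i < j" for i
  proof -
    have "\<not> bad i" using not_less_Least[of i bad] that unfolding j_def by blast
    then show ?thesis using that j unfolding bad_def by auto
  qed
  have Ya: "finite (Y a j)" "Y a j \<subseteq> E" "card (Y a j) = Suc j" "a \<in> Y a j"
    using Y_basic[OF a, of j] j by auto
  have chain: "chained \<delta> (Y a j)"
    using Y_close[OF a, of \<delta> j] \<delta> j before by auto
  have bY: "b \<in> Y a j"
    using far[OF b] infdist_le[OF Ya(4), of b] \<delta> by (simp add: dist_real_def)
  \<comment> \<open>A greedy set of b that stays inside \<open>Y a j\<close> has met no limit point
    and has fewer than m points, so the recursion at b is still running.\<close>
  have lt: "i < ns b" if "i \<le> j" "i \<le> ns b" "Y b i \<subseteq> Y a j" for i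
  proof -
    have "yp b i \<in> Y a j" using that(3) unfolding Y_image by blast
    then have "\<not> yp b i islimpt E" using Y_no_limit[OF j] by blast
    moreover have "i \<noteq> m - 1" using that(1) before_ns(2)[OF j] by simp
    ultimately show ?thesis using ns_stop[of b] that(2) by (metis le_neq_implies_less)
  qed
  have sub: "i \<le> ns b \<and> Y b i \<subseteq> Y a j" if "i \<le> j" for i
    using that
  proof (induction i)
    case 0
    then show ?case using bY by simp
  next
    case (Suc i)
    then have IH: "i \<le> ns b" "Y b i \<subseteq> Y a j" by auto
    have i: "i < ns b" using lt[of i] Suc IH by simp
    have Yb: "card (Y b i) = Suc i" "b \<in> Y b i" using Y_basic[OF b IH(1)] by auto
    then have "Y b i \<subset> Y a j" using IH(2) Ya(3) Suc.prems by auto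
    moreover have "Y b i \<noteq> {}" using Yb by blast
    ultimately obtain y w where yw: "y \<in> Y a j - Y b i" "w \<in> Y b i" "dist y w \<le> \<delta>"
      using chain unfolding chained_def by metis
    \<comment> \<open>The chain supplies a candidate within \<delta>, so the actual choice is within
      \<delta> as well, and the isolation of \<open>Y a j\<close> keeps it inside.\<close>
    have "infdist (yp b (Suc i)) (Y b i) \<le> infdist y (Y b i)"
      using next_point(2)[OF b i, of y] yw(1) Ya(2) by blast
    also have "\<dots> \<le> \<delta>" using infdist_le[OF yw(2), of y] yw(3) by linarith
    finally have "infdist (yp b (Suc i)) (Y b i) \<le> \<delta>" .
    then obtain v where v: "v \<in> Y b i" "dist (yp b (Suc i)) v \<le> \<delta>"
      using infdist_Y_attained[OF b IH(1), of "yp b (Suc i)"] by metis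
    have "infdist (yp b (Suc i)) (Y a j) \<le> \<delta>"
      using infdist_le[of v "Y a j" "yp b (Suc i)"] v IH(2) by (meson order_trans subsetD)
    then have "yp b (Suc i) \<in> Y a j" using far next_point(1)[OF b i] by blast
    then show ?case using IH i by auto
  qed
  have jb: "j < ns b" using lt[of j] sub[of j] by simp
  have eqj: "Y b j = Y a j"
    using sub[of j] Y_basic[OF b, of j] Ya by (metis card_subset_eq order_refl)
  have eq: "Y b i = Y a i" if "j \<le> i" for i
    using that by (induction i rule: dec_induct) (auto simp: eqj)
  \<comment> \<open>The inequality is strict: the sets agree from index j on, the points only from
    the next index.\<close>
  have eqy: "yp b i = yp a i" if "j < i" for i
    using that eq[of "i - 1"] by (cases i) auto
  have "ns a = ns b"
  proof (rule antisym)
    show "ns a \<le> ns b"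
    proof (rule ccontr)
      assume "\<not> ns a \<le> ns b"
      then show False using before_ns[of "ns b" a] ns_stop[of b] eqy[OF jb] by auto
    qed
    show "ns b \<le> ns a"
    proof (rule ccontr)
      assume "\<not> ns b \<le> ns a"
      then show False using before_ns[of "ns a" b] ns_stop[of a] eqy[OF j] by auto
    qed
  qed
  then show ?thesis using eq[of "ns a"] eqy[OF j] j unfolding S_set_def s_pt_def by auto
qed

end

section \<open>The polynomials of the construction\<close>

lemma lagrange_poly_spec:
  assumes "finite S" "S \<noteq> {}"
  shows "degree (lagrange_poly S f) \<le> card S - 1" "\<And>y. y \<in> S \<Longrightarrow> poly (lagrange_poly S f) y = f y"
proof -
  obtain s where s: "s \<in> S" using assms by blast
  have "\<exists>!P. degree P \<le> card S - 1 \<and> (\<forall>y\<in>S. poly P y = f y)"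
  proof (rule ex_ex1I)
    show "\<exists>P. degree P \<le> card S - 1 \<and> (\<forall>y\<in>S. poly P y = f y)" by (rule lagrange_exists[OF assms(1)])
    show "P = Q" if "degree P \<le> card S - 1 \<and> (\<forall>y\<in>S. poly P y = f y)"
      "degree Q \<le> card S - 1 \<and> (\<forall>y\<in>S. poly Q y = f y)" for P Q
      using that by (intro hermite_unique[OF assms(1) s order_refl]) auto
  qed
  from theI'[OF this] show "degree (lagrange_poly S f) \<le> card S - 1"
    "\<And>y. y \<in> S \<Longrightarrow> poly (lagrange_poly S f) y = f y"
    unfolding lagrange_poly_def by auto
qed

lemma lagrange_poly_unique:
  assumes "finite S" "S \<noteq> {}" "degree P \<le> card S - 1" "\<And>y. y \<in> S \<Longrightarrow> poly P y = f y"
  shows "lagrange_poly S f = P"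
proof -
  obtain s where s: "s \<in> S" using assms by blast
  show ?thesis
    by (rule hermite_unique[OF assms(1) s order_refl])
       (use assms lagrange_poly_spec[OF assms(1,2), where f = f] in auto)
qed

lemma lagrange_poly_lincomb:
  assumes "finite S" "S \<noteq> {}"
  shows "lagrange_poly S (\<lambda>x. \<alpha> * f x + \<beta> * g x) = smult \<alpha> (lagrange_poly S f) + smult \<beta> (lagrange_poly S g)"
  using lagrange_poly_spec[OF assms, where f = f] lagrange_poly_spec[OF assms, where f = g]
  by (intro lagrange_poly_unique[OF assms] degree_add_le order_trans[OF degree_smult_le]) auto

lemma eventually_shrinking_sets:
  assumes "r > 0"
  shows "eventually (\<lambda>S. S \<subseteq> E \<and> finite S \<and> card S = m \<and> diameter (insert z S) < r) (shrinking_sets m E z)"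
proof -
  have "eventually (\<lambda>x. x < r) (nhds (0::real))"
    using assms by (intro eventually_nhds_in_open[of "{..<r}" 0, simplified]) auto
  then have "eventually (\<lambda>S. diameter (insert z S) < r) (filtercomap (\<lambda>S. diameter (insert z S)) (nhds 0))"
    by (rule eventually_filtercomapI)
  then show ?thesis
    unfolding shrinking_sets_def eventually_inf_principal by eventually_elim auto
qed

text \<open>\<open>Lim\<close> is determined only along a proper filter; every ball around a limit
  point holds m points of \<open>E\<close>.\<close>

lemma shrinking_sets_nontrivial:
  assumes "z islimpt E"
  shows "shrinking_sets m E z \<noteq> bot"
proof
  assume "shrinking_sets m E z = bot"
  then have "eventually (\<lambda>S. False) (shrinking_sets m E z)" by simp
  then have "eventually (\<lambda>S. \<not> (S \<subseteq> E \<and> finite S \<and> card S = m)) (filtercomap (\<lambda>S. diameter (insert z S)) (nhds 0))"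
    unfolding shrinking_sets_def eventually_inf_principal by simp
  then obtain Q where Q: "eventually Q (nhds (0::real))"
    "\<And>S. Q (diameter (insert z S)) \<Longrightarrow> \<not> (S \<subseteq> E \<and> finite S \<and> card S = m)"
    unfolding eventually_filtercomap by blast
  obtain r where r: "r > 0" "\<And>x. \<bar>x\<bar> < r \<Longrightarrow> Q x"
    using Q(1) unfolding eventually_nhds_metric by (auto simp: dist_real_def)
  have "infinite (E \<inter> ball z (r / 4))"
    using assms r(1) unfolding islimpt_eq_infinite_ball by simp
  then obtain S where S: "finite S" "card S = m" "S \<subseteq> E \<inter> ball z (r / 4)"
    using infinite_arbitrarily_large by blast
  have "diameter (insert z S) \<le> r / 2"
  proof (rule diameter_le)
    fix x y assume "x \<in> insert z S" "y \<in> insert z S"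
    then have "x \<in> ball z (r / 4)" "y \<in> ball z (r / 4)" using S(3) r(1) by auto
    then show "norm (x - y) \<le> r / 2" by (auto simp: dist_real_def abs_if split: if_splits)
  qed (use r in simp)
  moreover have "diameter (insert z S) \<ge> 0" using S(1) by (intro diameter_ge_0 finite_imp_bounded) simp
  ultimately have "\<bar>diameter (insert z S)\<bar> < r" using r(1) by linarith
  then show False using Q(2)[OF r(2)] S by blast
qed

text \<open>Selected once from an existence statement in which it precedes the polynomials and the
  interval; every later constant inherits the dependence on m alone.\<close>

definition hermite_const :: "nat \<Rightarrow> real" where
  "hermite_const m = (SOME B. B \<ge> 0 \<and> (\<forall>(P::real poly) Q a b. degree P \<le> m - 1 \<and> degree Q \<le> m - 1 \<and> a < b \<longrightarrow>
    (\<exists>H. glues m B P Q a b H)))"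

lemma hermite_const:
  assumes "m \<ge> 1"
  shows "hermite_const m \<ge> 0"
    and "\<And>P Q a b. degree P \<le> m - 1 \<Longrightarrow> degree Q \<le> m - 1 \<Longrightarrow> a < b \<Longrightarrow>
    \<exists>H. glues m (hermite_const m) P Q a b H"
  using someI_ex[OF two_point_hermite[OF assms]] unfolding hermite_const_def by simp_all

text \<open>Origin of the factors: 2 for comparing \<open>P a\<close> with \<open>P b\<close>
  through \<open>G\<close>, m for the number of jet orders, and (2 m + 1)^(m - 1) for the ratio of
  hull length to gap length.\<close>

definition glue_const :: "nat \<Rightarrow> real" where
  "glue_const m = hermite_const m * (2 * real m * real (2 * m + 1) ^ (m - 1))"

lemma glue_const_nonneg: "m \<ge> 1 \<Longrightarrow> glue_const m \<ge> 0"
  using hermite_const(1) by (simp add: glue_const_def)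

lemma abs_integral_mono:
  assumes "in_Lp p g" "p > 1" "c' \<le> c" "d \<le> d'"
  shows "abs_integral g c d \<le> abs_integral g c' d'"
proof -
  have int: "integrable lebesgue (\<lambda>t. indicat_real {a..b} t *\<^sub>R \<bar>g t\<bar>)" for a b
    using set_integrable_abs[OF in_Lp_set_integrable[OF assms(1,2)]] by (simp add: set_integrable_def)
  then show ?thesis
    unfolding set_lebesgue_integral_def
  proof (rule integral_mono)
    show "indicat_real {c..d} t *\<^sub>R \<bar>g t\<bar> \<le> indicat_real {c'..d'} t *\<^sub>R \<bar>g t\<bar>" for t
      using assms(3,4) by (auto simp: indicator_def)
  qed (rule int)+
qed

lemma abs_integral_nonneg: "abs_integral g c d \<ge> 0"
  unfolding set_lebesgue_integral_def by (intro integral_nonneg_AE AE_I2) simp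

lemma abs_integral_small:
  assumes "in_Lp p g" "p > 1" "\<epsilon> > 0"
  obtains r where "r > 0" "abs_integral g (z - r) (z + r) < \<epsilon>"
proof -
  have si: "set_integrable lebesgue {c..d} (\<lambda>t. \<bar>g t\<bar>)" for c d
    using in_Lp_set_integrable[OF assms(1,2)] by (rule set_integrable_abs)
  have eq: "abs_integral g c d = integral {c..d} (\<lambda>t. \<bar>g t\<bar>)" and int: "(\<lambda>t. \<bar>g t\<bar>) integrable_on {c..d}" for c d
    using set_lebesgue_integral_eq_integral[OF si, of c d] by auto
  define I where "I x = integral {z - 1..x} (\<lambda>t. \<bar>g t\<bar>)" for x
  have "continuous_on {z - 1..z + 1} I"
    unfolding I_def by (rule indefinite_integral_continuous_1[OF int])
  then have "\<forall>e>0. \<exists>d>0. \<forall>x\<in>{z - 1..z + 1}. dist x z < d \<longrightarrow> dist (I x) (I z) < e"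
    unfolding continuous_on_iff by (auto dest: bspec[of _ _ z])
  then obtain d where d: "d > 0" "\<And>x. x \<in> {z - 1..z + 1} \<Longrightarrow> dist x z < d \<Longrightarrow> dist (I x) (I z) < \<epsilon> / 2"
    using assms(3) by (meson half_gt_zero)
  define r where "r = min (d / 2) 1"
  have r: "r > 0" "r < d" "r \<le> 1" using d(1) by (auto simp: r_def)
  have "I (z - r) + integral {z - r..z + r} (\<lambda>t. \<bar>g t\<bar>) = I (z + r)"
    unfolding I_def using r by (intro Henstock_Kurzweil_Integration.integral_combine int) auto
  moreover have "dist (I (z - r)) (I z) < \<epsilon> / 2" "dist (I (z + r)) (I z) < \<epsilon> / 2"
    using r by (intro d(2); simp add: dist_real_def)+
  ultimately have "integral {z - r..z + r} (\<lambda>t. \<bar>g t\<bar>) < \<epsilon>" unfolding dist_real_def by linarith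
  then show thesis using that[of r] r eq by simp
qed

section \<open>Comparison with a fixed extension of f\<close>

text \<open>\<open>G\<close> is an arbitrary extension. The operator does not mention it, so the
  norm bound obtained here holds for all competitors and passes to the infimum that defines the
  trace norm.\<close>

locale whitney_ext = whitney +
  fixes p :: real and f G :: "real \<Rightarrow> real"
  assumes p: "p > 1" and G: "G \<in> sobolev m p" and Gf: "\<And>x. x \<in> E \<Longrightarrow> G x = f x"
begin

definition D :: "nat \<Rightarrow> real \<Rightarrow> real" where "D i = (deriv ^^ i) G"
definition g :: "real \<Rightarrow> real" where "g = (deriv ^^ m) G"
abbreviation "P \<equiv> P_poly m E nc f"
abbreviation "W \<equiv> abs_integral g"

lemma D_0: "x \<in> E \<Longrightarrow> D 0 x = f x" using Gf by (simp add: D_def)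

lemma D_deriv: "Suc i < m \<Longrightarrow> (D i has_real_derivative D (Suc i) x) (at x)"
  using G unfolding sobolev_def D_def by (auto simp: DERIV_deriv_iff_field_differentiable)

lemma D_ac: "abs_continuous_on a b (D (m - 1))"
  using G unfolding sobolev_def D_def by auto

lemma g_Lp: "in_Lp p g" using G unfolding sobolev_def g_def by auto

lemma g_deriv: "g = deriv (D (m - 1))"
proof -
  have "(deriv ^^ m) G = deriv ((deriv ^^ (m - 1)) G)" using m by (cases m) auto
  then show ?thesis by (simp only: g_def D_def)
qed

lemma D_increment: "x \<le> y \<Longrightarrow> \<bar>D (m - 1) y - D (m - 1) x\<bar> \<le> W x y"
  using abs_continuous_increment_le[of "D (m - 1)" x y p] D_ac g_Lp p unfolding g_deriv by blast

lemmas W_mono = abs_integral_mono[OF g_Lp p]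

text \<open>The derivative of order m - 1 of \<open>Q\<close> is constant, so at the top order the
  difference has the same oscillation as \<open>D (m - 1)\<close>, which the integral of |g|
  controls; the zeros of all orders come from the Hermite conditions.\<close>

lemma hermite_close:
  fixes Q :: "real poly"
  assumes A: "finite A" "s \<in> A" "card A \<le> m" "A \<subseteq> {c..d}" and Q: "degree Q \<le> m - 1"
    and "\<And>y. y \<in> A \<Longrightarrow> poly Q y = D 0 y" "\<And>i. i \<in> {1..m - card A} \<Longrightarrow> poly_deriv i Q s = D i s"
    and "t \<in> {c..d}" "i < m"
  shows "\<bar>D i t - poly_deriv i Q t\<bar> \<le> W c d * (d - c) ^ (m - 1 - i)"
proof (rule derivative_family_bound[where R = "\<lambda>i t. D i t - poly_deriv i Q t"])
  show der: "((\<lambda>t. D i t - poly_deriv i Q t) has_real_derivative D (Suc i) x - poly_deriv (Suc i) Q x) (at x)"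
    if "Suc i < m" for i x
    by (intro DERIV_diff D_deriv that poly_deriv_DERIV)
  show "\<exists>z\<in>{c..d}. D i z - poly_deriv i Q z = 0" if "i < m" for i
    by (rule hermite_derivative_zeros[where R = "\<lambda>i t. D i t - poly_deriv i Q t" and S = A and s = s and m = m])
       (use der A assms(6,7) that in auto)
  have "(pderiv ^^ m) Q = 0" using degree_higher_pderiv[of m Q] Q m
    by (intro poly_eqI) (auto simp: coeff_higher_pderiv coeff_eq_0)
  then have "pderiv ((pderiv ^^ (m - 1)) Q) = 0" using m by (cases m) auto
  then obtain k where "(pderiv ^^ (m - 1)) Q = [:k:]" by (metis pderiv_eq_0_iff degree_eq_zeroE)
  then show "\<bar>(D (m - 1) y - poly_deriv (m - 1) Q y) - (D (m - 1) x - poly_deriv (m - 1) Q x)\<bar> \<le> W c d"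
    if "c \<le> x" "x \<le> y" "y \<le> d" for x y
    using D_increment[OF that(2)] W_mono[OF that(1,3)] by simp
qed (use assms in auto)

text \<open>This settles the existence of the limits that the construction demands: Lagrange
  polynomials on sets near z are close to the jet of \<open>G\<close> at z, because the integral of
  |g| over a shrinking interval tends to 0.\<close>

lemma lagrange_limit:
  assumes z: "z islimpt E" and i: "i < m"
  shows "((\<lambda>S. poly_deriv i (lagrange_poly S f) z) \<longlongrightarrow> D i z) (shrinking_sets m E z)"
  unfolding tendsto_iff
proof (intro allI impI)
  fix \<epsilon> :: real assume "\<epsilon> > 0"
  obtain r0 where r0: "r0 > 0" "W (z - r0) (z + r0) < \<epsilon>"
    using abs_integral_small[OF g_Lp p \<open>\<epsilon> > 0\<close>] by metis
  define r where "r = min r0 (1 / 2)"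
  have r: "r > 0" "r \<le> 1 / 2" "r \<le> r0" using r0 by (auto simp: r_def)
  from eventually_shrinking_sets[OF r(1)]
  show "eventually (\<lambda>S. dist (poly_deriv i (lagrange_poly S f) z) (D i z) < \<epsilon>) (shrinking_sets m E z)"
  proof eventually_elim
    fix A assume A: "A \<subseteq> E \<and> finite A \<and> card A = m \<and> diameter (insert z A) < r"
    have ne: "A \<noteq> {}" using A m by auto
    then obtain s where s: "s \<in> A" by blast
    have "A \<subseteq> {z - r..z + r}"
    proof
      fix y assume "y \<in> A"
      then have "dist y z \<le> diameter (insert z A)"
        using A by (intro diameter_bounded_bound finite_imp_bounded) auto
      then show "y \<in> {z - r..z + r}" using A by (auto simp: dist_real_def)
    qed
    then have "\<bar>D i z - poly_deriv i (lagrange_poly A f) z\<bar> \<le> W (z - r) (z + r) * ((z + r) - (z - r)) ^ (m - 1 - i)"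
      using A s lagrange_poly_spec[OF _ ne, where f = f] D_0 r i
      by (intro hermite_close[of A s]) auto
    also have "\<dots> \<le> W (z - r) (z + r) * 1"
      using r by (intro mult_left_mono power_le_one abs_integral_nonneg) auto
    also have "\<dots> \<le> W (z - r0) (z + r0)" using W_mono[of "z - r0" "z - r" "z + r" "z + r0"] r by simp
    finally show "dist (poly_deriv i (lagrange_poly A f) z) (D i z) < \<epsilon>"
      using r0(2) by (simp add: dist_real_def abs_minus_commute)
  qed
qed

lemma limit_deriv_eq:
  assumes "z islimpt E" "i < m"
  shows "limit_deriv m E f i z = D i z"
  unfolding limit_deriv_def
  by (rule tendsto_Lim[OF shrinking_sets_nontrivial[OF assms(1)] lagrange_limit[OF assms]])

lemma P_unique:
  assumes x: "x \<in> E" and "degree Q \<le> m - 1" "\<And>y. y \<in> S x \<Longrightarrow> poly Q y = f y"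
    and "\<And>i. i \<in> {1..m - card (S x)} \<Longrightarrow> poly_deriv i Q (sp x) = D i (sp x)"
  shows "P x = Q"
proof (cases "card (S x) = m")
  case True
  have "S x \<noteq> {}" using S_basic(3)[OF x] by blast
  then have "lagrange_poly (S x) f = Q"
    using S_basic[OF x] assms True by (intro lagrange_poly_unique) auto
  then show ?thesis using True by (simp add: P_poly_def Let_def)
next
  case False
  have lim: "limit_deriv m E f i (sp x) = D i (sp x)" if "i \<in> {1..m - card (S x)}" for i
  proof (rule limit_deriv_eq[OF small_S_limit[OF x False]])
    have "card (S x) > 0" using S_basic[OF x] by (metis card_gt_0_iff empty_iff)
    then show "i < m" using that m by auto
  qed
  have "(THE P. degree P \<le> m - 1 \<and> (\<forall>y\<in>S x. poly P y = f y) \<and>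
      (\<forall>i\<in>{1..m - card (S x)}. poly_deriv i P (sp x) = limit_deriv m E f i (sp x))) = Q"
  proof (rule the_equality)
    show "degree Q \<le> m - 1 \<and> (\<forall>y\<in>S x. poly Q y = f y) \<and>
      (\<forall>i\<in>{1..m - card (S x)}. poly_deriv i Q (sp x) = limit_deriv m E f i (sp x))"
      using assms lim by auto
    show "R = Q" if "degree R \<le> m - 1 \<and> (\<forall>y\<in>S x. poly R y = f y) \<and>
      (\<forall>i\<in>{1..m - card (S x)}. poly_deriv i R (sp x) = limit_deriv m E f i (sp x))" for R
      by (rule hermite_unique[OF S_basic(1)[OF x] S_basic(4)[OF x] S_basic(5)[OF x]])
         (use that assms lim in auto)
  qed
  then show ?thesis using False by (simp add: P_poly_def Let_def)
qed

lemma P_spec: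
  assumes x: "x \<in> E"
  shows "degree (P x) \<le> m - 1" "\<And>y. y \<in> S x \<Longrightarrow> poly (P x) y = f y"
    "\<And>i. i \<in> {1..m - card (S x)} \<Longrightarrow> poly_deriv i (P x) (sp x) = D i (sp x)"
proof -
  obtain Q where Q: "degree Q \<le> m - 1" "\<forall>y\<in>S x. poly Q y = f y"
    "\<forall>i\<in>{1..m - card (S x)}. poly_deriv i Q (sp x) = D i (sp x)"
    using hermite_exists[OF S_basic(1)[OF x] S_basic(4)[OF x] S_basic(5)[OF x], of f "\<lambda>i. D i (sp x)"] by blast
  have "P x = Q" using Q by (intro P_unique[OF x]) auto
  with Q show "degree (P x) \<le> m - 1" "\<And>y. y \<in> S x \<Longrightarrow> poly (P x) y = f y"
    "\<And>i. i \<in> {1..m - card (S x)} \<Longrightarrow> poly_deriv i (P x) (sp x) = D i (sp x)" by auto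
qed

lemma P_self: "x \<in> E \<Longrightarrow> poly (P x) x = f x"
  using P_spec(2) S_basic(3) by blast

lemma P_close:
  assumes x: "x \<in> E" and "S x \<subseteq> {c..d}" "t \<in> {c..d}" "i < m"
  shows "\<bar>D i t - poly_deriv i (P x) t\<bar> \<le> W c d * (d - c) ^ (m - 1 - i)"
  by (rule hermite_close[OF S_basic(1)[OF x] S_basic(4)[OF x] S_basic(5)[OF x]])
     (use assms P_spec[OF x] S_basic(2)[OF x] D_0 in auto)

lemma P_limit_point:
  assumes "z islimpt E" "i < m"
  shows "poly_deriv i (P z) z = D i z"
proof (cases i)
  case 0
  then show ?thesis using S_limit_point(1)[OF assms(1)] P_self D_0 by simp
next
  case (Suc k)
  then show ?thesis
    using P_spec(3)[OF S_limit_point(1)[OF assms(1)], of i] S_limit_point[OF assms(1)] assms(2) by simp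
qed

section \<open>Gaps and gluing polynomials\<close>

definition gap :: "real \<Rightarrow> real \<Rightarrow> bool" where
  "gap a b \<longleftrightarrow> a \<in> E \<and> b \<in> E \<and> a < b \<and> {a<..<b} \<inter> E = {}"

abbreviation "H a b \<equiv> H_poly m P {a<..<b}"
definition "lo a b = Min (S a \<union> S b)"
definition "hi a b = Max (S a \<union> S b)"

lemma hull_bounds:
  assumes "gap a b"
  shows "S a \<subseteq> {lo a b..hi a b}" "S b \<subseteq> {lo a b..hi a b}" "lo a b \<le> a" "b \<le> hi a b"
    "lo a b \<in> S a \<union> S b" "hi a b \<in> S a \<union> S b"
proof -
  have ab: "a \<in> E" "b \<in> E" using assms by (auto simp: gap_def)
  have fin: "finite (S a \<union> S b)" and ne: "S a \<union> S b \<noteq> {}" and mem: "a \<in> S a \<union> S b" "b \<in> S a \<union> S b"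
    using S_basic(1,3)[OF ab(1)] S_basic(1,3)[OF ab(2)] by auto
  show "S a \<subseteq> {lo a b..hi a b}" "S b \<subseteq> {lo a b..hi a b}" "lo a b \<le> a" "b \<le> hi a b"
    unfolding lo_def hi_def using fin mem by auto
  show "lo a b \<in> S a \<union> S b" "hi a b \<in> S a \<union> S b"
    unfolding lo_def hi_def using Min_in[OF fin ne] Max_in[OF fin ne] by blast+
qed

text \<open>2 m + 1 = m + 1 + m: unless the greedy data at both ends coincide, the hull reaches at
  most m gap lengths beyond either end.\<close>

lemma gap_dichotomy:
  assumes "gap a b"
  shows "P a = P b \<or> hi a b - lo a b \<le> real (2 * m + 1) * (b - a)"
proof -
  have ab: "a \<in> E" "b \<in> E" "a < b" using assms by (auto simp: gap_def)
  have eq: ?thesis if "S a = S b \<and> sp a = sp b" using that by (simp add: P_poly_def Let_def)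
  consider "S a = S b \<and> sp a = sp b" | "S a \<subseteq> cball a (real m * \<bar>b - a\<bar>)" "S b \<subseteq> cball b (real m * \<bar>b - a\<bar>)"
    using S_dichotomy[OF ab(1,2) refl] S_dichotomy[OF ab(2,1) refl] by (auto simp: abs_minus_commute)
  then show ?thesis
  proof cases
    case 1
    then show ?thesis by (rule eq)
  next
    case 2
    then have "S a \<union> S b \<subseteq> {a - real m * (b - a)..b + real m * (b - a)}"
    proof -
      have "cball a (real m * \<bar>b - a\<bar>) \<subseteq> {a - real m * (b - a)..b + real m * (b - a)}"
        "cball b (real m * \<bar>b - a\<bar>) \<subseteq> {a - real m * (b - a)..b + real m * (b - a)}"
        using ab(3) by (auto simp: dist_real_def abs_le_iff)
      with 2 show ?thesis by blast
    qed
    then have "a - real m * (b - a) \<le> lo a b" "hi a b \<le> b + real m * (b - a)"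
      using hull_bounds(5,6)[OF assms] by auto
    then show ?thesis by (simp add: algebra_simps)
  qed
qed

lemma H_spec:
  assumes "gap a b"
  shows "\<And>i. i < m \<Longrightarrow> poly_deriv i (H a b) a = poly_deriv i (P a) a"
    "\<And>i. i < m \<Longrightarrow> poly_deriv i (H a b) b = poly_deriv i (P b) b"
    "\<And>i x. i \<le> m \<Longrightarrow> x \<in> {a..b} \<Longrightarrow> \<bar>poly_deriv i (H a b) x - poly_deriv i (P a) x\<bar>
       \<le> hermite_const m * (\<Sum>k<m. \<bar>poly_deriv k (P b) b - poly_deriv k (P a) b\<bar> * (b - a) ^ k) / (b - a) ^ i"
    "degree (H a b) \<le> 2 * m - 1"
proof -
  have ab: "a \<in> E" "b \<in> E" "a < b" using assms by (auto simp: gap_def)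
  obtain Q where Q: "degree Q \<le> 2 * m - 1"
      "\<forall>i<m. poly_deriv i Q a = poly_deriv i (P a) a \<and> poly_deriv i Q b = poly_deriv i (P b) b"
      "\<forall>i\<le>m. \<forall>x\<in>{a..b}. \<bar>poly_deriv i Q x - poly_deriv i (P a) x\<bar>
         \<le> hermite_const m * (\<Sum>k<m. \<bar>poly_deriv k (P b) b - poly_deriv k (P a) b\<bar> * (b - a) ^ k) / (b - a) ^ i"
    using hermite_const(2)[OF m P_spec(1)[OF ab(1)] P_spec(1)[OF ab(2)] ab(3)] by blast
  have "H a b = (THE H. degree H \<le> 2 * m - 1 \<and>
           (\<forall>i<m. poly_deriv i H a = poly_deriv i (P a) a \<and> poly_deriv i H b = poly_deriv i (P b) b))"
    using ab(3) by (simp add: H_poly_def)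
  also have "\<dots> = Q"
  proof (rule the_equality)
    show "R = Q" if "degree R \<le> 2 * m - 1 \<and>
           (\<forall>i<m. poly_deriv i R a = poly_deriv i (P a) a \<and> poly_deriv i R b = poly_deriv i (P b) b)" for R
      by (rule two_point_hermite_unique[OF m _ Q(1) ab(3)]) (use that Q(2) in auto)
  qed (use Q in auto)
  finally have "H a b = Q" .
  with Q show "\<And>i. i < m \<Longrightarrow> poly_deriv i (H a b) a = poly_deriv i (P a) a"
    "\<And>i. i < m \<Longrightarrow> poly_deriv i (H a b) b = poly_deriv i (P b) b"
    "\<And>i x. i \<le> m \<Longrightarrow> x \<in> {a..b} \<Longrightarrow> \<bar>poly_deriv i (H a b) x - poly_deriv i (P a) x\<bar>
       \<le> hermite_const m * (\<Sum>k<m. \<bar>poly_deriv k (P b) b - poly_deriv k (P a) b\<bar> * (b - a) ^ k) / (b - a) ^ i"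
    "degree (H a b) \<le> 2 * m - 1"
    by auto
qed

text \<open>\<open>P a\<close> and \<open>P b\<close> both approximate the jet of \<open>G\<close>
  at b, so their jets there differ by the integral of |g| times powers of the hull length, which are
  traded for powers of the gap length. Equal polynomials are treated separately, since the hull may
  then be long.\<close>

lemma H_close:
  assumes gp: "gap a b" and i: "i \<le> m" and x: "x \<in> {a..b}"
  shows "\<bar>poly_deriv i (H a b) x - poly_deriv i (P a) x\<bar>
    \<le> glue_const m * W (lo a b) (hi a b) * (b - a) ^ (m - 1) / (b - a) ^ i"
    and "P a = P b \<Longrightarrow> poly_deriv i (H a b) x = poly_deriv i (P a) x"
proof -
  have ab: "a \<in> E" "b \<in> E" "a < b" using gp by (auto simp: gap_def)
  show eq: "poly_deriv i (H a b) x = poly_deriv i (P a) x" if "P a = P b"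
    using H_spec(3)[OF gp i x] that by simp
  let ?W = "W (lo a b) (hi a b)"
  have Wnn: "?W \<ge> 0" by (rule abs_integral_nonneg)
  show "\<bar>poly_deriv i (H a b) x - poly_deriv i (P a) x\<bar>
    \<le> glue_const m * ?W * (b - a) ^ (m - 1) / (b - a) ^ i"
  proof (cases "P a = P b")
    case True
    then show ?thesis using eq Wnn glue_const_nonneg[OF m] ab(3) by simp
  next
    case False
    then have len: "hi a b - lo a b \<le> real (2 * m + 1) * (b - a)" using gap_dichotomy[OF gp] by blast
    have tm: "\<bar>poly_deriv k (P b) b - poly_deriv k (P a) b\<bar> * (b - a) ^ k
        \<le> 2 * ?W * real (2 * m + 1) ^ (m - 1) * (b - a) ^ (m - 1)" if k: "k < m" for k
    proof -
      have b: "b \<in> {lo a b..hi a b}" using hull_bounds[OF gp] ab(3) by auto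
      have "\<bar>poly_deriv k (P b) b - poly_deriv k (P a) b\<bar> \<le> 2 * (?W * (hi a b - lo a b) ^ (m - 1 - k))"
        using P_close[OF ab(1) hull_bounds(1)[OF gp] b k] P_close[OF ab(2) hull_bounds(2)[OF gp] b k] by linarith
      also have "\<dots> \<le> 2 * (?W * (real (2 * m + 1) * (b - a)) ^ (m - 1 - k))"
        using len b Wnn by (intro mult_left_mono power_mono) auto
      also have "\<dots> = 2 * ?W * real (2 * m + 1) ^ (m - 1 - k) * (b - a) ^ (m - 1 - k)"
        by (simp add: power_mult_distrib)
      also have "\<dots> \<le> 2 * ?W * real (2 * m + 1) ^ (m - 1) * (b - a) ^ (m - 1 - k)"
        using Wnn ab(3) by (intro mult_right_mono mult_left_mono power_increasing) auto
      finally have "\<bar>poly_deriv k (P b) b - poly_deriv k (P a) b\<bar> * (b - a) ^ k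
          \<le> 2 * ?W * real (2 * m + 1) ^ (m - 1) * (b - a) ^ (m - 1 - k) * (b - a) ^ k"
        using ab(3) by (intro mult_right_mono) auto
      also have "\<dots> = 2 * ?W * real (2 * m + 1) ^ (m - 1) * ((b - a) ^ (m - 1 - k) * (b - a) ^ k)"
        by (simp only: mult.assoc)
      also have "(b - a) ^ (m - 1 - k) * (b - a) ^ k = (b - a) ^ (m - 1)"
        using k by (simp flip: power_add)
      finally show ?thesis .
    qed
    have "(\<Sum>k<m. \<bar>poly_deriv k (P b) b - poly_deriv k (P a) b\<bar> * (b - a) ^ k)
        \<le> (\<Sum>k<m. 2 * ?W * real (2 * m + 1) ^ (m - 1) * (b - a) ^ (m - 1))"
      by (intro sum_mono tm) simp
    also have "\<dots> = real m * (2 * ?W * real (2 * m + 1) ^ (m - 1) * (b - a) ^ (m - 1))" by simp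
    finally have "hermite_const m * (\<Sum>k<m. \<bar>poly_deriv k (P b) b - poly_deriv k (P a) b\<bar> * (b - a) ^ k) / (b - a) ^ i
        \<le> hermite_const m * (real m * (2 * ?W * real (2 * m + 1) ^ (m - 1) * (b - a) ^ (m - 1))) / (b - a) ^ i"
      using ab(3) hermite_const(1)[OF m] by (intro divide_right_mono mult_left_mono) auto
    also have "\<dots> = glue_const m * ?W * (b - a) ^ (m - 1) / (b - a) ^ i"
      by (simp add: glue_const_def algebra_simps)
    finally show ?thesis using H_spec(3)[OF gp i x] by linarith
  qed
qed

end

section \<open>Regularity of the glued function\<close>

lemma H_poly_right: "H_poly m P {a<..} = P a"
proof -
  have "\<not> bdd_above {a<..}"
    unfolding bdd_above_def by (metis gt_ex greaterThan_iff less_le_not_le max.strict_boundedE)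
  then show ?thesis by (simp add: H_poly_def)
qed

lemma H_poly_left: "H_poly m P {..<b} = P b"
proof -
  have "\<not> bdd_below {..<b}"
    unfolding bdd_below_def by (metis lt_ex lessThan_iff less_le_not_le min.strict_boundedE)
  then show ?thesis by (simp add: H_poly_def)
qed

lemma mvt_open_segment:
  fixes \<phi> :: "real \<Rightarrow> real"
  assumes "u \<noteq> y" "\<And>t. isCont \<phi> t" "\<And>t. t \<in> open_segment u y \<Longrightarrow> (\<phi> has_real_derivative \<psi> t) (at t)"
  shows "\<exists>\<xi>\<in>open_segment u y. \<bar>\<phi> y - \<phi> u\<bar> = \<bar>y - u\<bar> * \<bar>\<psi> \<xi>\<bar>"
proof -
  have *: "\<exists>\<xi>. a < \<xi> \<and> \<xi> < b \<and> \<bar>\<phi> b - \<phi> a\<bar> = \<bar>b - a\<bar> * \<bar>\<psi> \<xi>\<bar>"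
    if "a < b" "\<And>t. a < t \<Longrightarrow> t < b \<Longrightarrow> (\<phi> has_real_derivative \<psi> t) (at t)" for a b
  proof -
    have "\<exists>l z. a < z \<and> z < b \<and> DERIV \<phi> z :> l \<and> \<phi> b - \<phi> a = (b - a) * l"
    proof (rule MVT[OF that(1)])
      show "continuous_on {a..b} \<phi>" using assms(2) by (simp add: continuous_at_imp_continuous_on)
      show "\<phi> differentiable at t" if "a < t" "t < b" for t
        using \<open>\<And>t. a < t \<Longrightarrow> t < b \<Longrightarrow> (\<phi> has_real_derivative \<psi> t) (at t)\<close>[OF that] real_differentiable_def by blast
    qed
    then obtain l z where z: "a < z" "z < b" "DERIV \<phi> z :> l" "\<phi> b - \<phi> a = (b - a) * l" by blast
    then have "l = \<psi> z" using \<open>\<And>t. a < t \<Longrightarrow> t < b \<Longrightarrow> (\<phi> has_real_derivative \<psi> t) (at t)\<close>[of z] DERIV_unique by blast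
    then show ?thesis using z by (intro exI[of _ z]) (simp add: abs_mult)
  qed
  show ?thesis
  proof (cases "u < y")
    case True
    then show ?thesis using *[OF True] assms(3) by (auto simp: open_segment_eq_real_ivl)
  next
    case False
    then have "y < u" using assms(1) by simp
    then show ?thesis using *[of y u] assms(3) by (auto simp: open_segment_eq_real_ivl abs_minus_commute)
  qed
qed

section \<open>The jet of the glued function\<close>

context whitney_ext
begin

definition Qf :: "real \<Rightarrow> real poly" where
  "Qf t = (if t \<in> E then P t else H_poly m P (connected_component_set (- E) t))"

text \<open>Candidate derivatives, obtained by differentiating the polynomial in force at t while it
  is held fixed. That they are the derivatives of F is proved everywhere for i < m; the order m is
  used only off \<open>E\<close>.\<close>

definition Fj :: "nat \<Rightarrow> real \<Rightarrow> real" where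
  "Fj i t = poly_deriv i (Qf t) t"

lemma Ext_eq: "Ext m E nc f = Fj 0"
  by (rule ext) (simp add: Ext_def Fj_def Qf_def)

lemma Qf_E: "t \<in> E \<Longrightarrow> Qf t = P t"
  by (simp add: Qf_def)

lemma component_eq:
  assumes "t \<in> I" "connected I" "I \<subseteq> - E" "\<And>C. t \<in> C \<Longrightarrow> C \<subseteq> - E \<Longrightarrow> connected C \<Longrightarrow> C \<subseteq> I"
  shows "connected_component_set (- E) t = I"
  using assms by (intro connected_component_unique) auto

lemma connected_avoid:
  fixes C :: "real set"
  assumes "connected C" "t \<in> C" "s \<in> C" "e \<notin> C"
  shows "t < e \<Longrightarrow> s < e" "e < t \<Longrightarrow> e < s"
  using connected_contains_Icc[OF assms(1-3)] connected_contains_Icc[OF assms(1,3,2)] assms(4)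
  by (meson atLeastAtMost_iff linorder_not_less subsetD less_imp_le)+

lemma component_gap:
  assumes "gap a b" "a < t" "t < b"
  shows "t \<notin> E" "connected_component_set (- E) t = {a<..<b}"
proof -
  have ab: "a \<in> E" "b \<in> E" "{a<..<b} \<subseteq> - E" using assms(1) by (auto simp: gap_def)
  then show "t \<notin> E" using assms(2,3) by auto
  show "connected_component_set (- E) t = {a<..<b}"
  proof (rule component_eq)
    show "C \<subseteq> {a<..<b}" if "t \<in> C" "C \<subseteq> - E" "connected C" for C
    proof
      fix s assume "s \<in> C"
      moreover have "a \<notin> C" "b \<notin> C" using that ab by auto
      ultimately show "s \<in> {a<..<b}"
        using connected_avoid[OF that(3,1), of s] assms(2,3) by auto
    qed
  qed (use assms ab in auto)
qed

lemma Qf_gap: "gap a b \<Longrightarrow> a < t \<Longrightarrow> t < b \<Longrightarrow> Qf t = H a b"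
  using component_gap by (simp add: Qf_def)

lemma component_right:
  assumes "a \<in> E" "E \<inter> {a<..} = {}" "a < t"
  shows "t \<notin> E" "connected_component_set (- E) t = {a<..}"
proof -
  show "t \<notin> E" using assms by auto
  show "connected_component_set (- E) t = {a<..}"
  proof (rule component_eq)
    show "C \<subseteq> {a<..}" if "t \<in> C" "C \<subseteq> - E" "connected C" for C
    proof
      fix s assume "s \<in> C"
      moreover have "a \<notin> C" using that assms(1) by auto
      ultimately show "s \<in> {a<..}" using connected_avoid[OF that(3,1), of s] assms(3) by auto
    qed
  qed (use assms in auto)
qed

lemma Qf_right:
  assumes "a \<in> E" "E \<inter> {a<..} = {}" "a < t"
  shows "Qf t = P a"
  using component_right[OF assms] by (simp add: Qf_def H_poly_right)

lemma component_left:
  assumes "b \<in> E" "E \<inter> {..<b} = {}" "t < b"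
  shows "t \<notin> E" "connected_component_set (- E) t = {..<b}"
proof -
  show "t \<notin> E" using assms by auto
  show "connected_component_set (- E) t = {..<b}"
  proof (rule component_eq)
    show "C \<subseteq> {..<b}" if "t \<in> C" "C \<subseteq> - E" "connected C" for C
    proof
      fix s assume "s \<in> C"
      moreover have "b \<notin> C" using that assms(1) by auto
      ultimately show "s \<in> {..<b}" using connected_avoid[OF that(3,1), of s] assms(3) by auto
    qed
  qed (use assms in auto)
qed

lemma Qf_left:
  assumes "b \<in> E" "E \<inter> {..<b} = {}" "t < b"
  shows "Qf t = P b"
  using component_left[OF assms] by (simp add: Qf_def H_poly_left)

lemma last_before:
  assumes "t \<notin> E" "E \<inter> {..t} \<noteq> {}"
  obtains a where "a \<in> E" "a < t" "{a<..t} \<inter> E = {}"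
proof -
  have cl: "closed (E \<inter> {..t})" using closed_E by (intro closed_Int closed_atMost)
  have bd: "bdd_above (E \<inter> {..t})" by auto
  have "Sup (E \<inter> {..t}) \<in> E \<inter> {..t}" by (rule closed_contains_Sup[OF assms(2) bd cl])
  then have "Sup (E \<inter> {..t}) \<in> E" "Sup (E \<inter> {..t}) < t" using assms(1) by (auto simp: less_le)
  moreover have "{Sup (E \<inter> {..t})<..t} \<inter> E = {}"
    using cSup_upper[OF _ bd] by fastforce
  ultimately show thesis by (rule that)
qed

lemma first_after:
  assumes "t \<notin> E" "E \<inter> {t..} \<noteq> {}"
  obtains b where "b \<in> E" "t < b" "{t..<b} \<inter> E = {}"
proof -
  have cl: "closed (E \<inter> {t..})" using closed_E by (intro closed_Int closed_atLeast)
  have bd: "bdd_below (E \<inter> {t..})" by auto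
  have "Inf (E \<inter> {t..}) \<in> E \<inter> {t..}" by (rule closed_contains_Inf[OF assms(2) bd cl])
  then have "Inf (E \<inter> {t..}) \<in> E" "t < Inf (E \<inter> {t..})" using assms(1) by (auto simp: less_le)
  moreover have "{t..<Inf (E \<inter> {t..})} \<inter> E = {}"
    using cInf_lower[OF _ bd] by fastforce
  ultimately show thesis by (rule that)
qed

lemma gap_between:
  assumes "u \<in> E" "v \<in> E" "u < t" "t < v" "t \<notin> E"
  obtains a b where "gap a b" "u \<le> a" "a < t" "t < b" "b \<le> v"
proof -
  obtain a where a: "a \<in> E" "a < t" "{a<..t} \<inter> E = {}"
    using last_before[OF assms(5)] assms(1,3) by (metis IntI atMost_iff empty_iff less_imp_le)
  obtain b where b: "b \<in> E" "t < b" "{t..<b} \<inter> E = {}"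
    using first_after[OF assms(5)] assms(2,4) by (metis IntI atLeast_iff empty_iff less_imp_le)
  have "e \<notin> E" if "a < e" "e < b" for e
    using a(3) b(3) that by (cases "e \<le> t") (auto simp: disjoint_iff)
  then have "gap a b" using a b by (auto simp: gap_def)
  moreover have "u \<le> a"
  proof -
    have "u \<notin> {a<..t}" using a(3) assms(1) by blast
    then show ?thesis using assms(3) by simp
  qed
  moreover have "b \<le> v"
  proof -
    have "v \<notin> {t..<b}" using b(3) assms(2) by blast
    then show ?thesis using assms(4) by simp
  qed
  ultimately show thesis using that a b by blast
qed

lemma off_E_cases:
  assumes "t \<notin> E"
  obtains (gap) a b where "gap a b" "a < t" "t < b"
  | (right) a where "a \<in> E" "E \<inter> {a<..} = {}" "a < t"
  | (left) b where "b \<in> E" "E \<inter> {..<b} = {}" "t < b"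
proof -
  have "E \<noteq> {}" using big m by auto
  then obtain e where e: "e \<in> E" by blast
  consider "E \<inter> {..t} = {}" | "E \<inter> {t..} = {}" | "E \<inter> {..t} \<noteq> {}" "E \<inter> {t..} \<noteq> {}" by blast
  then show thesis
  proof cases
    case 1
    then have "E \<inter> {t..} \<noteq> {}" using e by (metis IntI atLeast_iff atMost_iff empty_iff linear)
    then obtain b where b: "b \<in> E" "t < b" "{t..<b} \<inter> E = {}" using first_after[OF assms] by metis
    have "e' \<notin> E" if "e' < b" for e' using 1 b(3) that by (cases "e' \<le> t") (auto simp: disjoint_iff)
    then have "E \<inter> {..<b} = {}" by auto
    then show thesis using left b by blast
  next
    case 2
    then have "E \<inter> {..t} \<noteq> {}" using e by (metis IntI atLeast_iff atMost_iff empty_iff linear)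
    then obtain a where a: "a \<in> E" "a < t" "{a<..t} \<inter> E = {}" using last_before[OF assms] by metis
    have "e' \<notin> E" if "a < e'" for e' using 2 a(3) that by (cases "e' \<le> t") (auto simp: disjoint_iff)
    then have "E \<inter> {a<..} = {}" by auto
    then show thesis using right a by blast
  next
    case 3
    then obtain u v where "u \<in> E" "u \<le> t" "v \<in> E" "t \<le> v" by auto
    then have "u < t" "t < v" using assms by (auto simp: less_le)
    then obtain a b where "gap a b" "a < t" "t < b"
      using gap_between[OF \<open>u \<in> E\<close> \<open>v \<in> E\<close> _ _ assms] by metis
    then show thesis using gap by blast
  qed
qed

lemma Qf_local:
  assumes "x \<notin> E"
  shows "\<exists>Q. \<exists>\<eta>>0. Qf x = Q \<and> (\<forall>t. \<bar>t - x\<bar> < \<eta> \<longrightarrow> Qf t = Q \<and> t \<notin> E)"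
  using assms
proof (cases x rule: off_E_cases)
  case (gap a b)
  have "Qf t = Qf x \<and> t \<notin> E" if "\<bar>t - x\<bar> < min (x - a) (b - x)" for t
  proof -
    have t: "t \<in> {a<..<b}" using that by auto
    then have "t \<notin> E" using gap(1) unfolding gap_def by blast
    then show ?thesis using Qf_gap[OF gap(1), of t] Qf_gap[OF gap] t by simp
  qed
  moreover have "min (x - a) (b - x) > 0" using gap by simp
  ultimately show ?thesis by blast
next
  case (right a)
  have "Qf t = Qf x \<and> t \<notin> E" if "\<bar>t - x\<bar> < x - a" for t
  proof -
    have t: "a < t" using that by auto
    then have "t \<notin> E" using right(2) by auto
    then show ?thesis using Qf_right[OF right(1,2), of t] Qf_right[OF right] t by simp
  qed
  moreover have "x - a > 0" using right by simp
  ultimately show ?thesis by blast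
next
  case (left b)
  have "Qf t = Qf x \<and> t \<notin> E" if "\<bar>t - x\<bar> < b - x" for t
  proof -
    have t: "t < b" using that by auto
    then have "t \<notin> E" using left(2) by auto
    then show ?thesis using Qf_left[OF left(1,2), of t] Qf_left[OF left] t by simp
  qed
  moreover have "b - x > 0" using left by simp
  ultimately show ?thesis by blast
qed

text \<open>Isolation from one side makes a single polynomial valid next to x. The one-sided form
  also serves limit points of \<open>E\<close> that are isolated from one side, where the adjacent
  gap need not be short and the comparison with \<open>G\<close> gives nothing.\<close>

lemma right_polynomial:
  assumes \<epsilon>: "\<epsilon> > 0" "{x<..<x + \<epsilon>} \<inter> E = {}"
  shows "\<exists>Q. \<exists>\<eta>>0. (\<forall>i<m. poly_deriv i Q x = Fj i x) \<and> (\<forall>t. x < t \<and> t < x + \<eta> \<longrightarrow> Qf t = Q)"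
proof (cases "x \<in> E")
  case False
  then obtain Q \<eta> where "\<eta> > 0" "Qf x = Q" "\<And>t. \<bar>t - x\<bar> < \<eta> \<Longrightarrow> Qf t = Q \<and> t \<notin> E"
    using Qf_local by blast
  then show ?thesis by (intro exI[of _ Q] exI[of _ \<eta>]) (auto simp: Fj_def)
next
  case x: True
  show ?thesis
  proof (cases "E \<inter> {x<..} = {}")
    case True
    then show ?thesis using Qf_right[OF x True] x by (intro exI[of _ "P x"] exI[of _ 1]) (auto simp: Fj_def Qf_E)
  next
    case False
    have "x + \<epsilon> / 2 \<notin> E" using \<epsilon> by (auto simp: disjoint_iff)
    moreover have "E \<inter> {x + \<epsilon> / 2..} \<noteq> {}"
    proof -
      obtain e where "e \<in> E" "x < e" using False by auto
      moreover then have "\<not> e < x + \<epsilon>" using \<epsilon>(2) by auto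
      ultimately show ?thesis using \<epsilon>(1) by (intro ex_in_conv[THEN iffD1] exI[of _ e]) auto
    qed
    ultimately obtain b where b: "b \<in> E" "x + \<epsilon> / 2 < b" "{x + \<epsilon> / 2..<b} \<inter> E = {}"
      using first_after by metis
    have "e \<notin> E" if "x < e" "e < b" for e
    proof (cases "e < x + \<epsilon>")
      case True
      then show ?thesis using \<epsilon>(2) that by (auto simp: disjoint_iff)
    next
      case False
      then show ?thesis using b(3) that \<epsilon>(1) by (auto simp: disjoint_iff)
    qed
    moreover have "x < b" using b(2) \<epsilon>(1) by linarith
    ultimately have gp: "gap x b" using x b by (auto simp: gap_def)
    then show ?thesis
      using Qf_gap[OF gp] H_spec(1)[OF gp] x \<open>x < b\<close>
      by (intro exI[of _ "H x b"] exI[of _ "b - x"]) (auto simp: Fj_def Qf_E)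
  qed
qed

lemma left_polynomial:
  assumes \<epsilon>: "\<epsilon> > 0" "{x - \<epsilon><..<x} \<inter> E = {}"
  shows "\<exists>Q. \<exists>\<eta>>0. (\<forall>i<m. poly_deriv i Q x = Fj i x) \<and> (\<forall>t. t < x \<and> x - \<eta> < t \<longrightarrow> Qf t = Q)"
proof (cases "x \<in> E")
  case False
  then obtain Q \<eta> where "\<eta> > 0" "Qf x = Q" "\<And>t. \<bar>t - x\<bar> < \<eta> \<Longrightarrow> Qf t = Q \<and> t \<notin> E"
    using Qf_local by blast
  then show ?thesis by (intro exI[of _ Q] exI[of _ \<eta>]) (auto simp: Fj_def)
next
  case x: True
  show ?thesis
  proof (cases "E \<inter> {..<x} = {}")
    case True
    then show ?thesis using Qf_left[OF x True] x by (intro exI[of _ "P x"] exI[of _ 1]) (auto simp: Fj_def Qf_E)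
  next
    case False
    have "x - \<epsilon> / 2 \<notin> E" using \<epsilon> by (auto simp: disjoint_iff)
    moreover have "E \<inter> {..x - \<epsilon> / 2} \<noteq> {}"
    proof -
      obtain e where "e \<in> E" "e < x" using False by auto
      moreover then have "\<not> x - \<epsilon> < e" using \<epsilon>(2) by auto
      ultimately show ?thesis using \<epsilon>(1) by (intro ex_in_conv[THEN iffD1] exI[of _ e]) auto
    qed
    ultimately obtain a where a: "a \<in> E" "a < x - \<epsilon> / 2" "{a<..x - \<epsilon> / 2} \<inter> E = {}"
      using last_before by metis
    have "e \<notin> E" if "a < e" "e < x" for e
    proof (cases "x - \<epsilon> < e")
      case True
      then show ?thesis using \<epsilon>(2) that by (auto simp: disjoint_iff)
    next
      case False
      then show ?thesis using a(3) that \<epsilon>(1) by (auto simp: disjoint_iff)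
    qed
    moreover have "a < x" using a(2) \<epsilon>(1) by linarith
    ultimately have gp: "gap a x" using x a by (auto simp: gap_def)
    then show ?thesis
      using Qf_gap[OF gp] H_spec(2)[OF gp] x \<open>a < x\<close>
      by (intro exI[of _ "H a x"] exI[of _ "x - a"]) (auto simp: Fj_def Qf_E)
  qed
qed

lemma isolated_sides:
  assumes "\<not> x islimpt E"
  obtains \<epsilon> where "\<epsilon> > 0" "{x<..<x + \<epsilon>} \<inter> E = {}" "{x - \<epsilon><..<x} \<inter> E = {}"
proof -
  obtain \<epsilon> where "\<epsilon> > 0" "\<And>e. e \<in> E \<Longrightarrow> e \<noteq> x \<Longrightarrow> \<not> dist e x < \<epsilon>"
    using assms unfolding islimpt_approachable by blast
  then have "e \<notin> E" if "e \<noteq> x" "\<bar>e - x\<bar> < \<epsilon>" for e using that by (auto simp: dist_real_def)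
  then show thesis using \<open>\<epsilon> > 0\<close> by (intro that[of \<epsilon>]) (auto simp: disjoint_iff)
qed

lemma Fj_tendsto_side:
  assumes ev: "eventually (\<lambda>t. Qf t = Q) (at x within T)" and jet: "\<And>i. i < m \<Longrightarrow> poly_deriv i Q x = Fj i x"
    and i: "i < m"
  shows "(Fj i \<longlongrightarrow> Fj i x) (at x within T)"
    and "Suc i < m \<Longrightarrow> ((\<lambda>t. (Fj i t - Fj i x) / (t - x)) \<longlongrightarrow> Fj (Suc i) x) (at x within T)"
proof -
  have "(poly_deriv i Q \<longlongrightarrow> poly_deriv i Q x) (at x within T)"
    by (rule tendsto_within_subset[OF isContD[OF poly_isCont]]) simp
  then show "(Fj i \<longlongrightarrow> Fj i x) (at x within T)"
    unfolding jet[OF i]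
    by (rule Lim_transform_eventually) (use ev in \<open>eventually_elim, simp add: Fj_def\<close>)
  assume si: "Suc i < m"
  have "(poly_deriv i Q has_real_derivative poly_deriv (Suc i) Q x) (at x within T)"
    by (rule has_field_derivative_at_within[OF poly_deriv_DERIV])
  then have "((\<lambda>t. (poly_deriv i Q t - Fj i x) / (t - x)) \<longlongrightarrow> Fj (Suc i) x) (at x within T)"
    unfolding has_field_derivative_iff jet[OF i] jet[OF si] .
  then show "((\<lambda>t. (Fj i t - Fj i x) / (t - x)) \<longlongrightarrow> Fj (Suc i) x) (at x within T)"
    by (rule Lim_transform_eventually) (use ev in \<open>eventually_elim, simp add: Fj_def\<close>)
qed

lemma Fj_tendsto_right:
  assumes "\<epsilon> > 0" "{x<..<x + \<epsilon>} \<inter> E = {}" "i < m"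
  shows "(Fj i \<longlongrightarrow> Fj i x) (at_right x)"
    and "Suc i < m \<Longrightarrow> ((\<lambda>t. (Fj i t - Fj i x) / (t - x)) \<longlongrightarrow> Fj (Suc i) x) (at_right x)"
proof -
  obtain Q \<eta> where Q: "\<eta> > 0" "\<And>i. i < m \<Longrightarrow> poly_deriv i Q x = Fj i x"
    "\<And>t. x < t \<Longrightarrow> t < x + \<eta> \<Longrightarrow> Qf t = Q"
    using right_polynomial[OF assms(1,2)] by blast
  have "eventually (\<lambda>t. t \<in> {x<..<x + \<eta>}) (at_right x)"
    using Q(1) by (intro eventually_at_right_real) simp
  then have ev: "eventually (\<lambda>t. Qf t = Q) (at_right x)"
    by eventually_elim (use Q(3) in auto)
  show "(Fj i \<longlongrightarrow> Fj i x) (at_right x)"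
    "Suc i < m \<Longrightarrow> ((\<lambda>t. (Fj i t - Fj i x) / (t - x)) \<longlongrightarrow> Fj (Suc i) x) (at_right x)"
    using Fj_tendsto_side[OF ev Q(2) assms(3)] by auto
qed

lemma Fj_tendsto_left:
  assumes "\<epsilon> > 0" "{x - \<epsilon><..<x} \<inter> E = {}" "i < m"
  shows "(Fj i \<longlongrightarrow> Fj i x) (at_left x)"
    and "Suc i < m \<Longrightarrow> ((\<lambda>t. (Fj i t - Fj i x) / (t - x)) \<longlongrightarrow> Fj (Suc i) x) (at_left x)"
proof -
  obtain Q \<eta> where Q: "\<eta> > 0" "\<And>i. i < m \<Longrightarrow> poly_deriv i Q x = Fj i x"
    "\<And>t. t < x \<Longrightarrow> x - \<eta> < t \<Longrightarrow> Qf t = Q"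
    using left_polynomial[OF assms(1,2)] by blast
  have "eventually (\<lambda>t. t \<in> {x - \<eta><..<x}) (at_left x)"
    using Q(1) by (intro eventually_at_left_real) simp
  then have ev: "eventually (\<lambda>t. Qf t = Q) (at_left x)"
    by eventually_elim (use Q(3) in auto)
  show "(Fj i \<longlongrightarrow> Fj i x) (at_left x)"
    "Suc i < m \<Longrightarrow> ((\<lambda>t. (Fj i t - Fj i x) / (t - x)) \<longlongrightarrow> Fj (Suc i) x) (at_left x)"
    using Fj_tendsto_side[OF ev Q(2) assms(3)] by auto
qed

lemma Fj_deriv_off_limit:
  assumes "\<not> x islimpt E" "Suc i < m"
  shows "(Fj i has_real_derivative Fj (Suc i) x) (at x)"
proof -
  obtain \<epsilon> where \<epsilon>: "\<epsilon> > 0" "{x<..<x + \<epsilon>} \<inter> E = {}" "{x - \<epsilon><..<x} \<inter> E = {}"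
    using isolated_sides[OF assms(1)] by metis
  have "i < m" using assms(2) by simp
  then show ?thesis
    unfolding has_field_derivative_iff
    using Fj_tendsto_left(2)[OF \<epsilon>(1,3)] Fj_tendsto_right(2)[OF \<epsilon>(1,2)] assms(2)
    by (intro filterlim_split_at) auto
qed

lemma Fj_deriv_off_E:
  assumes "x \<notin> E"
  shows "(Fj i has_real_derivative Fj (Suc i) x) (at x)"
proof -
  obtain Q \<eta> where \<eta>: "\<eta> > 0" "Qf x = Q" "\<And>t. \<bar>t - x\<bar> < \<eta> \<Longrightarrow> Qf t = Q \<and> t \<notin> E"
    using Qf_local[OF assms] by blast
  have "(poly_deriv i Q has_real_derivative Fj (Suc i) x) (at x)"
    using poly_deriv_DERIV[of i Q x] by (simp add: Fj_def \<eta>(2))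
  then show ?thesis
    by (rule has_field_derivative_transform_within[OF _ \<eta>(1)])
       (use \<eta>(3) in \<open>auto simp: Fj_def dist_real_def\<close>)
qed

section \<open>Behaviour at the limit points of E\<close>

text \<open>1 stands for comparing \<open>P\<close> with \<open>G\<close>,
  \<open>glue_const m\<close> for comparing the gluing polynomial with \<open>P\<close>; 2 (m + 1)
  bounds the length of the interval used when \<epsilon> \<le> 1.\<close>

definition cont_const :: real where
  "cont_const = (1 + glue_const m) * (2 * real (m + 1)) ^ (m - 1)"

lemma cont_const_pos: "cont_const > 0"
proof -
  have "1 + glue_const m > 0" using glue_const_nonneg[OF m] by linarith
  then show ?thesis unfolding cont_const_def by (intro mult_pos_pos zero_less_power) auto
qed

text \<open>For a gap both ends must be near z, since the gluing polynomial depends on the greedy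
  sets of both.\<close>

abbreviation near_cell :: "real \<Rightarrow> real \<Rightarrow> real \<Rightarrow> bool" where
  "near_cell z \<epsilon> t \<equiv> (t \<in> E \<and> \<bar>t - z\<bar> \<le> \<epsilon>) \<or>
    (\<exists>a b. gap a b \<and> a < t \<and> t < b \<and> \<bar>a - z\<bar> \<le> \<epsilon> \<and> \<bar>b - z\<bar> \<le> \<epsilon>)"

text \<open>Greedy sets of points within \<epsilon> of z stay within (m + 1) \<epsilon> of z, so a
  single interval around z contains all the sets involved, and the polynomials are compared with
  \<open>G\<close> over it.\<close>

lemma Fj_near_limit:
  assumes z: "z islimpt E" and \<epsilon>: "0 < \<epsilon>" "\<epsilon> \<le> 1" and i: "i < m"
    and t: "near_cell z \<epsilon> t"
  shows "\<bar>Fj i t - D i t\<bar> \<le> cont_const * W (z - real (m + 1) * \<epsilon>) (z + real (m + 1) * \<epsilon>)"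
proof -
  define c where "c = z - real (m + 1) * \<epsilon>"
  define d where "d = z + real (m + 1) * \<epsilon>"
  define L where "L = (2 * real (m + 1)) ^ (m - 1)"
  have Wnn: "W c d \<ge> 0" by (rule abs_integral_nonneg)
  have Lnn: "L \<ge> 0" unfolding L_def by simp
  have eps: "\<epsilon> \<le> real (m + 1) * \<epsilon>" using \<epsilon> by (simp add: algebra_simps)
  have len: "(d - c) ^ k \<le> L" if "k \<le> m - 1" for k
  proof -
    have "real (m + 1) * \<epsilon> \<le> real (m + 1) * 1" using \<epsilon>(2) by (intro mult_left_mono) auto
    then have "d - c \<le> 2 * real (m + 1)" unfolding c_def d_def by linarith
    moreover have "d - c \<ge> 0" using \<epsilon>(1) by (simp add: c_def d_def)
    ultimately have "(d - c) ^ k \<le> (2 * real (m + 1)) ^ k" by (intro power_mono)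
    also have "\<dots> \<le> L" unfolding L_def using that by (intro power_increasing) auto
    finally show ?thesis .
  qed
  have Scd: "S e \<subseteq> {c..d}" if e: "e \<in> E" "\<bar>e - z\<bar> \<le> \<epsilon>" for e
  proof -
    have "S e \<subseteq> cball e (real m * \<bar>e - z\<bar>)" by (rule S_near_limit_point[OF e(1) z])
    also have "\<dots> \<subseteq> cball e (real m * \<epsilon>)" using e(2) by (intro subset_cball mult_left_mono) auto
    also have "\<dots> \<subseteq> {c..d}"
      using e(2) unfolding c_def d_def by (auto simp: dist_real_def abs_le_iff algebra_simps)
    finally show ?thesis .
  qed
  have Pc: "\<bar>D i t - poly_deriv i (P e) t\<bar> \<le> W c d * L" if e: "e \<in> E" "\<bar>e - z\<bar> \<le> \<epsilon>" and "\<bar>t - z\<bar> \<le> \<epsilon>" for e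
  proof -
    have "\<bar>D i t - poly_deriv i (P e) t\<bar> \<le> W c d * (d - c) ^ (m - 1 - i)"
      using that(3) eps by (intro P_close[OF e(1) Scd[OF e] _ i]) (auto simp: c_def d_def abs_le_iff)
    also have "\<dots> \<le> W c d * L" using len Wnn by (intro mult_left_mono) auto
    finally show ?thesis .
  qed
  have gnn: "glue_const m \<ge> 0" by (rule glue_const_nonneg[OF m])
  have "\<bar>Fj i t - D i t\<bar> \<le> (1 + glue_const m) * (W c d * L)"
    using t
  proof (elim disjE exE conjE)
    assume *: "t \<in> E" "\<bar>t - z\<bar> \<le> \<epsilon>"
    have "\<bar>Fj i t - D i t\<bar> \<le> W c d * L"
      using Pc[OF * *(2)] * by (simp add: Fj_def Qf_E abs_minus_commute)
    also have "\<dots> \<le> (1 + glue_const m) * (W c d * L)" using gnn Wnn Lnn by (simp add: algebra_simps)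
    finally show ?thesis .
  next
    fix a b assume *: "gap a b" "a < t" "t < b" "\<bar>a - z\<bar> \<le> \<epsilon>" "\<bar>b - z\<bar> \<le> \<epsilon>"
    have ab: "a \<in> E" "b \<in> E" "a < b" using *(1) by (auto simp: gap_def)
    have tz: "\<bar>t - z\<bar> \<le> \<epsilon>" using * by linarith
    have "S a \<union> S b \<subseteq> {c..d}" using Scd[OF ab(1) *(4)] Scd[OF ab(2) *(5)] by blast
    then have "c \<le> lo a b" "hi a b \<le> d" using hull_bounds(5,6)[OF *(1)] by (meson atLeastAtMost_iff subsetD)+
    then have WW: "W (lo a b) (hi a b) \<le> W c d" by (rule W_mono)
    have ba: "b - a \<le> d - c" using *(4,5) eps unfolding c_def d_def by linarith
    have "\<bar>Fj i t - poly_deriv i (P a) t\<bar> \<le> glue_const m * W (lo a b) (hi a b) * (b - a) ^ (m - 1) / (b - a) ^ i"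
      using H_close(1)[OF *(1), of i t] Qf_gap[OF *(1-3)] * i by (simp add: Fj_def)
    also have "\<dots> = glue_const m * (W (lo a b) (hi a b) * (b - a) ^ (m - 1 - i))"
      using i ab(3) by (simp add: power_diff)
    also have "\<dots> \<le> glue_const m * (W c d * L)"
    proof (intro mult_left_mono gnn mult_mono WW Wnn)
      have "(b - a) ^ (m - 1 - i) \<le> (d - c) ^ (m - 1 - i)" using ba ab(3) by (intro power_mono) auto
      also have "\<dots> \<le> L" by (intro len) simp
      finally show "(b - a) ^ (m - 1 - i) \<le> L" .
    qed (use ab in auto)
    finally have "\<bar>Fj i t - D i t\<bar> \<le> glue_const m * (W c d * L) + W c d * L"
      using Pc[OF ab(1) *(4) tz] by linarith
    then show ?thesis by (simp add: algebra_simps)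
  qed
  then show ?thesis unfolding cont_const_def L_def c_def d_def by (simp only: mult.assoc mult.commute mult.left_commute)
qed

lemma D_isCont: "i < m \<Longrightarrow> isCont (D i) x"
proof (cases "Suc i < m")
  case True
  then show ?thesis using D_deriv DERIV_isCont by blast
next
  case False
  moreover assume "i < m"
  ultimately have "i = m - 1" by linarith
  then show ?thesis
    using abs_continuous_imp_continuous[OF D_ac] by (simp add: continuous_on_eq_continuous_at)
qed

lemma near_limit_small:
  assumes z: "z islimpt E" and e: "e > 0"
  obtains \<epsilon> where "0 < \<epsilon>" "\<And>i t. i < m \<Longrightarrow> near_cell z \<epsilon> t \<Longrightarrow> \<bar>Fj i t - D i t\<bar> < e"
proof -
  have "e / cont_const > 0" using e cont_const_pos by simp
  then obtain r where r: "r > 0" "W (z - r) (z + r) < e / cont_const"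
    using abs_integral_small[OF g_Lp p] by metis
  define \<epsilon> where "\<epsilon> = min 1 (r / real (m + 1))"
  have \<epsilon>: "0 < \<epsilon>" "\<epsilon> \<le> 1" "real (m + 1) * \<epsilon> \<le> r"
  proof -
    show "0 < \<epsilon>" "\<epsilon> \<le> 1" using r(1) by (auto simp: \<epsilon>_def)
    have "real (m + 1) * \<epsilon> \<le> real (m + 1) * (r / real (m + 1))" by (intro mult_left_mono) (auto simp: \<epsilon>_def)
    also have "\<dots> = r" by (simp del: of_nat_add)
    finally show "real (m + 1) * \<epsilon> \<le> r" .
  qed
  have "W (z - real (m + 1) * \<epsilon>) (z + real (m + 1) * \<epsilon>) \<le> W (z - r) (z + r)"
    using \<epsilon>(3) by (intro W_mono) auto
  then have "cont_const * W (z - real (m + 1) * \<epsilon>) (z + real (m + 1) * \<epsilon>) \<le> cont_const * W (z - r) (z + r)"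
    using cont_const_pos by (intro mult_left_mono) auto
  also have "\<dots> < e" using r(2) cont_const_pos by (simp add: pos_less_divide_eq mult.commute)
  finally have "cont_const * W (z - real (m + 1) * \<epsilon>) (z + real (m + 1) * \<epsilon>) < e" .
  then have "\<bar>Fj i t - D i t\<bar> < e" if "i < m" "near_cell z \<epsilon> t" for i t
    using Fj_near_limit[OF z \<epsilon>(1,2) that] by linarith
  then show thesis using that \<epsilon>(1) by blast
qed

lemma Fj_limit_point:
  assumes "z islimpt E" "i < m"
  shows "Fj i z = D i z"
  using P_limit_point[OF assms] S_limit_point(1)[OF assms(1)] by (simp add: Fj_def Qf_E)

text \<open>On each side of z, either \<open>E\<close> is absent nearby and one polynomial is in
  force, or a point \<open>e0\<close> of \<open>E\<close> close to z traps every gap met between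
  \<open>e0\<close> and z, so that the comparison with \<open>D i\<close> applies.\<close>

lemma Fj_isCont_limit:
  assumes z: "z islimpt E" and i: "i < m"
  shows "isCont (Fj i) z"
proof -
  have zE: "z \<in> E" by (rule S_limit_point(1)[OF z])
  have lim: "(Fj i \<longlongrightarrow> Fj i z) (at z within T)"
    if ev: "\<And>\<epsilon>. \<epsilon> > 0 \<Longrightarrow> eventually (\<lambda>t. near_cell z \<epsilon> t) (at z within T)" for T
  proof -
    have "((\<lambda>t. Fj i t - D i t) \<longlongrightarrow> 0) (at z within T)"
      unfolding tendsto_iff
    proof (intro allI impI)
      fix e :: real assume "e > 0"
      from near_limit_small[OF z this] obtain \<epsilon> where \<epsilon>: "0 < \<epsilon>" "\<And>i t. i < m \<Longrightarrow> near_cell z \<epsilon> t \<Longrightarrow> \<bar>Fj i t - D i t\<bar> < e"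
        by metis
      from ev[OF \<epsilon>(1)] show "eventually (\<lambda>t. dist (Fj i t - D i t) 0 < e) (at z within T)"
        by (rule eventually_mono) (use \<epsilon>(2)[OF i] in \<open>simp add: dist_real_def\<close>)
    qed
    moreover have "(D i \<longlongrightarrow> D i z) (at z within T)"
      by (rule tendsto_within_subset[OF isContD[OF D_isCont[OF i]]]) simp
    ultimately have "((\<lambda>t. (Fj i t - D i t) + D i t) \<longlongrightarrow> 0 + D i z) (at z within T)" by (rule tendsto_add)
    then show ?thesis using Fj_limit_point[OF z i] by simp
  qed
  have "(Fj i \<longlongrightarrow> Fj i z) (at_right z)"
  proof (cases "\<exists>\<epsilon>>0. {z<..<z + \<epsilon>} \<inter> E = {}")
    case True
    then show ?thesis using Fj_tendsto_right(1) i by blast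
  next
    case False
    show ?thesis
    proof (rule lim)
      fix \<epsilon> :: real assume "\<epsilon> > 0"
      then obtain e0 where e0: "e0 \<in> E" "z < e0" "e0 < z + \<epsilon>" using False by (auto simp: disjoint_iff)
      have "eventually (\<lambda>t. t \<in> {z<..<e0}) (at_right z)" by (rule eventually_at_right_real[OF e0(2)])
      then show "eventually (\<lambda>t. near_cell z \<epsilon> t) (at_right z)"
      proof (rule eventually_mono)
        fix t assume t: "t \<in> {z<..<e0}"
        show "near_cell z \<epsilon> t"
        proof (cases "t \<in> E")
          case True
          then show ?thesis using t e0 by auto
        next
          case False
          have "z < t" "t < e0" using t by auto
          then obtain a b where "gap a b" "z \<le> a" "a < t" "t < b" "b \<le> e0"
            by (rule gap_between[OF zE e0(1) _ _ False])
          then show ?thesis using e0 by (intro disjI2 exI[of _ a] exI[of _ b]) auto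
        qed
      qed
    qed
  qed
  moreover have "(Fj i \<longlongrightarrow> Fj i z) (at_left z)"
  proof (cases "\<exists>\<epsilon>>0. {z - \<epsilon><..<z} \<inter> E = {}")
    case True
    then show ?thesis using Fj_tendsto_left(1) i by blast
  next
    case False
    show ?thesis
    proof (rule lim)
      fix \<epsilon> :: real assume "\<epsilon> > 0"
      then obtain e0 where e0: "e0 \<in> E" "e0 < z" "z - \<epsilon> < e0" using False by (auto simp: disjoint_iff)
      have "eventually (\<lambda>t. t \<in> {e0<..<z}) (at_left z)" by (rule eventually_at_left_real[OF e0(2)])
      then show "eventually (\<lambda>t. near_cell z \<epsilon> t) (at_left z)"
      proof (rule eventually_mono)
        fix t assume t: "t \<in> {e0<..<z}"
        show "near_cell z \<epsilon> t"
        proof (cases "t \<in> E")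
          case True
          then show ?thesis using t e0 by auto
        next
          case False
          have "e0 < t" "t < z" using t by auto
          then obtain a b where "gap a b" "e0 \<le> a" "a < t" "t < b" "b \<le> z"
            by (rule gap_between[OF e0(1) zE _ _ False])
          then show ?thesis using e0 by (intro disjI2 exI[of _ a] exI[of _ b]) auto
        qed
      qed
    qed
  qed
  ultimately show ?thesis unfolding isCont_def by (intro filterlim_split_at)
qed

lemma Fj_isCont:
  assumes "i < m"
  shows "isCont (Fj i) x"
proof (cases "x islimpt E")
  case True
  then show ?thesis using Fj_isCont_limit assms by blast
next
  case False
  obtain \<epsilon> where \<epsilon>: "\<epsilon> > 0" "{x<..<x + \<epsilon>} \<inter> E = {}" "{x - \<epsilon><..<x} \<inter> E = {}"
    using isolated_sides[OF False] by metis
  then show ?thesis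
    unfolding isCont_def using Fj_tendsto_left(1)[OF \<epsilon>(1,3) assms] Fj_tendsto_right(1)[OF \<epsilon>(1,2) assms]
    by (intro filterlim_split_at)
qed

text \<open>At a limit point x the difference \<phi> is used, which vanishes at all limit points.
  From y go back towards x to the nearest limit point u: on the open segment between them \<phi> i
  has derivative \<phi> (Suc i), which is small near x, so |\<phi> i y| \<le> e |y - u| \<le> e |y -
  x|. Hence \<phi> i has derivative 0 at x.\<close>

lemma Fj_deriv:
  assumes i: "Suc i < m"
  shows "(Fj i has_real_derivative Fj (Suc i) x) (at x)"
proof (cases "x islimpt E")
  case False
  then show ?thesis using Fj_deriv_off_limit i by blast
next
  case z: True
  define \<phi> where "\<phi> j t = Fj j t - D j t" for j t
  have i': "i < m" using i by simp
  have cont: "isCont (\<phi> j) t" if "j < m" for j t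
    unfolding \<phi>_def using that by (intro continuous_intros Fj_isCont D_isCont)
  have zero: "\<phi> j t = 0" if "t islimpt E" "j < m" for j t
    using Fj_limit_point[OF that] by (simp add: \<phi>_def)
  have der: "(\<phi> i has_real_derivative \<phi> (Suc i) t) (at t)" if "\<not> t islimpt E" for t
    unfolding \<phi>_def by (intro DERIV_diff Fj_deriv_off_limit D_deriv that i)
  have "(\<phi> i has_real_derivative 0) (at x)"
    unfolding has_field_derivative_def has_derivative_at_alt
  proof (intro conjI allI impI bounded_linear_mult_right)
    fix e :: real assume "e > 0"
    have "(\<phi> (Suc i) \<longlongrightarrow> 0) (at x)" using isContD[OF cont[OF i, of x]] zero[OF z i] by simp
    then obtain d where d: "d > 0" "\<And>t. t \<noteq> x \<Longrightarrow> dist t x < d \<Longrightarrow> \<bar>\<phi> (Suc i) t\<bar> < e"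
      using \<open>e > 0\<close> unfolding tendsto_iff eventually_at by (auto simp: dist_real_def)
    have "norm (\<phi> i y - \<phi> i x - 0 * (y - x)) \<le> e * norm (y - x)" if y: "norm (y - x) < d" for y
    proof (cases "y islimpt E")
      case True
      then show ?thesis using zero[OF True i'] zero[OF z i'] \<open>e > 0\<close> by simp
    next
      case False
      let ?K = "{t. t islimpt E} \<inter> closed_segment x y"
      have cl: "closed ?K" by (intro closed_Int closed_limpts closed_segment)
      have ne: "?K \<noteq> {}" using z by auto
      obtain u where u: "u \<in> ?K" "\<And>v. v \<in> ?K \<Longrightarrow> dist y u \<le> dist y v"
        using distance_attains_inf[OF cl ne, of y] by metis
      have uy: "u \<noteq> y" using u(1) False by auto
      have seg: "t \<in> closed_segment x y \<and> dist y t < dist y u \<and> t \<noteq> x" if "t \<in> open_segment u y" for t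
        using u(1) that uy by (auto simp: closed_segment_eq_real_ivl open_segment_eq_real_ivl dist_real_def split: if_splits)
      have nolim: "\<not> t islimpt E" if "t \<in> open_segment u y" for t
        using seg[OF that] u(2)[of t] by auto
      obtain \<xi> where \<xi>: "\<xi> \<in> open_segment u y" "\<bar>\<phi> i y - \<phi> i u\<bar> = \<bar>y - u\<bar> * \<bar>\<phi> (Suc i) \<xi>\<bar>"
        using mvt_open_segment[OF uy cont[OF i'] der[OF nolim]] by blast
      have "dist \<xi> x < d"
        using seg[OF \<xi>(1)] y by (auto simp: closed_segment_eq_real_ivl dist_real_def split: if_splits)
      then have "\<bar>\<phi> (Suc i) \<xi>\<bar> < e" using d(2) seg[OF \<xi>(1)] by blast
      moreover have "\<bar>y - u\<bar> \<le> \<bar>y - x\<bar>" using u(2)[of x] z by (simp add: dist_real_def)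
      ultimately have "\<bar>y - u\<bar> * \<bar>\<phi> (Suc i) \<xi>\<bar> \<le> \<bar>y - x\<bar> * e" by (intro mult_mono) auto
      then show ?thesis using \<xi>(2) zero[of u i] zero[OF z i'] u(1) i' by (simp add: mult.commute)
    qed
    then show "\<exists>d>0. \<forall>y. norm (y - x) < d \<longrightarrow> norm (\<phi> i y - \<phi> i x - 0 * (y - x)) \<le> e * norm (y - x)"
      using d(1) by blast
  qed
  then have "((\<lambda>t. \<phi> i t + D i t) has_real_derivative 0 + D (Suc i) x) (at x)"
    by (intro DERIV_add D_deriv i)
  then show ?thesis using Fj_limit_point[OF z i] by (simp add: \<phi>_def)
qed

end

section \<open>The norm estimate\<close>

lemma countable_isolated_points:
  fixes A :: "real set"
  shows "countable {x \<in> A. \<not> x islimpt A}"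
proof -
  have "\<exists>q r. q \<in> \<rat> \<and> r \<in> \<rat> \<and> A \<inter> {q<..<r} = {x}" if xA: "x \<in> A" and xl: "\<not> x islimpt A" for x
  proof -
    obtain e where e: "e > 0" "\<And>y. y \<in> A \<Longrightarrow> y \<noteq> x \<Longrightarrow> \<not> dist y x < e"
      using xl unfolding islimpt_approachable by blast
    obtain q where q: "q \<in> \<rat>" "x - e < q" "q < x" using Rats_dense_in_real[of "x - e" x] e(1) by auto
    obtain r where r: "r \<in> \<rat>" "x < r" "r < x + e" using Rats_dense_in_real[of x "x + e"] e(1) by auto
    have "y \<in> {x}" if "y \<in> A" "q < y" "y < r" for y
    proof (rule ccontr)
      assume "y \<notin> {x}"
      then have "y \<noteq> x" by simp
      moreover have "dist y x < e" using that q r unfolding dist_real_def by linarith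
      ultimately show False using e(2)[OF that(1)] by blast
    qed
    then have "A \<inter> {q<..<r} \<subseteq> {x}" by (meson IntE greaterThanLessThan_iff subsetI)
    moreover have "x \<in> A \<inter> {q<..<r}" using xA q r by simp
    ultimately have "A \<inter> {q<..<r} = {x}" by blast
    then show ?thesis using q(1) r(1) by blast
  qed
  then obtain q r where qr: "\<And>x. x \<in> A \<Longrightarrow> \<not> x islimpt A \<Longrightarrow> q x \<in> \<rat> \<and> r x \<in> \<rat> \<and> A \<inter> {q x<..<r x} = {x}"
    by metis
  have "inj_on (\<lambda>x. (q x, r x)) {x \<in> A. \<not> x islimpt A}"
  proof (rule inj_onI, clarify)
    fix x y assume "x \<in> A" "\<not> x islimpt A" "y \<in> A" "\<not> y islimpt A" "q x = q y" "r x = r y"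
    then have "{x} = {y}" using qr[of x] qr[of y] by metis
    then show "x = y" by simp
  qed
  moreover have "countable ((\<lambda>x. (q x, r x)) ` {x \<in> A. \<not> x islimpt A})"
  proof (rule countable_subset)
    show "(\<lambda>x. (q x, r x)) ` {x \<in> A. \<not> x islimpt A} \<subseteq> \<rat> \<times> \<rat>" using qr by auto
  qed (intro countable_SIGMA countable_rat)
  ultimately show ?thesis by (rule countable_image_inj_on[rotated])
qed

text \<open>Hoelder's inequality up to the factor 2^p, from \<open>young_split\<close> with the t
  that balances both terms; if the integral on the right vanishes, arbitrarily small t are used
  instead.\<close>

lemma abs_integral_powr_le:
  assumes L: "in_Lp p g" "p > 1" and "c < d"
  shows "abs_integral g c d powr p
    \<le> 2 powr p * (d - c) powr (p - 1) * (LINT t:{c..d}|lebesgue. \<bar>g t\<bar> powr p)"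
proof -
  define len where "len = d - c"
  define I where "I = (LINT t:{c..d}|lebesgue. \<bar>g t\<bar> powr p)"
  have len: "len > 0" using \<open>c < d\<close> by (simp add: len_def)
  have Inn: "I \<ge> 0" unfolding I_def set_lebesgue_integral_def by (intro integral_nonneg_AE AE_I2) simp
  have gp: "integrable lebesgue (\<lambda>t. \<bar>g t\<bar> powr p)" using L by (simp add: in_Lp_def)
  have int: "integrable lebesgue (\<lambda>x. indicat_real {c..d} x *\<^sub>R \<bar>g x\<bar>)"
    using set_integrable_abs[OF in_Lp_set_integrable[OF L]] by (simp add: set_integrable_def)
  have intp: "integrable lebesgue (\<lambda>x. indicat_real {c..d} x *\<^sub>R \<bar>g x\<bar> powr p)"
    by (rule integrable_mult_indicator[OF _ gp]) simp
  have ind: "integrable lebesgue (indicat_real {c..d})"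
    using lmeasurable_iff_integrable lmeasurable_interval by blast
  have split: "abs_integral g c d \<le> t * len + t powr (1 - p) * I" if t: "t > 0" for t
  proof -
    have "abs_integral g c d \<le> (LINT x|lebesgue. t * indicat_real {c..d} x + t powr (1 - p) * (indicat_real {c..d} x *\<^sub>R \<bar>g x\<bar> powr p))"
      unfolding set_lebesgue_integral_def
    proof (rule integral_mono[OF int])
      show "integrable lebesgue (\<lambda>x. t * indicat_real {c..d} x + t powr (1 - p) * (indicat_real {c..d} x *\<^sub>R \<bar>g x\<bar> powr p))"
        by (intro Bochner_Integration.integrable_add integrable_mult_right ind intp)
      show "indicat_real {c..d} x *\<^sub>R \<bar>g x\<bar> \<le> t * indicat_real {c..d} x + t powr (1 - p) * (indicat_real {c..d} x *\<^sub>R \<bar>g x\<bar> powr p)" for x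
        using young_split[OF t L(2), of "\<bar>g x\<bar>"] by (simp add: indicator_def)
    qed
    also have "\<dots> = (LINT x|lebesgue. t * indicat_real {c..d} x) + (LINT x|lebesgue. t powr (1 - p) * (indicat_real {c..d} x *\<^sub>R \<bar>g x\<bar> powr p))"
      by (intro Bochner_Integration.integral_add integrable_mult_right ind intp)
    also have "(LINT x|lebesgue. t * indicat_real {c..d} x) = t * len"
      using \<open>c < d\<close> by (simp add: len_def)
    also have "(LINT x|lebesgue. t powr (1 - p) * (indicat_real {c..d} x *\<^sub>R \<bar>g x\<bar> powr p)) = t powr (1 - p) * I"
      unfolding I_def set_lebesgue_integral_def by (rule integral_mult_right_zero)
    finally show ?thesis .
  qed
  have Wnn: "abs_integral g c d \<ge> 0" by (rule abs_integral_nonneg)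
  have "abs_integral g c d powr p \<le> 2 powr p * len powr (p - 1) * I"
  proof (cases "I = 0")
    case True
    have "abs_integral g c d \<le> 0"
    proof (rule field_le_epsilon)
      fix e :: real assume "e > 0"
      then show "abs_integral g c d \<le> 0 + e" using split[of "e / len"] len True by simp
    qed
    then have "abs_integral g c d = 0" using Wnn by linarith
    then show ?thesis using True by simp
  next
    case False
    then have I: "I > 0" using Inn by simp
    define t where "t = (I / len) powr (1 / p)"
    have t: "t > 0" using I len by (simp add: t_def)
    have tp: "t powr p = I / len" using I len L(2) by (simp add: t_def powr_powr)
    have "t powr (1 - p) * I = t * len"
      using t tp I len by (simp add: powr_diff)
    then have "abs_integral g c d \<le> 2 * (t * len)" using split[OF t] by linarith
    then have "abs_integral g c d powr p \<le> (2 * (t * len)) powr p"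
      using Wnn L(2) by (intro powr_mono2) auto
    also have "\<dots> = 2 powr p * (t powr p * len powr p)" using t len by (simp add: powr_mult)
    also have "\<dots> = 2 powr p * len powr (p - 1) * I"
      unfolding tp using len by (simp add: powr_diff)
    finally show ?thesis .
  qed
  then show ?thesis by (simp add: len_def I_def)
qed

section \<open>Overlap of the hulls\<close>

context whitney_ext
begin

text \<open>A representative of the m-th derivative of F, measured and estimated before it is known
  to be a derivative.\<close>

definition h :: "real \<Rightarrow> real" where "h t = (if t \<in> E then g t else Fj m t)"

definition gaps :: "(real \<times> real) set" where "gaps = {(a, b). gap a b}"

lemma gap_unique:
  assumes "gap a b" "gap a' b'" "a < t" "t < b" "a' < t" "t < b'"
  shows "a = a' \<and> b = b'"
proof -
  have E: "a \<in> E" "b \<in> E" "a' \<in> E" "b' \<in> E" and d: "{a<..<b} \<inter> E = {}" "{a'<..<b'} \<inter> E = {}"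
    using assms(1,2) by (auto simp: gap_def)
  have "a \<notin> {a'<..<b'}" "b \<notin> {a'<..<b'}" "a' \<notin> {a<..<b}" "b' \<notin> {a<..<b}" using E d by blast+
  then show ?thesis using assms(3-6) by auto
qed

lemma countable_gaps: "countable gaps"
proof -
  have "\<exists>q. q \<in> \<rat> \<and> a < q \<and> q < b" if "gap a b" for a b
    using Rats_dense_in_real[of a b] that by (auto simp: gap_def)
  then obtain q where q: "\<And>a b. gap a b \<Longrightarrow> q a b \<in> \<rat> \<and> a < q a b \<and> q a b < b" by metis
  have "inj_on (\<lambda>(a, b). q a b) gaps"
  proof (rule inj_onI, clarify)
    fix a b a' b' assume "(a, b) \<in> gaps" "(a', b') \<in> gaps" "q a b = q a' b'"
    then show "a = a' \<and> b = b'" using gap_unique[of a b a' b' "q a b"] q[of a b] q[of a' b'] by (auto simp: gaps_def)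
  qed
  moreover have "(\<lambda>(a, b). q a b) ` gaps \<subseteq> \<rat>" using q by (auto simp: gaps_def)
  moreover have "countable (\<rat> :: real set)" by (rule countable_rat)
  ultimately show ?thesis using countable_image_inj_on countable_subset by blast
qed

lemma gap_snd_inj: "gap a b \<Longrightarrow> gap a' b \<Longrightarrow> a = a'"
proof -
  assume *: "gap a b" "gap a' b"
  then have "a \<notin> {a'<..<b}" "a' \<notin> {a<..<b}" "a < b" "a' < b" unfolding gap_def by blast+
  then show "a = a'" by auto
qed

lemma gap_fst_inj: "gap a b \<Longrightarrow> gap a b' \<Longrightarrow> b = b'"
proof -
  assume *: "gap a b" "gap a b'"
  then have "b \<notin> {a<..<b'}" "b' \<notin> {a<..<b}" "a < b" "a < b'" unfolding gap_def by blast+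
  then show "b = b'" by auto
qed

lemma E_convexD: "E_convex E A \<Longrightarrow> u \<in> A \<Longrightarrow> v \<in> A \<Longrightarrow> e \<in> E \<Longrightarrow> u \<le> e \<Longrightarrow> e \<le> v \<Longrightarrow> e \<in> A"
  unfolding E_convex_def by blast

text \<open>The outer end of the hull belongs to \<open>S a\<close> or \<open>S b\<close>; together
  with a or b respectively it spans the stretch in question, and convexity within \<open>E\<close>
  fills it.\<close>

lemma hull_E:
  assumes "gap a b"
  shows "E \<inter> {lo a b..a} \<subseteq> S a \<union> S b" "E \<inter> {b..hi a b} \<subseteq> S a \<union> S b"
proof -
  have ab: "a \<in> E" "b \<in> E" "a < b" using assms by (auto simp: gap_def)
  have S: "a \<in> S a" "b \<in> S b" "E_convex E (S a)" "E_convex E (S b)" using S_basic[OF ab(1)] S_basic[OF ab(2)] by auto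
  show "E \<inter> {lo a b..a} \<subseteq> S a \<union> S b"
  proof
    fix e assume e: "e \<in> E \<inter> {lo a b..a}"
    consider "lo a b \<in> S a" | "lo a b \<in> S b" using hull_bounds(5)[OF assms] by blast
    then show "e \<in> S a \<union> S b"
    proof cases
      case 1
      then have "e \<in> S a" using E_convexD[OF S(3) _ S(1)] e by simp
      then show ?thesis ..
    next
      case 2
      have "e \<le> b" using e ab(3) by simp
      then have "e \<in> S b" using 2 E_convexD[OF S(4) _ S(2)] e by simp
      then show ?thesis ..
    qed
  qed
  show "E \<inter> {b..hi a b} \<subseteq> S a \<union> S b"
  proof
    fix e assume e: "e \<in> E \<inter> {b..hi a b}"
    consider "hi a b \<in> S a" | "hi a b \<in> S b" using hull_bounds(6)[OF assms] by blast
    then show "e \<in> S a \<union> S b"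
    proof cases
      case 1
      have "a \<le> e" using e ab(3) by simp
      then have "e \<in> S a" using 1 E_convexD[OF S(3) S(1)] e by simp
      then show ?thesis ..
    next
      case 2
      then have "e \<in> S b" using E_convexD[OF S(4) S(2)] e by simp
      then show ?thesis ..
    qed
  qed
qed

lemma hull_card:
  assumes "gap a b"
  shows "finite (S a \<union> S b)" "card (S a \<union> S b) \<le> 2 * m"
proof -
  have ab: "a \<in> E" "b \<in> E" using assms by (auto simp: gap_def)
  show "finite (S a \<union> S b)" using S_basic(1) ab by blast
  show "card (S a \<union> S b) \<le> 2 * m"
    using card_Un_le[of "S a" "S b"] S_basic(5)[OF ab(1)] S_basic(5)[OF ab(2)] by linarith
qed

lemma hull_E_finite:
  assumes "gap a b"
  shows "finite (E \<inter> {lo a b..hi a b})"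
proof -
  have "E \<inter> {lo a b..hi a b} \<subseteq> S a \<union> S b"
  proof
    fix e assume e: "e \<in> E \<inter> {lo a b..hi a b}"
    have "e \<notin> {a<..<b}" using assms e unfolding gap_def by blast
    then have "e \<le> a \<or> b \<le> e" by auto
    then show "e \<in> S a \<union> S b" using e hull_E[OF assms] by auto
  qed
  then show ?thesis using hull_card(1)[OF assms] finite_subset by blast
qed

text \<open>A finite subset lies between its least element and t, where \<open>E\<close> has at most
  n points.\<close>

lemma few_points_before:
  fixes t :: real
  shows "finite {b \<in> E. b \<le> t \<and> finite (E \<inter> {b..t}) \<and> card (E \<inter> {b..t}) \<le> n}
    \<and> card {b \<in> E. b \<le> t \<and> finite (E \<inter> {b..t}) \<and> card (E \<inter> {b..t}) \<le> n} \<le> n"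
proof (rule finite_if_finite_subsets_card_bdd)
  fix F assume F: "F \<subseteq> {b \<in> E. b \<le> t \<and> finite (E \<inter> {b..t}) \<and> card (E \<inter> {b..t}) \<le> n}" "finite F"
  show "card F \<le> n"
  proof (cases "F = {}")
    case False
    then have "Min F \<in> F" using F(2) by simp
    then have *: "finite (E \<inter> {Min F..t})" "card (E \<inter> {Min F..t}) \<le> n" using F(1) by auto
    have "F \<subseteq> E \<inter> {Min F..t}" using F by auto
    then show ?thesis using card_mono[OF *(1)] *(2) by (meson order_trans)
  qed simp
qed

lemma few_points_after:
  fixes t :: real
  shows "finite {b \<in> E. t \<le> b \<and> finite (E \<inter> {t..b}) \<and> card (E \<inter> {t..b}) \<le> n}
    \<and> card {b \<in> E. t \<le> b \<and> finite (E \<inter> {t..b}) \<and> card (E \<inter> {t..b}) \<le> n} \<le> n"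
proof (rule finite_if_finite_subsets_card_bdd)
  fix F assume F: "F \<subseteq> {b \<in> E. t \<le> b \<and> finite (E \<inter> {t..b}) \<and> card (E \<inter> {t..b}) \<le> n}" "finite F"
  show "card F \<le> n"
  proof (cases "F = {}")
    case False
    then have "Max F \<in> F" using F(2) by simp
    then have *: "finite (E \<inter> {t..Max F})" "card (E \<inter> {t..Max F}) \<le> n" using F(1) by auto
    have "F \<subseteq> E \<inter> {t..Max F}" using F by auto
    then show ?thesis using card_mono[OF *(1)] *(2) by (meson order_trans)
  qed simp
qed

text \<open>A hull is a run of at most \<open>2 m\<close> consecutive points of \<open>E\<close>, so a point off \<open>E\<close> lies in
  boundedly many hulls; this replaces the maximal function, whose norm would depend on \<open>p\<close>.\<close>
lemma hull_overlap:
  assumes t: "t \<notin> E"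
  shows "finite {(a, b). gap a b \<and> t \<in> {lo a b..hi a b}}
    \<and> card {(a, b). gap a b \<and> t \<in> {lo a b..hi a b}} \<le> 4 * m + 1"
proof -
  \<comment> \<open>Three positions of a gap relative to t: on the left with its hull reaching t, on
    the right likewise, or around t. The first two account for 2 m gaps each, the last for
    one.\<close>
  define B1 where "B1 = {(a, b). gap a b \<and> b \<le> t \<and> t \<le> hi a b}"
  define B2 where "B2 = {(a, b). gap a b \<and> t \<le> a \<and> lo a b \<le> t}"
  define B3 where "B3 = {(a, b). gap a b \<and> a < t \<and> t < b}"
  let ?V1 = "{b \<in> E. b \<le> t \<and> finite (E \<inter> {b..t}) \<and> card (E \<inter> {b..t}) \<le> 2 * m}"
  let ?V2 = "{b \<in> E. t \<le> b \<and> finite (E \<inter> {t..b}) \<and> card (E \<inter> {t..b}) \<le> 2 * m}"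
  have sub: "X \<subseteq> S a \<union> S b \<Longrightarrow> finite X \<and> card X \<le> 2 * m" if "gap a b" for a b X
    using hull_card[OF that] finite_subset card_mono by (meson order_trans)
  have "snd ` B1 \<subseteq> ?V1"
  proof (rule image_subsetI)
    fix i assume "i \<in> B1"
    obtain a b where i: "i = (a, b)" by fastforce
    with \<open>i \<in> B1\<close> have "(a, b) \<in> B1" by simp
    then have *: "gap a b" "b \<le> t" "t \<le> hi a b" by (auto simp: B1_def)
    have "E \<inter> {b..t} \<subseteq> E \<inter> {b..hi a b}" using *(3) by auto
    then have "E \<inter> {b..t} \<subseteq> S a \<union> S b" using hull_E(2)[OF *(1)] by blast
    from sub[OF *(1) this] show "snd i \<in> ?V1" using * by (auto simp: gap_def i)
  qed
  then have f1: "finite (snd ` B1)" "card (snd ` B1) \<le> 2 * m"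
    using few_points_before[of t "2 * m"] finite_subset card_mono by (blast, meson order_trans)
  have i1: "inj_on snd B1" unfolding B1_def by (auto intro!: inj_onI dest: gap_snd_inj)
  have B1: "finite B1" "card B1 \<le> 2 * m" using f1 finite_imageD[OF f1(1) i1] card_image[OF i1] by auto
  have "fst ` B2 \<subseteq> ?V2"
  proof (rule image_subsetI)
    fix i assume "i \<in> B2"
    obtain a b where i: "i = (a, b)" by fastforce
    with \<open>i \<in> B2\<close> have "(a, b) \<in> B2" by simp
    then have *: "gap a b" "t \<le> a" "lo a b \<le> t" by (auto simp: B2_def)
    have "E \<inter> {t..a} \<subseteq> E \<inter> {lo a b..a}" using *(3) by auto
    then have "E \<inter> {t..a} \<subseteq> S a \<union> S b" using hull_E(1)[OF *(1)] by blast
    from sub[OF *(1) this] show "fst i \<in> ?V2" using * by (auto simp: gap_def i)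
  qed
  then have f2: "finite (fst ` B2)" "card (fst ` B2) \<le> 2 * m"
    using few_points_after[of t "2 * m"] finite_subset card_mono by (blast, meson order_trans)
  have i2: "inj_on fst B2" unfolding B2_def by (auto intro!: inj_onI dest: gap_fst_inj)
  have B2: "finite B2" "card B2 \<le> 2 * m" using f2 finite_imageD[OF f2(1) i2] card_image[OF i2] by auto
  have B3: "finite B3 \<and> card B3 \<le> 1"
  proof (rule finite_if_finite_subsets_card_bdd)
    fix F assume F: "F \<subseteq> B3" "finite F"
    have "i = j" if "i \<in> F" "j \<in> F" for i j
    proof -
      have "i \<in> B3" "j \<in> B3" using F(1) that by auto
      then show ?thesis
        using gap_unique[of "fst i" "snd i" "fst j" "snd j" t] unfolding B3_def by (simp add: case_prod_unfold prod_eq_iff)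
    qed
    then show "card F \<le> 1" using F(2) by (simp add: card_le_Suc0_iff_eq)
  qed
  have cover: "{(a, b). gap a b \<and> t \<in> {lo a b..hi a b}} \<subseteq> B1 \<union> (B2 \<union> B3)"
    unfolding B1_def B2_def B3_def by auto
  have fin: "finite (B1 \<union> (B2 \<union> B3))" using B1 B2 B3 by auto
  have "card (B1 \<union> (B2 \<union> B3)) \<le> 4 * m + 1"
    using card_Un_le[of B1 "B2 \<union> B3"] card_Un_le[of B2 B3] B1(2) B2(2) B3 by linarith
  then show ?thesis using cover fin finite_subset card_mono by (meson order_trans)
qed

lemma h_off:
  assumes "t \<notin> E" "\<And>a b. gap a b \<Longrightarrow> \<not> (a < t \<and> t < b)"
  shows "h t = 0"
proof -
  have van: "poly_deriv m (P a) t = 0" if "a \<in> E" for a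
  proof -
    have "(pderiv ^^ m) (P a) = 0"
      using P_spec(1)[OF that] m by (intro poly_eqI) (auto simp: coeff_higher_pderiv coeff_eq_0)
    then show ?thesis by simp
  qed
  show ?thesis
    using assms(1)
  proof (cases t rule: off_E_cases)
    case (gap a b)
    then show ?thesis using assms(2) by blast
  next
    case (right a)
    then show ?thesis using Qf_right[OF right] van assms(1) by (simp add: h_def Fj_def)
  next
    case (left b)
    then show ?thesis using Qf_left[OF left] van assms(1) by (simp add: h_def Fj_def)
  qed
qed

lemma h_gap:
  assumes gp: "gap a b" and t: "a < t" "t < b"
  shows "\<bar>h t\<bar> \<le> (if P a = P b then 0 else glue_const m * W (lo a b) (hi a b) / (b - a))"
proof -
  have ab: "a \<in> E" "a < b" "t \<notin> E" using gp t by (auto simp: gap_def disjoint_iff)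
  have "(pderiv ^^ m) (P a) = 0"
    using P_spec(1)[OF ab(1)] m by (intro poly_eqI) (auto simp: coeff_higher_pderiv coeff_eq_0)
  then have van: "poly_deriv m (P a) t = 0" by simp
  have ht: "h t = poly_deriv m (H a b) t" using Qf_gap[OF gp t] ab(3) by (simp add: h_def Fj_def)
  have "(b - a) ^ m = (b - a) * (b - a) ^ (m - 1)" using m by (cases m) auto
  then have "glue_const m * W (lo a b) (hi a b) * (b - a) ^ (m - 1) / (b - a) ^ m
      = glue_const m * W (lo a b) (hi a b) / (b - a)"
    using ab(2) by simp
  then show ?thesis using H_close[OF gp order_refl, of t] t van ht by auto
qed

lemma h_measurable: "h \<in> borel_measurable lebesgue"
proof -
  have E: "E \<in> sets lebesgue" using closed_E by (simp add: lebesgue_closedin)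
  have "continuous_on (- E) (Fj m)"
    using Fj_deriv_off_E DERIV_isCont by (intro continuous_at_imp_continuous_on) blast
  then have "(\<lambda>x. indicator (- E) x *\<^sub>R Fj m x) \<in> borel_measurable borel"
    using closed_E by (intro borel_measurable_continuous_on_indicator) auto
  then have 1: "(\<lambda>x. indicator (- E) x *\<^sub>R Fj m x) \<in> borel_measurable lebesgue"
    by (simp add: measurable_completion)
  have 2: "(\<lambda>x. indicator E x *\<^sub>R g x) \<in> borel_measurable lebesgue"
    using g_Lp E unfolding in_Lp_def by (intro borel_measurable_scaleR borel_measurable_indicator) auto
  have "h = (\<lambda>x. indicator (- E) x *\<^sub>R Fj m x + indicator E x *\<^sub>R g x)"
    by (auto simp: h_def indicator_def)
  then show ?thesis using borel_measurable_add[OF 1 2] by simp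
qed

end

section \<open>Summation over the gaps\<close>

text \<open>With X = 2 glue_const m (2 m + 1), the p-th power of the norm is at most 1 + (4 m + 1)
  X^p times that of \<open>G\<close>: 1 for the part on \<open>E\<close>, 4 m + 1 for the overlap.
  This is at most (4 m + 2) (1 + X)^p, and replacing 4 m + 2 by its p-th power makes the root
  independent of p.\<close>

definition ext_const :: "nat \<Rightarrow> real" where
  "ext_const m = real (4 * m + 2) * (1 + 2 * glue_const m * real (2 * m + 1))"

lemma abs_powr_measurable:
  assumes [measurable]: "u \<in> borel_measurable M"
  shows "(\<lambda>t. \<bar>u t\<bar> powr (p::real)) \<in> borel_measurable M"
  by measurable

lemma ennreal_abs_powr_measurable:
  assumes "u \<in> borel_measurable M"
  shows "(\<lambda>t. ennreal (\<bar>u t\<bar> powr (p::real))) \<in> borel_measurable M"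
  by (rule measurable_compose[OF abs_powr_measurable[OF assms] measurable_ennreal])

context whitney_ext
begin

abbreviation pow_p :: "(real \<Rightarrow> real) \<Rightarrow> real \<Rightarrow> ennreal" where
  "pow_p u t \<equiv> ennreal (\<bar>u t\<bar> powr p)"

definition gap_bound :: "real \<times> real \<Rightarrow> real" where
  "gap_bound = (\<lambda>(a, b). if P a = P b then 0 else glue_const m * W (lo a b) (hi a b) / (b - a))"

definition Lp_mass :: "real \<Rightarrow> real \<Rightarrow> real" where
  "Lp_mass c d = (LINT t:{c..d}|lebesgue. \<bar>g t\<bar> powr p)"

lemma Lp_mass_nonneg: "Lp_mass c d \<ge> 0"
  unfolding Lp_mass_def set_lebesgue_integral_def by (intro integral_nonneg_AE AE_I2) simp

text \<open>Hoelder on the hull costs its length to the power p - 1, at most (M \<delta>)^(p-1), and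
  the powers of the gap length \<delta> cancel. M^(p-1) is enlarged to M^p so that the constant is a
  p-th power.\<close>

lemma gap_bound_powr:
  assumes "gap a b"
  shows "(b - a) * gap_bound (a, b) powr p
    \<le> (2 * glue_const m * real (2 * m + 1)) powr p * Lp_mass (lo a b) (hi a b)"
proof (cases "P a = P b")
  case True
  then show ?thesis using Lp_mass_nonneg by (simp add: gap_bound_def)
next
  case False
  define \<delta> where "\<delta> = b - a"
  define M where "M = real (2 * m + 1)"
  have \<delta>: "\<delta> > 0" using assms by (auto simp: gap_def \<delta>_def)
  have M: "M \<ge> 1" by (simp add: M_def)
  have gl: "glue_const m \<ge> 0" by (rule glue_const_nonneg[OF m])
  have len: "lo a b < hi a b" "hi a b - lo a b \<le> M * \<delta>"
    using gap_dichotomy[OF assms] False hull_bounds(3,4)[OF assms] \<delta> by (auto simp: M_def \<delta>_def)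
  let ?W = "W (lo a b) (hi a b)" and ?I = "Lp_mass (lo a b) (hi a b)"
  have Wnn: "?W \<ge> 0" by (rule abs_integral_nonneg)
  have "?W powr p \<le> 2 powr p * (hi a b - lo a b) powr (p - 1) * ?I"
    unfolding Lp_mass_def by (rule abs_integral_powr_le[OF g_Lp p len(1)])
  also have "\<dots> \<le> 2 powr p * (M * \<delta>) powr (p - 1) * ?I"
    using len p Lp_mass_nonneg by (intro mult_right_mono mult_left_mono powr_mono2) auto
  also have "\<dots> = 2 powr p * (M powr (p - 1) * \<delta> powr (p - 1)) * ?I"
    using M \<delta> by (simp add: powr_mult)
  also have "\<dots> \<le> 2 powr p * (M powr p * \<delta> powr (p - 1)) * ?I"
    using M Lp_mass_nonneg by (intro mult_right_mono mult_left_mono powr_mono) auto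
  finally have 1: "?W powr p \<le> 2 powr p * (M powr p * \<delta> powr (p - 1)) * ?I" .
  have "\<delta> * gap_bound (a, b) powr p = \<delta> * (glue_const m powr p * ?W powr p / \<delta> powr p)"
    using False gl Wnn \<delta> by (simp add: gap_bound_def \<delta>_def powr_mult powr_divide)
  also have "\<dots> \<le> \<delta> * (glue_const m powr p * (2 powr p * (M powr p * \<delta> powr (p - 1)) * ?I) / \<delta> powr p)"
    using 1 \<delta> by (intro mult_left_mono divide_right_mono) auto
  also have "\<dots> = (2 powr p * glue_const m powr p * M powr p) * ?I"
    using \<delta> by (simp add: powr_diff)
  also have "2 powr p * glue_const m powr p * M powr p = (2 * glue_const m * M) powr p"
    using gl M by (simp add: powr_mult)
  finally show ?thesis by (simp add: \<delta>_def M_def)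
qed

text \<open>\<open>E\<close> meets a hull in finitely many points, so deleting it does not change
  the integral; the overlap bound is available off \<open>E\<close>.\<close>

lemma Lp_mass_nn_integral:
  assumes "gap a b"
  shows "ennreal (Lp_mass (lo a b) (hi a b))
    = (\<integral>\<^sup>+x. indicator ({lo a b..hi a b} - E) x * pow_p g x \<partial>lebesgue)"
proof -
  let ?J = "{lo a b..hi a b}"
  have gp: "integrable lebesgue (\<lambda>t. \<bar>g t\<bar> powr p)" using g_Lp by (simp add: in_Lp_def)
  have int: "integrable lebesgue (\<lambda>x. indicat_real ?J x *\<^sub>R \<bar>g x\<bar> powr p)"
    by (rule integrable_mult_indicator[OF _ gp]) simp
  have "ennreal (Lp_mass (lo a b) (hi a b)) = (\<integral>\<^sup>+x. ennreal (indicat_real ?J x *\<^sub>R \<bar>g x\<bar> powr p) \<partial>lebesgue)"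
    unfolding Lp_mass_def set_lebesgue_integral_def
    by (rule nn_integral_eq_integral[OF int, symmetric]) simp
  also have "\<dots> = (\<integral>\<^sup>+x. indicator (?J - E) x * pow_p g x \<partial>lebesgue)"
  proof (rule nn_integral_cong_AE)
    have "negligible (E \<inter> ?J)" by (rule negligible_finite[OF hull_E_finite[OF assms]])
    then have "AE x in lebesgue. x \<notin> E \<inter> ?J"
      by (intro AE_not_in) (simp add: negligible_iff_null_sets)
    then show "AE x in lebesgue. ennreal (indicat_real ?J x *\<^sub>R \<bar>g x\<bar> powr p)
        = indicator (?J - E) x * (pow_p g x)"
      by (rule AE_mp) (auto simp: indicator_def)
  qed
  finally show ?thesis .
qed

definition g_mass :: real where "g_mass = (LINT x|lebesgue. \<bar>g x\<bar> powr p)"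

lemma g_mass_nn: "(\<integral>\<^sup>+x. pow_p g x \<partial>lebesgue) = ennreal g_mass" "g_mass \<ge> 0"
  using g_Lp unfolding g_mass_def in_Lp_def
  by (auto intro!: nn_integral_eq_integral integral_nonneg_AE)

lemma E_lebesgue: "E \<in> sets lebesgue"
  using closed_E by (simp add: lebesgue_closedin)

lemma Compl_E_lebesgue: "- E \<in> sets lebesgue"
  using closed_E by (simp add: lebesgue_openin open_Compl)

text \<open>Tonelli for counting measure on the countable set of gaps against Lebesgue measure:
  summing over hulls becomes counting, at each point off \<open>E\<close>, the hulls that contain
  it.\<close>

lemma hulls_mass:
  "(\<integral>\<^sup>+i. ennreal (case i of (a, b) \<Rightarrow> Lp_mass (lo a b) (hi a b)) \<partial>count_space gaps) \<le> ennreal (real (4 * m + 1) * g_mass)"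
proof -
  define J where "J i = {lo (fst i) (snd i)..hi (fst i) (snd i)} - E" for i
  have Jm: "J i \<in> sets lebesgue" for i unfolding J_def using E_lebesgue by auto
  have gm: "(\<lambda>x. (pow_p g x)) \<in> borel_measurable lebesgue"
    using g_Lp unfolding in_Lp_def by (intro ennreal_abs_powr_measurable) blast
  have "(\<integral>\<^sup>+i. ennreal (case i of (a, b) \<Rightarrow> Lp_mass (lo a b) (hi a b)) \<partial>count_space gaps)
      = (\<integral>\<^sup>+i. (\<integral>\<^sup>+x. indicator (J i) x * pow_p g x \<partial>lebesgue) \<partial>count_space gaps)"
  proof (rule nn_integral_cong)
    fix i assume "i \<in> space (count_space gaps)"
    then have "gap (fst i) (snd i)" by (auto simp: gaps_def)
    then show "ennreal (case i of (a, b) \<Rightarrow> Lp_mass (lo a b) (hi a b)) = (\<integral>\<^sup>+x. indicator (J i) x * pow_p g x \<partial>lebesgue)"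
      unfolding J_def case_prod_unfold by (rule Lp_mass_nn_integral)
  qed
  also have "\<dots> = (\<integral>\<^sup>+x. (\<integral>\<^sup>+i. indicator (J i) x * pow_p g x \<partial>count_space gaps) \<partial>lebesgue)"
    by (rule nn_integral_count_space_nn_integral[OF countable_gaps borel_measurable_times_ennreal[OF borel_measurable_indicator[OF Jm] gm], symmetric])
  also have "\<dots> \<le> (\<integral>\<^sup>+x. ennreal (real (4 * m + 1)) * pow_p g x \<partial>lebesgue)"
  proof (rule nn_integral_mono)
    fix x
    let ?A = "{i \<in> gaps. x \<in> J i}"
    have A: "finite ?A" "card ?A \<le> 4 * m + 1"
    proof -
      have "finite ?A \<and> card ?A \<le> 4 * m + 1"
      proof (cases "x \<in> E")
        case True
        then have "?A = {}" by (auto simp: J_def)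
        then show ?thesis by (metis card.empty finite.emptyI zero_le)
      next
        case False
        then have "?A = {(a, b). gap a b \<and> x \<in> {lo a b..hi a b}}" by (auto simp: gaps_def J_def)
        then show ?thesis using hull_overlap[OF False] by simp
      qed
      then show "finite ?A" "card ?A \<le> 4 * m + 1" by auto
    qed
    have "(\<integral>\<^sup>+i. indicator (J i) x * pow_p g x \<partial>count_space gaps)
        = (\<integral>\<^sup>+i. pow_p g x * indicator ?A i \<partial>count_space gaps)"
      by (rule nn_integral_cong) (auto simp: indicator_def)
    also have "\<dots> = pow_p g x * emeasure (count_space gaps) ?A"
      by (rule nn_integral_cmult_indicator) auto
    also have "emeasure (count_space gaps) ?A = of_nat (card ?A)"
      using A by (intro emeasure_count_space_finite) auto
    also have "pow_p g x * of_nat (card ?A) \<le> pow_p g x * ennreal (real (4 * m + 1))"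
      unfolding ennreal_of_nat_eq_real_of_nat using A(2) by (intro mult_left_mono ennreal_leI) simp_all
    finally show "(\<integral>\<^sup>+i. indicator (J i) x * pow_p g x \<partial>count_space gaps)
        \<le> ennreal (real (4 * m + 1)) * (pow_p g x)" by (simp add: mult.commute)
  qed
  also have "\<dots> = ennreal (real (4 * m + 1)) * ennreal g_mass"
    using gm g_mass_nn by (subst nn_integral_cmult) auto
  also have "\<dots> = ennreal (real (4 * m + 1) * g_mass)"
    using g_mass_nn(2) by (intro ennreal_mult[symmetric]) auto
  finally show ?thesis .
qed

text \<open>The mass splits along \<open>E\<close>: there h is g, and elsewhere |h|^p is dominated
  by a sum of constants on the gaps, whose integrals are charged to the hulls.\<close>

lemma h_mass:
  "(\<integral>\<^sup>+t. pow_p h t \<partial>lebesgue) \<le> ennreal (ext_const m powr p * g_mass)"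
proof -
  define X where "X = 2 * glue_const m * real (2 * m + 1)"
  have X: "X \<ge> 0" using glue_const_nonneg[OF m] by (simp add: X_def)
  have hm: "(\<lambda>t. (pow_p h t)) \<in> borel_measurable lebesgue"
    by (rule ennreal_abs_powr_measurable[OF h_measurable])
  have "(\<integral>\<^sup>+t. pow_p h t \<partial>lebesgue)
      = (\<integral>\<^sup>+t. pow_p h t * indicator E t + pow_p h t * indicator (- E) t \<partial>lebesgue)"
    by (rule nn_integral_cong) (auto simp: indicator_def)
  also have "\<dots> = (\<integral>\<^sup>+t. pow_p h t * indicator E t \<partial>lebesgue) + (\<integral>\<^sup>+t. pow_p h t * indicator (- E) t \<partial>lebesgue)"
    using hm E_lebesgue Compl_E_lebesgue by (intro nn_integral_add borel_measurable_times_ennreal borel_measurable_indicator) auto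
  also have "(\<integral>\<^sup>+t. pow_p h t * indicator E t \<partial>lebesgue) \<le> ennreal g_mass"
    unfolding g_mass_nn(1)[symmetric] by (rule nn_integral_mono) (auto simp: indicator_def h_def)
  also have "(\<integral>\<^sup>+t. pow_p h t * indicator (- E) t \<partial>lebesgue)
      \<le> ennreal (X powr p) * ennreal (real (4 * m + 1) * g_mass)"
  proof -
    have "(\<integral>\<^sup>+t. pow_p h t * indicator (- E) t \<partial>lebesgue)
        \<le> (\<integral>\<^sup>+t. (\<integral>\<^sup>+i. ennreal (gap_bound i powr p) * indicator {fst i<..<snd i} t \<partial>count_space gaps) \<partial>lebesgue)"
    proof (rule nn_integral_mono)
      fix t
      show "pow_p h t * indicator (- E) t
          \<le> (\<integral>\<^sup>+i. ennreal (gap_bound i powr p) * indicator {fst i<..<snd i} t \<partial>count_space gaps)"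
      proof (cases "t \<in> E")
        case False
        show ?thesis
        proof (cases "\<exists>a b. gap a b \<and> a < t \<and> t < b")
          case True
          then obtain a b where ab: "gap a b" "a < t" "t < b" by blast
          have "\<bar>h t\<bar> \<le> gap_bound (a, b)" using h_gap[OF ab] by (simp add: gap_bound_def)
          then have "pow_p h t * indicator (- E) t
              \<le> ennreal (gap_bound (a, b) powr p) * indicator {fst (a, b)<..<snd (a, b)} t"
            using ab p False by (auto simp: indicator_def intro!: ennreal_leI powr_mono2)
          also have "\<dots> \<le> (\<integral>\<^sup>+i. ennreal (gap_bound i powr p) * indicator {fst i<..<snd i} t \<partial>count_space gaps)"
            using ab(1) by (intro nn_integral_ge_point) (simp add: gaps_def)
          finally show ?thesis .
        next
          case False
          then have "h t = 0" using h_off[OF \<open>t \<notin> E\<close>] by blast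
          then show ?thesis by simp
        qed
      qed simp
    qed
    also have "\<dots> = (\<integral>\<^sup>+i. (\<integral>\<^sup>+t. ennreal (gap_bound i powr p) * indicator {fst i<..<snd i} t \<partial>lebesgue) \<partial>count_space gaps)"
    proof (rule nn_integral_count_space_nn_integral[OF countable_gaps])
      show "(\<lambda>t. ennreal (gap_bound i powr p) * indicator {fst i<..<snd i} t) \<in> borel_measurable lebesgue" for i
        by (rule borel_measurable_times_ennreal[OF borel_measurable_const borel_measurable_indicator]) simp
    qed
    also have "\<dots> \<le> (\<integral>\<^sup>+i. ennreal (X powr p) * ennreal (case i of (a, b) \<Rightarrow> Lp_mass (lo a b) (hi a b)) \<partial>count_space gaps)"
    proof (rule nn_integral_mono)
      fix i assume "i \<in> space (count_space gaps)"
      then obtain a b where i: "i = (a, b)" "gap a b" by (auto simp: gaps_def)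
      have "a < b" using i(2) by (simp add: gap_def)
      have "(\<integral>\<^sup>+t. ennreal (gap_bound i powr p) * indicator {fst i<..<snd i} t \<partial>lebesgue)
          = ennreal (gap_bound i powr p) * emeasure lebesgue {a<..<b}"
        by (subst nn_integral_cmult_indicator) (auto simp: i)
      also have "\<dots> = ennreal ((b - a) * gap_bound (a, b) powr p)"
        using \<open>a < b\<close> by (simp add: i ennreal_mult'[symmetric] mult.commute)
      also have "\<dots> \<le> ennreal (X powr p * Lp_mass (lo a b) (hi a b))"
        unfolding X_def by (rule ennreal_leI[OF gap_bound_powr[OF i(2)]])
      also have "\<dots> = ennreal (X powr p) * ennreal (case i of (a, b) \<Rightarrow> Lp_mass (lo a b) (hi a b))"
        using Lp_mass_nonneg by (simp add: i ennreal_mult)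
      finally show "(\<integral>\<^sup>+t. ennreal (gap_bound i powr p) * indicator {fst i<..<snd i} t \<partial>lebesgue)
          \<le> ennreal (X powr p) * ennreal (case i of (a, b) \<Rightarrow> Lp_mass (lo a b) (hi a b))" .
    qed
    also have "\<dots> = ennreal (X powr p) * (\<integral>\<^sup>+i. ennreal (case i of (a, b) \<Rightarrow> Lp_mass (lo a b) (hi a b)) \<partial>count_space gaps)"
      by (rule nn_integral_cmult) simp
    also have "\<dots> \<le> ennreal (X powr p) * ennreal (real (4 * m + 1) * g_mass)"
      by (intro mult_left_mono hulls_mass) simp
    finally show ?thesis .
  qed
  also have "ennreal g_mass + ennreal (X powr p) * ennreal (real (4 * m + 1) * g_mass)
      = ennreal (g_mass + X powr p * (real (4 * m + 1) * g_mass))"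
  proof -
    have "real (4 * m + 1) * g_mass \<ge> 0" using g_mass_nn(2) by simp
    then show ?thesis using g_mass_nn(2) by (simp only: ennreal_mult[symmetric] powr_ge_zero ennreal_plus[symmetric] mult_nonneg_nonneg)
  qed
  also have "\<dots> \<le> ennreal (ext_const m powr p * g_mass)"
  proof (rule ennreal_leI)
    have "1 \<le> (1 + X) powr p" using X p by (intro ge_one_powr_ge_zero) auto
    moreover have "X powr p \<le> (1 + X) powr p" using X p by (intro powr_mono2) auto
    then have "X powr p * real (4 * m + 1) \<le> (1 + X) powr p * real (4 * m + 1)" by (intro mult_right_mono) auto
    ultimately have "1 + X powr p * real (4 * m + 1) \<le> real (4 * m + 2) * (1 + X) powr p"
      by (simp add: algebra_simps)
    also have "\<dots> \<le> real (4 * m + 2) powr p * (1 + X) powr p"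
      using powr_mono[of 1 p "real (4 * m + 2)"] p by (intro mult_right_mono) auto
    also have "\<dots> = ext_const m powr p"
      using X unfolding ext_const_def X_def[symmetric] by (subst powr_mult) auto
    finally have "(1 + X powr p * real (4 * m + 1)) * g_mass \<le> ext_const m powr p * g_mass"
      using g_mass_nn(2) by (intro mult_right_mono)
    then show "g_mass + X powr p * (real (4 * m + 1) * g_mass) \<le> ext_const m powr p * g_mass"
      by (simp only: distrib_right mult_1 mult.assoc)
  qed
  finally show ?thesis by (simp add: add_mono)
qed

lemma h_Lp: "in_Lp p h" and h_integral: "(LINT t|lebesgue. \<bar>h t\<bar> powr p) \<le> ext_const m powr p * g_mass"
proof -
  have m': "(\<lambda>t. \<bar>h t\<bar> powr p) \<in> borel_measurable lebesgue" by (rule abs_powr_measurable[OF h_measurable])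
  have int: "integrable lebesgue (\<lambda>t. \<bar>h t\<bar> powr p)"
  proof (rule integrableI_bounded[OF m'])
    have "(\<integral>\<^sup>+t. ennreal (norm (\<bar>h t\<bar> powr p)) \<partial>lebesgue) \<le> ennreal (ext_const m powr p * g_mass)"
      using h_mass by simp
    also have "\<dots> < \<infinity>" by simp
    finally show "(\<integral>\<^sup>+t. ennreal (norm (\<bar>h t\<bar> powr p)) \<partial>lebesgue) < \<infinity>" .
  qed
  then show "in_Lp p h" using h_measurable by (simp add: in_Lp_def)
  have "ennreal (LINT t|lebesgue. \<bar>h t\<bar> powr p) \<le> ennreal (ext_const m powr p * g_mass)"
    using h_mass nn_integral_eq_integral[OF int] by simp
  then show "(LINT t|lebesgue. \<bar>h t\<bar> powr p) \<le> ext_const m powr p * g_mass"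
    using g_mass_nn(2) by (simp add: ennreal_le_iff)
qed

end

section \<open>Absolute continuity and identification of the m-th derivative\<close>

lemma in_Lp_max:
  assumes "in_Lp p u" "in_Lp p v"
  shows "in_Lp p (\<lambda>t. max \<bar>u t\<bar> \<bar>v t\<bar>)"
proof -
  have m: "u \<in> borel_measurable lebesgue" "v \<in> borel_measurable lebesgue"
    and i: "integrable lebesgue (\<lambda>t. \<bar>u t\<bar> powr p)" "integrable lebesgue (\<lambda>t. \<bar>v t\<bar> powr p)"
    using assms by (auto simp: in_Lp_def)
  have mm: "(\<lambda>t. max \<bar>u t\<bar> \<bar>v t\<bar>) \<in> borel_measurable lebesgue"
    using m by (intro borel_measurable_max borel_measurable_abs)
  have "integrable lebesgue (\<lambda>t. \<bar>max \<bar>u t\<bar> \<bar>v t\<bar>\<bar> powr p)"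
  proof (rule Bochner_Integration.integrable_bound[OF Bochner_Integration.integrable_add[OF i]])
    show "(\<lambda>t. \<bar>max \<bar>u t\<bar> \<bar>v t\<bar>\<bar> powr p) \<in> borel_measurable lebesgue" by (rule abs_powr_measurable[OF mm])
    show "AE t in lebesgue. norm (\<bar>max \<bar>u t\<bar> \<bar>v t\<bar>\<bar> powr p) \<le> norm (\<bar>u t\<bar> powr p + \<bar>v t\<bar> powr p)"
      by (intro AE_I2) (simp add: max_def)
  qed
  then show ?thesis using mm by (simp add: in_Lp_def)
qed

lemma abs_integral_mono_fun:
  assumes "in_Lp p u" "in_Lp p v" "p > 1" "\<And>t. \<bar>u t\<bar> \<le> \<bar>v t\<bar>"
  shows "abs_integral u c d \<le> abs_integral v c d"
  by (rule set_integral_mono) (use assms in_Lp_set_integrable set_integrable_abs in blast)+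

lemma abs_integral_combine:
  assumes L: "in_Lp p u" "p > 1" and "a \<le> b" "b \<le> c"
  shows "abs_integral u a b + abs_integral u b c = abs_integral u a c"
proof -
  have eq: "abs_integral u c d = integral {c..d} (\<lambda>t. \<bar>u t\<bar>)" and int: "(\<lambda>t. \<bar>u t\<bar>) integrable_on {c..d}" for c d
    using set_lebesgue_integral_eq_integral[OF set_integrable_abs[OF in_Lp_set_integrable[OF L]], of c d] by auto
  show ?thesis unfolding eq by (rule Henstock_Kurzweil_Integration.integral_combine[OF assms(3,4) int])
qed

lemma borel_measurable_negligible_modification:
  fixes u v :: "real \<Rightarrow> real"
  assumes v: "v \<in> borel_measurable lebesgue" and N: "negligible N" and eq: "\<And>t. t \<notin> N \<Longrightarrow> u t = v t"
  shows "u \<in> borel_measurable lebesgue"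
proof (rule borel_measurableI)
  fix A :: "real set" assume "open A"
  then have "v -` A \<inter> space lebesgue \<in> sets lebesgue" using v by (intro measurable_sets) auto
  then have 1: "v -` A - N \<in> sets lebesgue" using negligible_imp_sets[OF N] by auto
  have "negligible (u -` A \<inter> N)" by (rule negligible_subset[OF N]) blast
  then have 2: "u -` A \<inter> N \<in> sets lebesgue" by (rule negligible_imp_sets)
  have "u -` A \<inter> space lebesgue = (v -` A - N) \<union> (u -` A \<inter> N)" using eq by auto
  then show "u -` A \<inter> space lebesgue \<in> sets lebesgue" using sets.Un[OF 1 2] by simp
qed

lemma negligible_countable_set:
  fixes A :: "real set"
  assumes "countable A"
  shows "negligible A"
  using countable_imp_null_set_lborel[OF assms] null_sets_completionI negligible_iff_null_sets by blast

context whitney_ext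
begin

text \<open>A common majorant: increments of \<open>Fj (m - 1)\<close> between limit points are
  those of \<open>D (m - 1)\<close> and are controlled by g, over stretches free of limit points by
  h. Absolute continuity can thus be proved before the m-th derivative is identified.\<close>

definition k :: "real \<Rightarrow> real" where "k t = max \<bar>h t\<bar> \<bar>g t\<bar>"

lemma k_Lp: "in_Lp p k"
  unfolding k_def by (rule in_Lp_max[OF h_Lp g_Lp])

text \<open>Without limit points the compact interval meets \<open>E\<close> in finitely many
  points, and the fundamental theorem tolerates a finite exceptional set.\<close>

lemma increment_compact:
  assumes "x \<le> y" "\<And>z. z \<in> {x..y} \<Longrightarrow> \<not> z islimpt E"
  shows "\<bar>Fj (m - 1) y - Fj (m - 1) x\<bar> \<le> abs_integral k x y"
proof -
  have fin: "finite ({x..y} \<inter> E)" by (rule finite_not_islimpt_in_compact[OF compact_Icc assms(2)])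
  have "(Fj m has_integral Fj (m - 1) y - Fj (m - 1) x) {x..y}"
  proof (rule fundamental_theorem_of_calculus_strong[OF fin assms(1)])
    show "continuous_on {x..y} (Fj (m - 1))"
      using Fj_isCont[of "m - 1"] m by (intro continuous_at_imp_continuous_on) auto
  next
    fix t assume "t \<in> {x..y} - {x..y} \<inter> E"
    then have "(Fj (m - 1) has_real_derivative Fj (Suc (m - 1)) t) (at t)" by (intro Fj_deriv_off_E) blast
    then show "(Fj (m - 1) has_vector_derivative Fj m t) (at t)"
      using m by (simp add: has_real_derivative_iff_has_vector_derivative)
  qed
  then have "(h has_integral Fj (m - 1) y - Fj (m - 1) x) {x..y}"
    by (rule has_integral_spike_finite[OF fin, rotated]) (auto simp: h_def)
  moreover have si: "set_integrable lebesgue {x..y} h" by (rule in_Lp_set_integrable[OF h_Lp p])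
  ultimately have "Fj (m - 1) y - Fj (m - 1) x = (LINT t:{x..y}|lebesgue. h t)"
    using has_integral_set_lebesgue[OF si] has_integral_unique by blast
  then have "\<bar>Fj (m - 1) y - Fj (m - 1) x\<bar> \<le> abs_integral h x y"
    using set_integral_norm_bound[OF si] by simp
  also have "\<dots> \<le> abs_integral k x y"
    by (rule abs_integral_mono_fun[OF h_Lp k_Lp p]) (simp add: k_def)
  finally show ?thesis .
qed

text \<open>Limit points at the two ends are avoided by shrinking the interval; continuity of
  \<open>Fj (m - 1)\<close> restores the ends in the limit.\<close>

lemma increment_open:
  assumes "x \<le> y" "\<And>z. x < z \<Longrightarrow> z < y \<Longrightarrow> \<not> z islimpt E"
  shows "\<bar>Fj (m - 1) y - Fj (m - 1) x\<bar> \<le> abs_integral k x y"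
proof (cases "x = y")
  case True
  then show ?thesis using abs_integral_nonneg[where g = k and c = x and d = y] by simp
next
  case False
  then have "x < y" using assms(1) by simp
  define q where "q s = \<bar>Fj (m - 1) (y - s) - Fj (m - 1) (x + s)\<bar>" for s
  have c: "isCont (Fj (m - 1)) t" for t using Fj_isCont[of "m - 1"] m by simp
  have "isCont q 0" unfolding q_def
    by (intro continuous_intros isCont_o2[OF _ c])
  then have "(q \<longlongrightarrow> q 0) (at_right 0)"
    unfolding isCont_def by (rule tendsto_within_subset) simp
  moreover have "eventually (\<lambda>s. q s \<le> abs_integral k x y) (at_right 0)"
  proof -
    have "eventually (\<lambda>s. s \<in> {0<..<(y - x) / 2}) (at_right 0)"
      using \<open>x < y\<close> by (intro eventually_at_right_real) simp
    then show ?thesis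
    proof (rule eventually_mono)
      fix s assume s: "s \<in> {0<..<(y - x) / 2}"
      have "q s \<le> abs_integral k (x + s) (y - s)"
        unfolding q_def using s by (intro increment_compact assms(2)) auto
      also have "\<dots> \<le> abs_integral k x y" using s by (intro abs_integral_mono[OF k_Lp p]) auto
      finally show "q s \<le> abs_integral k x y" .
    qed
  qed
  ultimately have "q 0 \<le> abs_integral k x y"
    by (rule tendsto_upperbound) simp
  then show ?thesis by (simp add: q_def)
qed

text \<open>Cut at the first and the last limit point u and v in [x, y]. In the middle only the
  values at u and v matter, and they are those of \<open>D (m - 1)\<close>, whatever
  \<open>E\<close> looks like in between.\<close>

lemma increment:
  assumes "x \<le> y"
  shows "\<bar>Fj (m - 1) y - Fj (m - 1) x\<bar> \<le> abs_integral k x y"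
proof -
  let ?Z = "{z. z islimpt E} \<inter> {x..y}"
  have m1: "m - 1 < m" using m by simp
  show ?thesis
  proof (cases "?Z = {}")
    case True
    then show ?thesis using assms by (intro increment_open) auto
  next
    case False
    have cl: "closed ?Z" by (intro closed_Int closed_limpts closed_atLeastAtMost)
    have bd: "bdd_below ?Z" "bdd_above ?Z" by auto
    define u where "u = Inf ?Z"
    define v where "v = Sup ?Z"
    have u: "u \<in> ?Z" "\<And>z. z \<in> ?Z \<Longrightarrow> u \<le> z" unfolding u_def
      using closed_contains_Inf[OF False bd(1) cl] cInf_lower[OF _ bd(1)] by auto
    have v: "v \<in> ?Z" "\<And>z. z \<in> ?Z \<Longrightarrow> z \<le> v" unfolding v_def
      using closed_contains_Sup[OF False bd(2) cl] cSup_upper[OF _ bd(2)] by auto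
    have ord: "x \<le> u" "u \<le> v" "v \<le> y" using u v by auto
    have "\<not> z islimpt E" if "x < z" "z < u" for z
      using u(2)[of z] that ord by auto
    then have 1: "\<bar>Fj (m - 1) u - Fj (m - 1) x\<bar> \<le> abs_integral k x u" by (intro increment_open ord)
    have "\<not> z islimpt E" if "v < z" "z < y" for z
      using v(2)[of z] that ord by auto
    then have 2: "\<bar>Fj (m - 1) y - Fj (m - 1) v\<bar> \<le> abs_integral k v y" by (intro increment_open ord)
    have "\<bar>Fj (m - 1) v - Fj (m - 1) u\<bar> \<le> W u v"
      using D_increment[OF ord(2)] Fj_limit_point[OF _ m1] u(1) v(1) by simp
    also have "\<dots> \<le> abs_integral k u v"
      by (rule abs_integral_mono_fun[OF g_Lp k_Lp p]) (simp add: k_def)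
    finally have 3: "\<bar>Fj (m - 1) v - Fj (m - 1) u\<bar> \<le> abs_integral k u v" .
    have "abs_integral k x u + abs_integral k u v = abs_integral k x v"
      "abs_integral k x v + abs_integral k v y = abs_integral k x y"
      using ord by (intro abs_integral_combine[OF k_Lp p]; simp)+
    then show ?thesis using 1 2 3 by linarith
  qed
qed

lemma Fj_ac: "abs_continuous_on a b (Fj (m - 1))"
  by (rule abs_continuous_if_increments_le[OF k_Lp p increment])

text \<open>Almost every point of \<open>E\<close> is an accumulation point of limit points of \<open>E\<close>, where \<open>Fj (m - 1)\<close>
  and \<open>D (m - 1)\<close> coincide; so their derivatives, where both exist, coincide there as well.\<close>
lemma deriv_Fj_ae:
  obtains N where "negligible N" "\<And>t. t \<notin> N \<Longrightarrow> deriv (Fj (m - 1)) t = h t"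
proof
  let ?Z = "{z. z islimpt E}"
  let ?N = "{t. \<not> Fj (m - 1) differentiable at t} \<union> ({t. \<not> D (m - 1) differentiable at t} \<union>
    ({t \<in> E. \<not> t islimpt E} \<union> {t \<in> ?Z. \<not> t islimpt ?Z}))"
  show "negligible ?N"
  proof (intro negligible_Un)
    show "negligible {t. \<not> Fj (m - 1) differentiable at t}" by (rule abs_continuous_differentiable_ae[OF Fj_ac])
    show "negligible {t. \<not> D (m - 1) differentiable at t}" by (rule abs_continuous_differentiable_ae[OF D_ac])
    show "negligible {t \<in> E. \<not> t islimpt E}" "negligible {t \<in> ?Z. \<not> t islimpt ?Z}"
      by (rule negligible_countable_set[OF countable_isolated_points])+
  qed
  fix t assume t: "t \<notin> ?N"
  show "deriv (Fj (m - 1)) t = h t"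
  proof (cases "t \<in> E")
    case False
    have "(Fj (m - 1) has_real_derivative Fj (Suc (m - 1)) t) (at t)" by (rule Fj_deriv_off_E[OF False])
    then show ?thesis using False m by (simp add: DERIV_imp_deriv h_def)
  next
    case True
    then have tZ: "t islimpt E" "t islimpt ?Z" using t by auto
    have m1: "m - 1 < m" using m by simp
    have dF: "(Fj (m - 1) has_real_derivative deriv (Fj (m - 1)) t) (at t)"
      and dD: "(D (m - 1) has_real_derivative deriv (D (m - 1)) t) (at t)"
      using t by (simp_all add: DERIV_deriv_iff_real_differentiable)
    define \<phi> where "\<phi> s = Fj (m - 1) s - D (m - 1) s" for s
    define d where "d = deriv (Fj (m - 1)) t - deriv (D (m - 1)) t"
    have "(\<phi> has_real_derivative d) (at t)" unfolding \<phi>_def d_def by (rule DERIV_diff[OF dF dD])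
    then have lim: "((\<lambda>s. (\<phi> s - \<phi> t) / (s - t)) \<longlongrightarrow> d) (at t)" by (simp add: has_field_derivative_iff)
    have zero: "\<phi> s = 0" if "s islimpt E" for s using Fj_limit_point[OF that m1] by (simp add: \<phi>_def)
    have "d = 0"
    proof (rule ccontr)
      assume "d \<noteq> 0"
      with lim have "eventually (\<lambda>s. (\<phi> s - \<phi> t) / (s - t) \<noteq> 0) (at t)" by (rule tendsto_imp_eventually_ne)
      then obtain r where r: "r > 0" "\<And>s. s \<noteq> t \<Longrightarrow> dist s t < r \<Longrightarrow> (\<phi> s - \<phi> t) / (s - t) \<noteq> 0"
        unfolding eventually_at by blast
      obtain s where "s \<in> ?Z" "s \<noteq> t" "dist s t < r"
        using tZ(2) r(1) unfolding islimpt_approachable by blast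
      then show False using r(2)[of s] zero[of s] zero[OF tZ(1)] by simp
    qed
    then show ?thesis using True by (simp add: d_def h_def g_deriv)
  qed
qed

lemma deriv_funpow_Ext: "i < m \<Longrightarrow> (deriv ^^ i) (Ext m E nc f) = Fj i"
proof (induction i)
  case 0
  then show ?case by (simp add: Ext_eq)
next
  case (Suc i)
  then have "(deriv ^^ Suc i) (Ext m E nc f) = deriv (Fj i)" by simp
  also have "\<dots> = Fj (Suc i)" using Fj_deriv[OF Suc.prems] DERIV_imp_deriv by blast
  finally show ?case .
qed

lemma deriv_funpow_Ext_m: "(deriv ^^ m) (Ext m E nc f) = deriv (Fj (m - 1))"
proof -
  have "(deriv ^^ m) (Ext m E nc f) = deriv ((deriv ^^ (m - 1)) (Ext m E nc f))" using m by (cases m) auto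
  then show ?thesis using deriv_funpow_Ext[of "m - 1"] m by simp
qed

text \<open>\<open>deriv (Fj (m - 1))\<close> agrees with h off a null set, so measurability,
  integrability and the norm bound are transferred from h.\<close>

lemma Ext_sobolev: "Ext m E nc f \<in> sobolev m p"
  and Ext_norm: "sobolev_norm m p (Ext m E nc f) \<le> ext_const m * sobolev_norm m p G"
proof -
  let ?u = "deriv (Fj (m - 1))"
  obtain N where N: "negligible N" "\<And>t. t \<notin> N \<Longrightarrow> ?u t = h t" using deriv_Fj_ae by metis
  have um: "?u \<in> borel_measurable lebesgue"
    by (rule borel_measurable_negligible_modification[OF h_measurable N])
  have ae: "AE t in lebesgue. \<bar>h t\<bar> powr p = \<bar>?u t\<bar> powr p"
  proof -
    have "AE t in lebesgue. t \<notin> N" using N(1) by (intro AE_not_in) (simp add: negligible_iff_null_sets)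
    then show ?thesis by (rule AE_mp) (use N(2) in auto)
  qed
  have mh: "(\<lambda>t. \<bar>h t\<bar> powr p) \<in> borel_measurable lebesgue" and mu: "(\<lambda>t. \<bar>?u t\<bar> powr p) \<in> borel_measurable lebesgue"
    by (rule abs_powr_measurable[OF h_measurable], rule abs_powr_measurable[OF um])
  have "integrable lebesgue (\<lambda>t. \<bar>?u t\<bar> powr p)"
    using h_Lp integrable_cong_AE[OF mh mu ae] by (simp add: in_Lp_def)
  then have uL: "in_Lp p ?u" using um by (simp add: in_Lp_def)
  show "Ext m E nc f \<in> sobolev m p"
    unfolding sobolev_def
  proof (intro CollectI conjI allI impI)
    fix i x assume "i < m - 1"
    then have i: "Suc i < m" "i < m" by auto
    show "(deriv ^^ i) (Ext m E nc f) field_differentiable at x"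
      unfolding deriv_funpow_Ext[OF i(2)] using Fj_deriv[OF i(1)] field_differentiable_def by blast
  next
    fix a b
    have "m - 1 < m" using m by simp
    then show "abs_continuous_on a b ((deriv ^^ (m - 1)) (Ext m E nc f))"
      unfolding deriv_funpow_Ext[OF \<open>m - 1 < m\<close>] by (intro Fj_ac)
  next
    show "in_Lp p ((deriv ^^ m) (Ext m E nc f))" unfolding deriv_funpow_Ext_m by (rule uL)
  qed
  have "(LINT t|lebesgue. \<bar>?u t\<bar> powr p) = (LINT t|lebesgue. \<bar>h t\<bar> powr p)"
    by (rule integral_cong_AE[OF mh mu ae, symmetric])
  then have le: "(LINT t|lebesgue. \<bar>?u t\<bar> powr p) \<le> ext_const m powr p * g_mass" using h_integral by simp
  have Cnn: "ext_const m \<ge> 0" using glue_const_nonneg[OF m] by (simp add: ext_const_def)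
  have "(LINT t|lebesgue. \<bar>?u t\<bar> powr p) powr (1 / p) \<le> (ext_const m powr p * g_mass) powr (1 / p)"
    using le p by (intro powr_mono2 integral_nonneg_AE AE_I2) auto
  also have "\<dots> = ext_const m * g_mass powr (1 / p)"
    using Cnn g_mass_nn(2) p by (simp add: powr_mult powr_powr)
  finally show "sobolev_norm m p (Ext m E nc f) \<le> ext_const m * sobolev_norm m p G"
    unfolding sobolev_norm_def Lp_norm_def deriv_funpow_Ext_m g_mass_def g_def .
qed

lemma Ext_extends: "x \<in> E \<Longrightarrow> Ext m E nc f x = f x"
  unfolding Ext_def by (simp add: P_self)

end

section \<open>Linearity and the trace norm\<close>

context whitney
begin

lemma trace_whitney_ext:
  assumes "p > 1" "f \<in> trace_space m p E"
  obtains G where "whitney_ext m E nc p f G"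
proof -
  obtain G where "G \<in> sobolev m p" "\<forall>x\<in>E. G x = f x" using assms(2) by (auto simp: trace_space_def)
  then have "whitney_ext m E nc p f G" using assms(1) by unfold_locales auto
  then show thesis by (rule that)
qed

lemma S_nonempty_finite: "x \<in> E \<Longrightarrow> finite (S x) \<and> S x \<noteq> {} \<and> card (S x) \<le> m"
  using S_basic[of x] by blast

lemma shrinking_sets_nonempty:
  "eventually (\<lambda>A. A \<subseteq> E \<and> finite A \<and> A \<noteq> {}) (shrinking_sets m E z)"
  using eventually_shrinking_sets[OF zero_less_one, of E m z] by eventually_elim (use m in auto)

text \<open>\<open>Lim\<close> respects linear combinations when the limits exist; membership in the
  trace space supplies an extension of each function and with it both limits.\<close>

lemma limit_deriv_lincomb:
  assumes "p > 1" "f \<in> trace_space m p E" "g \<in> trace_space m p E" "z islimpt E" "i < m"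
  shows "limit_deriv m E (\<lambda>x. \<alpha> * f x + \<beta> * g x) i z = \<alpha> * limit_deriv m E f i z + \<beta> * limit_deriv m E g i z"
proof -
  obtain G where "whitney_ext m E nc p f G" using trace_whitney_ext[OF assms(1,2)] by metis
  then interpret f: whitney_ext m E nc p f G .
  obtain G' where "whitney_ext m E nc p g G'" using trace_whitney_ext[OF assms(1,3)] by metis
  then interpret g: whitney_ext m E nc p g G' .
  have "((\<lambda>A. \<alpha> * poly_deriv i (lagrange_poly A f) z + \<beta> * poly_deriv i (lagrange_poly A g) z)
      \<longlongrightarrow> \<alpha> * f.D i z + \<beta> * g.D i z) (shrinking_sets m E z)"
    by (intro tendsto_intros f.lagrange_limit g.lagrange_limit assms(4,5))
  moreover have "eventually (\<lambda>A. \<alpha> * poly_deriv i (lagrange_poly A f) z + \<beta> * poly_deriv i (lagrange_poly A g) z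
      = poly_deriv i (lagrange_poly A (\<lambda>x. \<alpha> * f x + \<beta> * g x)) z) (shrinking_sets m E z)"
    using shrinking_sets_nonempty
    by eventually_elim (simp add: lagrange_poly_lincomb higher_pderiv_add higher_pderiv_smult)
  ultimately have "((\<lambda>A. poly_deriv i (lagrange_poly A (\<lambda>x. \<alpha> * f x + \<beta> * g x)) z)
      \<longlongrightarrow> \<alpha> * f.D i z + \<beta> * g.D i z) (shrinking_sets m E z)"
    by (rule Lim_transform_eventually)
  then show ?thesis
    unfolding f.limit_deriv_eq[OF assms(4,5)] g.limit_deriv_eq[OF assms(4,5)]
    unfolding limit_deriv_def by (rule tendsto_Lim[OF shrinking_sets_nontrivial[OF assms(4)]])
qed

lemma P_poly_lincomb:
  assumes p: "p > 1" and f: "f \<in> trace_space m p E" and g: "g \<in> trace_space m p E" and x: "x \<in> E"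
  shows "P_poly m E nc (\<lambda>x. \<alpha> * f x + \<beta> * g x) x = smult \<alpha> (P_poly m E nc f x) + smult \<beta> (P_poly m E nc g x)"
proof (cases "card (S x) = m")
  case True
  then show ?thesis
    using S_nonempty_finite[OF x] by (simp add: P_poly_def Let_def lagrange_poly_lincomb)
next
  case False
  obtain G where "whitney_ext m E nc p f G" using trace_whitney_ext[OF p f] by metis
  then interpret f: whitney_ext m E nc p f G .
  obtain G' where "whitney_ext m E nc p g G'" using trace_whitney_ext[OF p g] by metis
  then interpret g: whitney_ext m E nc p g G' .
  have z: "sp x islimpt E" by (rule small_S_limit[OF x False])
  let ?F = "\<lambda>x. \<alpha> * f x + \<beta> * g x"
  let ?Q = "smult \<alpha> (f.P x) + smult \<beta> (g.P x)"
  have lim: "limit_deriv m E ?F i (sp x) = \<alpha> * f.D i (sp x) + \<beta> * g.D i (sp x)" if "i \<in> {1..m - card (S x)}" for i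
  proof -
    have "card (S x) > 0" using S_nonempty_finite[OF x] by (simp add: card_gt_0_iff)
    then have "i < m" using that m by auto
    then show ?thesis
      using limit_deriv_lincomb[OF p f g z] f.limit_deriv_eq[OF z] g.limit_deriv_eq[OF z] by simp
  qed
  have "P_poly m E nc ?F x = (THE P. degree P \<le> m - 1 \<and> (\<forall>y\<in>S x. poly P y = ?F y) \<and>
      (\<forall>i\<in>{1..m - card (S x)}. poly_deriv i P (sp x) = limit_deriv m E ?F i (sp x)))"
    using False by (simp add: P_poly_def Let_def)
  also have "\<dots> = ?Q"
  proof (rule the_equality)
    have "degree ?Q \<le> m - 1"
      using f.P_spec(1)[OF x] g.P_spec(1)[OF x]
      by (intro degree_add_le order_trans[OF degree_smult_le])
    then show Q: "degree ?Q \<le> m - 1 \<and> (\<forall>y\<in>S x. poly ?Q y = ?F y) \<and>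
      (\<forall>i\<in>{1..m - card (S x)}. poly_deriv i ?Q (sp x) = limit_deriv m E ?F i (sp x))"
      using f.P_spec(2,3)[OF x] g.P_spec(2,3)[OF x] lim
      by (simp add: higher_pderiv_add higher_pderiv_smult)
    show "R = ?Q" if "degree R \<le> m - 1 \<and> (\<forall>y\<in>S x. poly R y = ?F y) \<and>
      (\<forall>i\<in>{1..m - card (S x)}. poly_deriv i R (sp x) = limit_deriv m E ?F i (sp x))" for R
      by (rule hermite_unique[OF S_basic(1)[OF x] S_basic(4)[OF x] S_basic(5)[OF x]])
         (use that Q in auto)
  qed
  finally show ?thesis .
qed

text \<open>Functions on \<open>E\<close> are represented by total functions, and the construction
  reads no value off \<open>E\<close>: even the limits run over subsets of \<open>E\<close>.\<close>

lemma P_poly_cong: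
  assumes "x \<in> E" "\<And>y. y \<in> E \<Longrightarrow> f y = g y"
  shows "P_poly m E nc f x = P_poly m E nc g x"
proof -
  have L: "lagrange_poly A f = lagrange_poly A g" if "A \<subseteq> E" for A
  proof -
    have "(\<forall>y\<in>A. poly P y = f y) \<longleftrightarrow> (\<forall>y\<in>A. poly P y = g y)" for P
      using that assms(2) by (metis subsetD)
    then show ?thesis unfolding lagrange_poly_def by simp
  qed
  have lim: "limit_deriv m E f i z = limit_deriv m E g i z" for i z
  proof -
    have "eventually (\<lambda>A. poly_deriv i (lagrange_poly A f) z = poly_deriv i (lagrange_poly A g) z) (shrinking_sets m E z)"
      using shrinking_sets_nonempty by eventually_elim (simp add: L)
    then show ?thesis unfolding limit_deriv_def t2_space_class.Lim_def by (simp cong: tendsto_cong)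
  qed
  have S: "S x \<subseteq> E" by (rule S_basic(2)[OF assms(1)])
  have "(\<forall>y\<in>S x. poly P y = f y) \<longleftrightarrow> (\<forall>y\<in>S x. poly P y = g y)" for P
    using S assms(2) by (metis subsetD)
  then show ?thesis unfolding P_poly_def Let_def lim L[OF S] by simp
qed

lemma Ext_cong:
  assumes p: "p > 1" and f: "f \<in> trace_space m p E" and eq: "\<And>x. x \<in> E \<Longrightarrow> f x = g x"
  shows "Ext m E nc f = Ext m E nc g"
proof
  fix t
  obtain G where "whitney_ext m E nc p f G" using trace_whitney_ext[OF p f] by metis
  then interpret f: whitney_ext m E nc p f G .
  have P: "P_poly m E nc f x = P_poly m E nc g x" if "x \<in> E" for x by (rule P_poly_cong[OF that eq])
  show "Ext m E nc f t = Ext m E nc g t"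
  proof (cases "t \<in> E")
    case True
    then show ?thesis by (simp add: Ext_def P)
  next
    case False
    then show ?thesis
    proof (cases t rule: f.off_E_cases)
      case (gap a b)
      have "a \<in> E" "b \<in> E" "a < b" using gap(1) by (auto simp: f.gap_def)
      then show ?thesis using f.component_gap[OF gap] by (simp add: Ext_def H_poly_def P)
    next
      case (right a)
      then show ?thesis using f.component_right[OF right] by (simp add: Ext_def H_poly_right P)
    next
      case (left b)
      then show ?thesis using f.component_left[OF left] by (simp add: Ext_def H_poly_left P)
    qed
  qed
qed

text \<open>The gluing problem is linear in its data and uniquely solvable, so on a gap the
  combination of the two gluing polynomials is the gluing polynomial of the combination.\<close>

lemma Ext_lincomb:
  assumes p: "p > 1" and f: "f \<in> trace_space m p E" and g: "g \<in> trace_space m p E"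
  shows "Ext m E nc (\<lambda>x. \<alpha> * f x + \<beta> * g x) = (\<lambda>x. \<alpha> * Ext m E nc f x + \<beta> * Ext m E nc g x)"
proof
  fix t
  obtain G where "whitney_ext m E nc p f G" using trace_whitney_ext[OF p f] by metis
  then interpret f: whitney_ext m E nc p f G .
  obtain G' where "whitney_ext m E nc p g G'" using trace_whitney_ext[OF p g] by metis
  then interpret g: whitney_ext m E nc p g G' .
  let ?F = "\<lambda>x. \<alpha> * f x + \<beta> * g x"
  have P: "P_poly m E nc ?F x = smult \<alpha> (f.P x) + smult \<beta> (g.P x)" if "x \<in> E" for x
    by (rule P_poly_lincomb[OF p f g that])
  show "Ext m E nc ?F t = \<alpha> * Ext m E nc f t + \<beta> * Ext m E nc g t"
  proof (cases "t \<in> E")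
    case True
    then show ?thesis by (simp add: Ext_def P)
  next
    case False
    then show ?thesis
    proof (cases t rule: f.off_E_cases)
      case (gap a b)
      have ab: "a \<in> E" "b \<in> E" "a < b" using gap(1) by (auto simp: f.gap_def)
      have gap': "g.gap a b" using gap(1) by (simp add: f.gap_def g.gap_def)
      let ?Q = "smult \<alpha> (f.H a b) + smult \<beta> (g.H a b)"
      have "H_poly m (P_poly m E nc ?F) {a<..<b} = (THE H. degree H \<le> 2 * m - 1 \<and>
           (\<forall>i<m. poly_deriv i H a = poly_deriv i (P_poly m E nc ?F a) a \<and>
                  poly_deriv i H b = poly_deriv i (P_poly m E nc ?F b) b))"
        using ab(3) by (simp add: H_poly_def)
      also have "\<dots> = ?Q"
      proof (rule the_equality)
        have "degree ?Q \<le> 2 * m - 1"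
          using f.H_spec(4)[OF gap(1)] g.H_spec(4)[OF gap']
          by (intro degree_add_le order_trans[OF degree_smult_le])
        then show Q: "degree ?Q \<le> 2 * m - 1 \<and>
           (\<forall>i<m. poly_deriv i ?Q a = poly_deriv i (P_poly m E nc ?F a) a \<and>
                  poly_deriv i ?Q b = poly_deriv i (P_poly m E nc ?F b) b)"
          using f.H_spec(1,2)[OF gap(1)] g.H_spec(1,2)[OF gap']
          by (simp add: P[OF ab(1)] P[OF ab(2)] higher_pderiv_add higher_pderiv_smult)
        show "R = ?Q" if "degree R \<le> 2 * m - 1 \<and>
           (\<forall>i<m. poly_deriv i R a = poly_deriv i (P_poly m E nc ?F a) a \<and>
                  poly_deriv i R b = poly_deriv i (P_poly m E nc ?F b) b)" for R
          by (rule two_point_hermite_unique[OF m _ _ ab(3)]) (use that Q in auto)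
      qed
      finally show ?thesis using f.component_gap[OF gap] by (simp add: Ext_def)
    next
      case (right a)
      then show ?thesis using f.component_right[OF right] by (simp add: Ext_def H_poly_right P)
    next
      case (left b)
      then show ?thesis using f.component_left[OF left] by (simp add: Ext_def H_poly_left P)
    qed
  qed
qed

text \<open>\<open>ext_const m\<close> does not involve the extension, so the bound for every
  competitor passes to the infimum after division by this positive constant.\<close>

lemma Ext_trace_norm:
  assumes p: "p > 1" and f: "f \<in> trace_space m p E"
  shows "sobolev_norm m p (Ext m E nc f) \<le> ext_const m * trace_norm m p E f"
proof -
  let ?N = "{sobolev_norm m p F | F. F \<in> sobolev m p \<and> (\<forall>x\<in>E. F x = f x)}"
  have C: "ext_const m > 0"
    using glue_const_nonneg[OF m] unfolding ext_const_def by (intro mult_pos_pos add_pos_nonneg) auto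
  have "sobolev_norm m p (Ext m E nc f) / ext_const m \<le> Inf ?N"
  proof (rule cInf_greatest)
    show "?N \<noteq> {}" using f unfolding trace_space_def by blast
    fix r assume "r \<in> ?N"
    then obtain G where G: "r = sobolev_norm m p G" "G \<in> sobolev m p" "\<forall>x\<in>E. G x = f x" by blast
    then interpret f: whitney_ext m E nc p f G using p by unfold_locales auto
    show "sobolev_norm m p (Ext m E nc f) / ext_const m \<le> r"
      using f.Ext_norm C by (simp add: G(1) pos_divide_le_eq mult.commute)
  qed
  then show ?thesis using C by (simp add: trace_norm_def pos_divide_le_eq mult.commute)
qed

end

text \<open>The constant is quantified before p, \<open>E\<close> and the nearest-point choice. The
  first clause says that the operator is well defined on functions on \<open>E\<close>, which are
  represented here by total functions.\<close>

theorem mainTheorem10: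
  fixes m :: nat
  assumes "m \<ge> 1"
  shows "\<exists>C::real. \<forall>(p::real) (E::real set) (a::real set \<Rightarrow> real).
    1 < p \<and> closed E \<and> (infinite E \<or> card E \<ge> m + 1) \<and> nearest_point_choice E a \<longrightarrow>
      (\<forall>f \<in> trace_space m p E. \<forall>g \<in> trace_space m p E.
         (\<forall>x\<in>E. f x = g x) \<longrightarrow> Ext m E a f = Ext m E a g) \<and>
      (\<forall>f \<in> trace_space m p E. \<forall>g \<in> trace_space m p E. \<forall>\<alpha> \<beta> :: real.
         Ext m E a (\<lambda>x. \<alpha> * f x + \<beta> * g x) = (\<lambda>x. \<alpha> * Ext m E a f x + \<beta> * Ext m E a g x)) \<and>
      (\<forall>f \<in> trace_space m p E.
         Ext m E a f \<in> sobolev m p \<and>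
         (\<forall>x\<in>E. Ext m E a f x = f x) \<and>
         sobolev_norm m p (Ext m E a f) \<le> C * trace_norm m p E f)"
proof (intro exI[of _ "ext_const m"] allI impI)
  fix p :: real and E :: "real set" and a :: "real set \<Rightarrow> real"
  assume *: "1 < p \<and> closed E \<and> (infinite E \<or> card E \<ge> m + 1) \<and> nearest_point_choice E a"
  then interpret whitney m E a using assms by unfold_locales auto
  have p: "p > 1" using * by blast
  have "Ext m E a f \<in> sobolev m p" "\<forall>x\<in>E. Ext m E a f x = f x" if f: "f \<in> trace_space m p E" for f
  proof -
    obtain G where "whitney_ext m E a p f G" using trace_whitney_ext[OF p f] by metis
    then interpret f: whitney_ext m E a p f G .
    show "Ext m E a f \<in> sobolev m p" "\<forall>x\<in>E. Ext m E a f x = f x"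
      using f.Ext_sobolev f.Ext_extends by blast+
  qed
  moreover have "Ext m E a f = Ext m E a g" if "f \<in> trace_space m p E" "\<forall>x\<in>E. f x = g x" for f g
    using Ext_cong[OF p that(1)] that(2) by blast
  ultimately show "(\<forall>f \<in> trace_space m p E. \<forall>g \<in> trace_space m p E.
         (\<forall>x\<in>E. f x = g x) \<longrightarrow> Ext m E a f = Ext m E a g) \<and>
      (\<forall>f \<in> trace_space m p E. \<forall>g \<in> trace_space m p E. \<forall>\<alpha> \<beta> :: real.
         Ext m E a (\<lambda>x. \<alpha> * f x + \<beta> * g x) = (\<lambda>x. \<alpha> * Ext m E a f x + \<beta> * Ext m E a g x)) \<and>
      (\<forall>f \<in> trace_space m p E.
         Ext m E a f \<in> sobolev m p \<and>
         (\<forall>x\<in>E. Ext m E a f x = f x) \<and>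
         sobolev_norm m p (Ext m E a f) \<le> ext_const m * trace_norm m p E f)"
    using Ext_lincomb[OF p] Ext_trace_norm[OF p] by simp
qed

end
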